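(* Let $\Omega$ be a Hausdorff locally compact space, let $\mathcal{U}=\{\Omega,A_x,\Theta\}$ be a locally trivial continuous field of Banach algebras, and let the Banach algebra $\mathcal{A}$ be defined by $\mathcal{U}$. Then the following conditions are equivalent: (i) $\mathcal{A}$ is contractible; (ii) $\Omega$ is finite and discrete, and the Banach algebras $A_x$, $x\in\Omega$, are contractible; (iii) $\mathcal{H}^n(\mathcal{A},X)=\{0\}$ for any Banach $\mathcal{A}$-bimodule $X$ and all $n\ge1$.
   Context: Continuous fields. A continuous field of Banach algebras is a triple $\mathcal{U}=\{\Omega,A_t,\Theta\}$ where $\Omega$ is a locally compact Hausdorff space, $(A_t)_{t\in\Omega}$ is a family of Banach algebras, and $\Theta$ is a subalgebra of $\prod_{t\in\Omega}A_t$ such that: (i) for every $t\in\Omega$ the set $\{x(t):x\in\Theta\}$ is dense in $A_t$; (ii) for every $x\in\Theta$ the function $t\mapsto\|x(t)\|$ is continuous on $\Omega$; (iii) if $x\in\prod_{t}A_t$ and for every $t\in\Omega$ and every $\varepsilon>0$ there is $x'\in\Theta$ with $\|x(s)-x'(s)\|\le\varepsilon$ for all $s$ in some neighbourhood of $t$, then $x\in\Theta$. The Banach algebra $\mathcal{A}$ defined by $\mathcal{U}$ is the set of $x\in\Theta$ such that $t\mapsto\|x(t)\|$ vanishes at infinity on $\Omega$, with pointwise operations and norm $\|x\|=\sup_t\|x(t)\|$. For $Y\subseteq\Omega$, the induced field is $\mathcal{U}|_Y=\{Y,(A_t)_{t\in Y},\Theta|_Y\}$, where $\Theta|_Y$ is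 the set of $x\in\prod_{t\in Y}A_t$ such that for every $t_0\in Y$ and $\varepsilon>0$ there is $x'\in\Theta$ with $\|x(t)-x'(t)\|\le\varepsilon$ for all $t\in Y$ in some neighbourhood of $t_0$. An isomorphism of fields over the same space is a family of isometric algebra isomorphisms $\phi_t:A_t\to A'_t$ carrying $\Theta$ into $\Theta'$. The constant field over $\Omega$ defined by a Banach algebra $A$ has $A_t=A$ for all $t$ and $\Theta$ equal to the algebra of all continuous maps $\Omega\to A$. A field is trivial if it is isomorphic to a constant field, and locally trivial if every point of $\Omega$ has a neighbourhood $V$ such that $\mathcal{U}|_V$ is trivial. A Banach $B$-bimodule $P$ is projective if every epimorphism of Banach $B$-bimodules $\varphi:Y\to P$ that has a right inverse as a morphism of Banach spaces has a right inverse that is a bimodule morphism. A Banach algebra $B$ is contractible if $B_+$ (the Banach algebra obtained by adjoining an identity to $B$) is projective in the category of Banach $B$-bimodules; equivalently, $B$ is a projective Banach $B$-bimodule (biprojective) and has an identity. $\mathcal{H}^n(\mathcal{A},X)$ is the $n$th continuous Hochschild cohomology group of $\mathcal{A}$ with coefficients in the Banach $\mathcal{A}$-bimodule $X$, i.e. the cohomology of the complex of bounded $n$-linear maps $\mathcal{A}^n\to X$ with the usual Hochschild coboundary.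
   Formalization: All Banach algebras A_x are assumed nonzero (with all A_x = 0 over the real line, (i) and (iii) hold but (ii) fails); Banach bimodules range over an arbitrary sufficiently large universe, which contains a copy of any given bimodule. *)

theory Defs
  imports "HOL-Analysis.Analysis" "HOL-Algebra.Module" "HOL-Algebra.Elementary_Groups"
begin

section \<open>Banach spaces and Banach algebras with explicit carriers\<close>

text \<open>
  The fibres of a field vary with the point, and projectivity quantifies over all modules, so the
  structures are carrier-based, built on the modules of \<^theory>\<open>HOL-Algebra.Module\<close>. The scalars
  are the complex numbers. The record fields \<open>mult\<close> and \<open>one\<close> inherited from
  HOL-Algebra carry no meaning for Banach spaces and bimodules, and \<open>one\<close> carries none for
  Banach algebras, which need not have an identity.
\<close>

definition complex_scalars :: "complex ring" where
  "complex_scalars = \<lparr>carrier = UNIV, mult = (*), one = 1, zero = 0, add = (+)\<rparr>"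

record 'a normed_struct = "(complex, 'a) module" +
  nrm :: "'a \<Rightarrow> real"

text \<open>The value 0 outside the carrier is only there to satisfy the locale \<open>Metric_space\<close>, which
  asks for a symmetric nonnegative function on the whole type.\<close>

definition ndist :: "('a, 'm) normed_struct_scheme \<Rightarrow> 'a \<Rightarrow> 'a \<Rightarrow> real" where
  "ndist E x y = (if x \<in> carrier E \<and> y \<in> carrier E then nrm E (x \<ominus>\<^bsub>E\<^esub> y) else 0)"

abbreviation ntopology :: "('a, 'm) normed_struct_scheme \<Rightarrow> 'a topology" where
  "ntopology E \<equiv> Metric_space.mtopology (carrier E) (ndist E)"

locale banach_space = Module.module complex_scalars E for E (structure) +
  assumes nrm_nonneg: "x \<in> carrier E \<Longrightarrow> 0 \<le> nrm E x"
    and nrm_eq_0: "x \<in> carrier E \<Longrightarrow> nrm E x = 0 \<longleftrightarrow> x = \<zero>\<^bsub>E\<^esub>"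
    and nrm_triangle:
      "\<lbrakk>x \<in> carrier E; y \<in> carrier E\<rbrakk> \<Longrightarrow> nrm E (x \<oplus>\<^bsub>E\<^esub> y) \<le> nrm E x + nrm E y"
    and nrm_smult: "x \<in> carrier E \<Longrightarrow> nrm E (c \<odot>\<^bsub>E\<^esub> x) = cmod c * nrm E x"
    and complete: "Metric_space.mcomplete (carrier E) (ndist E)"

locale banach_algebra = banach_space A for A (structure) +
  assumes mult_closed: "\<lbrakk>x \<in> carrier A; y \<in> carrier A\<rbrakk> \<Longrightarrow> x \<otimes>\<^bsub>A\<^esub> y \<in> carrier A"
    and mult_assoc: "\<lbrakk>x \<in> carrier A; y \<in> carrier A; z \<in> carrier A\<rbrakk> \<Longrightarrow>
      (x \<otimes>\<^bsub>A\<^esub> y) \<otimes>\<^bsub>A\<^esub> z = x \<otimes>\<^bsub>A\<^esub> (y \<otimes>\<^bsub>A\<^esub> z)"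
    and mult_distl: "\<lbrakk>x \<in> carrier A; y \<in> carrier A; z \<in> carrier A\<rbrakk> \<Longrightarrow>
      (x \<oplus>\<^bsub>A\<^esub> y) \<otimes>\<^bsub>A\<^esub> z = (x \<otimes>\<^bsub>A\<^esub> z) \<oplus>\<^bsub>A\<^esub> (y \<otimes>\<^bsub>A\<^esub> z)"
    and mult_distr: "\<lbrakk>x \<in> carrier A; y \<in> carrier A; z \<in> carrier A\<rbrakk> \<Longrightarrow>
      x \<otimes>\<^bsub>A\<^esub> (y \<oplus>\<^bsub>A\<^esub> z) = (x \<otimes>\<^bsub>A\<^esub> y) \<oplus>\<^bsub>A\<^esub> (x \<otimes>\<^bsub>A\<^esub> z)"
    and smult_mult_left: "\<lbrakk>x \<in> carrier A; y \<in> carrier A\<rbrakk> \<Longrightarrow>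
      (c \<odot>\<^bsub>A\<^esub> x) \<otimes>\<^bsub>A\<^esub> y = c \<odot>\<^bsub>A\<^esub> (x \<otimes>\<^bsub>A\<^esub> y)"
    and smult_mult_right: "\<lbrakk>x \<in> carrier A; y \<in> carrier A\<rbrakk> \<Longrightarrow>
      x \<otimes>\<^bsub>A\<^esub> (c \<odot>\<^bsub>A\<^esub> y) = c \<odot>\<^bsub>A\<^esub> (x \<otimes>\<^bsub>A\<^esub> y)"
    and nrm_mult: "\<lbrakk>x \<in> carrier A; y \<in> carrier A\<rbrakk> \<Longrightarrow> nrm A (x \<otimes>\<^bsub>A\<^esub> y) \<le> nrm A x * nrm A y"

lemma (in banach_space) Metric_space_ndist: "Metric_space (carrier E) (ndist E)"
proof
  show "0 \<le> ndist E x y" for x y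
    by (simp add: ndist_def nrm_nonneg)
  have neg: "nrm E (\<ominus>\<^bsub>E\<^esub> x) = nrm E x" if x: "x \<in> carrier E" for x
  proof -
    have "\<ominus>\<^bsub>E\<^esub> x = (- 1) \<odot>\<^bsub>E\<^esub> x"
    proof -
      have "x \<oplus>\<^bsub>E\<^esub> (- 1) \<odot>\<^bsub>E\<^esub> x = \<zero>\<^bsub>E\<^esub>"
        using smult_l_distr[of 1 "- 1" x] smult_l_null[of x] smult_one[of x] x
        by (simp add: complex_scalars_def)
      then show ?thesis
        using x smult_closed[of "- 1" x] by (simp add: minus_equality M.a_comm complex_scalars_def)
    qed
    then show ?thesis
      using nrm_smult[OF x, of "- 1"] by simp
  qed
  show "ndist E x y = ndist E y x" for x y
  proof (cases "x \<in> carrier E \<and> y \<in> carrier E")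
    case True
    then have "y \<ominus>\<^bsub>E\<^esub> x = \<ominus>\<^bsub>E\<^esub> (x \<ominus>\<^bsub>E\<^esub> y)"
      by (simp add: a_minus_def minus_add M.a_comm)
    then show ?thesis
      using True neg by (simp add: ndist_def)
  qed (auto simp: ndist_def)
  show "ndist E x y = 0 \<longleftrightarrow> x = y" if "x \<in> carrier E" "y \<in> carrier E" for x y
  proof -
    have "x \<ominus>\<^bsub>E\<^esub> y = \<zero>\<^bsub>E\<^esub> \<longleftrightarrow> x = y"
      using that by (metis M.a_inv_closed M.minus_equality M.minus_minus M.r_neg a_minus_def)
    then show ?thesis
      using that by (simp add: ndist_def nrm_eq_0)
  qed
  show "ndist E x z \<le> ndist E x y + ndist E y z"
    if "x \<in> carrier E" "y \<in> carrier E" "z \<in> carrier E" for x y z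
  proof -
    have "x \<ominus>\<^bsub>E\<^esub> z = (x \<ominus>\<^bsub>E\<^esub> y) \<oplus>\<^bsub>E\<^esub> (y \<ominus>\<^bsub>E\<^esub> z)"
    proof -
      have "\<ominus>\<^bsub>E\<^esub> y \<oplus>\<^bsub>E\<^esub> (y \<oplus>\<^bsub>E\<^esub> \<ominus>\<^bsub>E\<^esub> z) = \<ominus>\<^bsub>E\<^esub> z"
        using that by (simp add: M.a_assoc[symmetric] M.l_neg)
      then show ?thesis
        using that by (simp add: a_minus_def M.a_assoc)
    qed
    then show ?thesis
      using that nrm_triangle[of "x \<ominus>\<^bsub>E\<^esub> y" "y \<ominus>\<^bsub>E\<^esub> z"] by (simp add: ndist_def)
  qed
qed

definition isometric_algebra_iso ::
    "('a, 'm) normed_struct_scheme \<Rightarrow> ('b, 'n) normed_struct_scheme \<Rightarrow> ('a \<Rightarrow> 'b) \<Rightarrow> bool" where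
  "isometric_algebra_iso A B f \<longleftrightarrow>
     bij_betw f (carrier A) (carrier B) \<and>
     (\<forall>x\<in>carrier A. \<forall>y\<in>carrier A. f (x \<oplus>\<^bsub>A\<^esub> y) = f x \<oplus>\<^bsub>B\<^esub> f y) \<and>
     (\<forall>c. \<forall>x\<in>carrier A. f (c \<odot>\<^bsub>A\<^esub> x) = c \<odot>\<^bsub>B\<^esub> f x) \<and>
     (\<forall>x\<in>carrier A. \<forall>y\<in>carrier A. f (x \<otimes>\<^bsub>A\<^esub> y) = f x \<otimes>\<^bsub>B\<^esub> f y) \<and>
     (\<forall>x\<in>carrier A. nrm B (f x) = nrm A x)"

section \<open>Continuous fields of Banach algebras\<close>

text \<open>
  A field is a base space, fibres, and a set of sections; the last is the \<open>\<Theta>\<close> of the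
  definition. Elements of the product of the fibres are extensional functions on the base space.
  The norm of \<open>prod_struct\<close> is meaningful for bounded sections only; inserting 0 makes it correct
  also over the empty base space.
\<close>

record ('t, 'a) banach_field =
  base :: "'t topology"
  fibre :: "'t \<Rightarrow> 'a normed_struct"
  sections :: "('t \<Rightarrow> 'a) set"

definition prod_struct :: "'t set \<Rightarrow> ('t \<Rightarrow> 'a normed_struct) \<Rightarrow> ('t \<Rightarrow> 'a) normed_struct" where
  "prod_struct I A =
     \<lparr>carrier = (\<Pi>\<^sub>E t\<in>I. carrier (A t)),
      mult = (\<lambda>x y. \<lambda>t\<in>I. x t \<otimes>\<^bsub>A t\<^esub> y t),
      one = (\<lambda>t\<in>I. \<one>\<^bsub>A t\<^esub>),
      zero = (\<lambda>t\<in>I. \<zero>\<^bsub>A t\<^esub>),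
      add = (\<lambda>x y. \<lambda>t\<in>I. x t \<oplus>\<^bsub>A t\<^esub> y t),
      smult = (\<lambda>c x. \<lambda>t\<in>I. c \<odot>\<^bsub>A t\<^esub> x t),
      nrm = (\<lambda>x. Sup (insert 0 ((\<lambda>t. nrm (A t) (x t)) ` I)))\<rparr>"

definition locally_approximable ::
    "'t topology \<Rightarrow> ('t \<Rightarrow> 'a normed_struct) \<Rightarrow> ('t \<Rightarrow> 'a) set \<Rightarrow> ('t \<Rightarrow> 'a) \<Rightarrow> bool" where
  "locally_approximable X A S x \<longleftrightarrow>
     (\<forall>t\<in>topspace X. \<forall>\<epsilon>>0. \<exists>x'\<in>S. \<exists>V. openin X V \<and> t \<in> V \<and>
        (\<forall>s\<in>V. nrm (A s) (x s \<ominus>\<^bsub>A s\<^esub> x' s) \<le> \<epsilon>))"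

definition continuous_field :: "('t, 'a) banach_field \<Rightarrow> bool" where
  "continuous_field U \<longleftrightarrow>
     Hausdorff_space (base U) \<and> locally_compact_space (base U) \<and>
     (\<forall>t\<in>topspace (base U). banach_algebra (fibre U t)) \<and>
     submodule (sections U) complex_scalars (prod_struct (topspace (base U)) (fibre U)) \<and>
     (\<forall>x\<in>sections U. \<forall>y\<in>sections U.
        x \<otimes>\<^bsub>prod_struct (topspace (base U)) (fibre U)\<^esub> y \<in> sections U) \<and>
     (\<forall>t\<in>topspace (base U).
        (ntopology (fibre U t)) closure_of {x t |x. x \<in> sections U} = carrier (fibre U t)) \<and>
     (\<forall>x\<in>sections U.
        continuous_map (base U) euclideanreal (\<lambda>t. nrm (fibre U t) (x t))) \<and>
     (\<forall>x \<in> (\<Pi>\<^sub>E t\<in>topspace (base U). carrier (fibre U t)).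
        locally_approximable (base U) (fibre U) (sections U) x \<longrightarrow> x \<in> sections U)"

definition vanishes_at_infinity :: "'t topology \<Rightarrow> ('t \<Rightarrow> real) \<Rightarrow> bool" where
  "vanishes_at_infinity X f \<longleftrightarrow>
     (\<forall>\<epsilon>>0. \<exists>K. compactin X K \<and> (\<forall>t \<in> topspace X - K. \<bar>f t\<bar> < \<epsilon>))"

definition field_algebra :: "('t, 'a) banach_field \<Rightarrow> ('t \<Rightarrow> 'a) normed_struct" where
  "field_algebra U = (prod_struct (topspace (base U)) (fibre U))
     \<lparr>carrier := {x \<in> sections U. vanishes_at_infinity (base U) (\<lambda>t. nrm (fibre U t) (x t))}\<rparr>"

definition restrict_field :: "('t, 'a) banach_field \<Rightarrow> 't set \<Rightarrow> ('t, 'a) banach_field" where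
  "restrict_field U Y =
     \<lparr>base = subtopology (base U) Y,
      fibre = fibre U,
      sections = {x \<in> (\<Pi>\<^sub>E t\<in>Y. carrier (fibre U t)).
        locally_approximable (subtopology (base U) Y) (fibre U) (sections U) x}\<rparr>"

definition constant_field :: "'t topology \<Rightarrow> 'a normed_struct \<Rightarrow> ('t, 'a) banach_field" where
  "constant_field X A =
     \<lparr>base = X,
      fibre = (\<lambda>_. A),
      sections = {x \<in> extensional (topspace X). continuous_map X (ntopology A) x}\<rparr>"

definition field_iso :: "('t, 'a) banach_field \<Rightarrow> ('t, 'b) banach_field \<Rightarrow> ('t \<Rightarrow> 'a \<Rightarrow> 'b) \<Rightarrow> bool"
  where
  "field_iso U U' \<phi> \<longleftrightarrow>
     base U = base U' \<and>
     (\<forall>t\<in>topspace (base U). isometric_algebra_iso (fibre U t) (fibre U' t) (\<phi> t)) \<and>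
     (\<forall>x\<in>sections U. (\<lambda>t\<in>topspace (base U). \<phi> t (x t)) \<in> sections U')"

text \<open>Over a nonempty base space a constant field isomorphic to \<open>U\<close> is defined by an algebra
  isometrically isomorphic to every fibre, so nothing is lost by taking that algebra in the type
  of the fibres.\<close>

definition trivial_field :: "('t, 'a) banach_field \<Rightarrow> bool" where
  "trivial_field U \<longleftrightarrow>
     (\<exists>(A :: 'a normed_struct) \<phi>. banach_algebra A \<and> field_iso U (constant_field (base U) A) \<phi>)"

definition locally_trivial :: "('t, 'a) banach_field \<Rightarrow> bool" where
  "locally_trivial U \<longleftrightarrow>
     (\<forall>t\<in>topspace (base U). \<exists>W V. openin (base U) W \<and> t \<in> W \<and> W \<subseteq> V \<and>
        V \<subseteq> topspace (base U) \<and> trivial_field (restrict_field U V))"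

section \<open>Banach bimodules, projectivity and contractibility\<close>

record ('a, 'x) bimodule = "'x normed_struct" +
  lact :: "'a \<Rightarrow> 'x \<Rightarrow> 'x"
  ract :: "'x \<Rightarrow> 'a \<Rightarrow> 'x"

locale banach_bimodule = B: banach_algebra B + X: banach_space X
  for B :: "('a, 'm) normed_struct_scheme" and X :: "('a, 'x, 'n) bimodule_scheme" +
  assumes lact_closed: "\<lbrakk>a \<in> carrier B; x \<in> carrier X\<rbrakk> \<Longrightarrow> lact X a x \<in> carrier X"
    and ract_closed: "\<lbrakk>a \<in> carrier B; x \<in> carrier X\<rbrakk> \<Longrightarrow> ract X x a \<in> carrier X"
    and lact_add: "\<lbrakk>a \<in> carrier B; x \<in> carrier X; y \<in> carrier X\<rbrakk> \<Longrightarrow>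
      lact X a (x \<oplus>\<^bsub>X\<^esub> y) = lact X a x \<oplus>\<^bsub>X\<^esub> lact X a y"
    and add_lact: "\<lbrakk>a \<in> carrier B; b \<in> carrier B; x \<in> carrier X\<rbrakk> \<Longrightarrow>
      lact X (a \<oplus>\<^bsub>B\<^esub> b) x = lact X a x \<oplus>\<^bsub>X\<^esub> lact X b x"
    and lact_smult: "\<lbrakk>a \<in> carrier B; x \<in> carrier X\<rbrakk> \<Longrightarrow>
      lact X a (c \<odot>\<^bsub>X\<^esub> x) = c \<odot>\<^bsub>X\<^esub> lact X a x"
    and smult_lact: "\<lbrakk>a \<in> carrier B; x \<in> carrier X\<rbrakk> \<Longrightarrow>
      lact X (c \<odot>\<^bsub>B\<^esub> a) x = c \<odot>\<^bsub>X\<^esub> lact X a x"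
    and ract_add: "\<lbrakk>a \<in> carrier B; x \<in> carrier X; y \<in> carrier X\<rbrakk> \<Longrightarrow>
      ract X (x \<oplus>\<^bsub>X\<^esub> y) a = ract X x a \<oplus>\<^bsub>X\<^esub> ract X y a"
    and add_ract: "\<lbrakk>a \<in> carrier B; b \<in> carrier B; x \<in> carrier X\<rbrakk> \<Longrightarrow>
      ract X x (a \<oplus>\<^bsub>B\<^esub> b) = ract X x a \<oplus>\<^bsub>X\<^esub> ract X x b"
    and ract_smult: "\<lbrakk>a \<in> carrier B; x \<in> carrier X\<rbrakk> \<Longrightarrow>
      ract X (c \<odot>\<^bsub>X\<^esub> x) a = c \<odot>\<^bsub>X\<^esub> ract X x a"
    and smult_ract: "\<lbrakk>a \<in> carrier B; x \<in> carrier X\<rbrakk> \<Longrightarrow>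
      ract X x (c \<odot>\<^bsub>B\<^esub> a) = c \<odot>\<^bsub>X\<^esub> ract X x a"
    and lact_assoc: "\<lbrakk>a \<in> carrier B; b \<in> carrier B; x \<in> carrier X\<rbrakk> \<Longrightarrow>
      lact X (a \<otimes>\<^bsub>B\<^esub> b) x = lact X a (lact X b x)"
    and ract_assoc: "\<lbrakk>a \<in> carrier B; b \<in> carrier B; x \<in> carrier X\<rbrakk> \<Longrightarrow>
      ract X x (a \<otimes>\<^bsub>B\<^esub> b) = ract X (ract X x a) b"
    and lact_ract: "\<lbrakk>a \<in> carrier B; b \<in> carrier B; x \<in> carrier X\<rbrakk> \<Longrightarrow>
      lact X a (ract X x b) = ract X (lact X a x) b"
    and act_bounded: "\<exists>C. \<forall>a\<in>carrier B. \<forall>x\<in>carrier X.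
      nrm X (lact X a x) \<le> C * nrm B a * nrm X x \<and> nrm X (ract X x a) \<le> C * nrm B a * nrm X x"

definition bounded_linear_map ::
    "('x, 'm) normed_struct_scheme \<Rightarrow> ('y, 'n) normed_struct_scheme \<Rightarrow> ('x \<Rightarrow> 'y) \<Rightarrow> bool" where
  "bounded_linear_map E F f \<longleftrightarrow>
     f \<in> carrier E \<rightarrow> carrier F \<and>
     (\<forall>x\<in>carrier E. \<forall>y\<in>carrier E. f (x \<oplus>\<^bsub>E\<^esub> y) = f x \<oplus>\<^bsub>F\<^esub> f y) \<and>
     (\<forall>c. \<forall>x\<in>carrier E. f (c \<odot>\<^bsub>E\<^esub> x) = c \<odot>\<^bsub>F\<^esub> f x) \<and>
     (\<exists>C. \<forall>x\<in>carrier E. nrm F (f x) \<le> C * nrm E x)"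

definition bimodule_morphism ::
    "('a, 'm) normed_struct_scheme \<Rightarrow> ('a, 'x, 'n) bimodule_scheme \<Rightarrow> ('a, 'y, 'o) bimodule_scheme
      \<Rightarrow> ('x \<Rightarrow> 'y) \<Rightarrow> bool" where
  "bimodule_morphism B X Y f \<longleftrightarrow>
     bounded_linear_map X Y f \<and>
     (\<forall>a\<in>carrier B. \<forall>x\<in>carrier X. f (lact X a x) = lact Y a (f x) \<and> f (ract X x a) = ract Y (f x) a)"

text \<open>
  The quantifier over all bimodules \<open>Y\<close> is a quantifier over the bimodules whose elements belong
  to the type given as the first argument, the universe of modules. A universe that is too small
  makes the condition weaker than projectivity. One into which the sequences of elements of the
  unitization of \<open>B\<close> embed is large enough to contain the projective tensor powers of the
  unitization that are used to test it. In the presence of a linear right inverse every reading of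
  "epimorphism" amounts to surjectivity.
\<close>

definition projective_bimodule ::
    "'u itself \<Rightarrow> ('a, 'm) normed_struct_scheme \<Rightarrow> ('a, 'x, 'n) bimodule_scheme \<Rightarrow> bool" where
  "projective_bimodule u B P \<longleftrightarrow>
     banach_bimodule B P \<and>
     (\<forall>(Y :: ('a, 'u) bimodule) \<phi>.
        banach_bimodule B Y \<and> bimodule_morphism B Y P \<phi> \<and> \<phi> ` carrier Y = carrier P \<and>
        (\<exists>\<sigma>. bounded_linear_map P Y \<sigma> \<and> (\<forall>p\<in>carrier P. \<phi> (\<sigma> p) = p)) \<longrightarrow>
        (\<exists>\<rho>. bimodule_morphism B P Y \<rho> \<and> (\<forall>p\<in>carrier P. \<phi> (\<rho> p) = p)))"

text \<open>The pair \<open>(a, s)\<close> stands for \<open>a + s e\<close> with \<open>e\<close> the adjoined identity; an identity is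
  adjoined even if \<open>B\<close> already has one.\<close>

definition unitization :: "('a, 'm) normed_struct_scheme \<Rightarrow> ('a \<times> complex) normed_struct" where
  "unitization B =
     \<lparr>carrier = carrier B \<times> UNIV,
      mult = (\<lambda>(a, s) (b, r). ((a \<otimes>\<^bsub>B\<^esub> b) \<oplus>\<^bsub>B\<^esub> (r \<odot>\<^bsub>B\<^esub> a \<oplus>\<^bsub>B\<^esub> s \<odot>\<^bsub>B\<^esub> b), s * r)),
      one = (\<zero>\<^bsub>B\<^esub>, 1),
      zero = (\<zero>\<^bsub>B\<^esub>, 0),
      add = (\<lambda>(a, s) (b, r). (a \<oplus>\<^bsub>B\<^esub> b, s + r)),
      smult = (\<lambda>c (a, s). (c \<odot>\<^bsub>B\<^esub> a, c * s)),
      nrm = (\<lambda>(a, s). nrm B a + cmod s)\<rparr>"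

definition unitization_bimodule ::
    "('a, 'm) normed_struct_scheme \<Rightarrow> ('a, 'a \<times> complex) bimodule" where
  "unitization_bimodule B = normed_struct.extend (unitization B)
     \<lparr>lact = (\<lambda>a p. (a, 0) \<otimes>\<^bsub>unitization B\<^esub> p), ract = (\<lambda>p a. p \<otimes>\<^bsub>unitization B\<^esub> (a, 0))\<rparr>"

definition contractible_algebra :: "'u itself \<Rightarrow> ('a, 'm) normed_struct_scheme \<Rightarrow> bool" where
  "contractible_algebra u B \<longleftrightarrow> projective_bimodule u B (unitization_bimodule B)"

section \<open>Continuous Hochschild cohomology\<close>

text \<open>
  Elements of the \<open>n\<close>-fold power of \<open>B\<close> are lists of length \<open>n\<close>, and a cochain is extensional
  (\<open>undefined\<close> outside these lists).
\<close>

definition tuples :: "('a, 'm) normed_struct_scheme \<Rightarrow> nat \<Rightarrow> 'a list set" where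
  "tuples B n = {as. length as = n \<and> set as \<subseteq> carrier B}"

definition cochains ::
    "('a, 'm) normed_struct_scheme \<Rightarrow> ('a, 'x, 'n) bimodule_scheme \<Rightarrow> nat \<Rightarrow> ('a list \<Rightarrow> 'x) set" where
  "cochains B X n = {f \<in> tuples B n \<rightarrow>\<^sub>E carrier X.
     (\<forall>as\<in>tuples B n. \<forall>i<n. \<forall>a\<in>carrier B. \<forall>b\<in>carrier B.
        f (as[i := a \<oplus>\<^bsub>B\<^esub> b]) = f (as[i := a]) \<oplus>\<^bsub>X\<^esub> f (as[i := b])) \<and>
     (\<forall>as\<in>tuples B n. \<forall>i<n. \<forall>a\<in>carrier B. \<forall>c.
        f (as[i := c \<odot>\<^bsub>B\<^esub> a]) = c \<odot>\<^bsub>X\<^esub> f (as[i := a])) \<and>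
     (\<exists>C. \<forall>as\<in>tuples B n. nrm X (f as) \<le> C * (\<Prod>i<n. nrm B (as ! i)))}"

definition cochain_group ::
    "('a, 'm) normed_struct_scheme \<Rightarrow> ('a, 'x, 'n) bimodule_scheme \<Rightarrow> nat \<Rightarrow> ('a list \<Rightarrow> 'x) monoid"
  where
  "cochain_group B X n =
     \<lparr>carrier = cochains B X n,
      mult = (\<lambda>f g. \<lambda>as\<in>tuples B n. f as \<oplus>\<^bsub>X\<^esub> g as),
      one = (\<lambda>as\<in>tuples B n. \<zero>\<^bsub>X\<^esub>)\<rparr>"

text \<open>
  With arguments numbered from 0, the coboundary of an \<open>n\<close>-cochain sends \<open>(a\<^sub>0, \<dots>, a\<^sub>n)\<close> to
  \<open>a\<^sub>0 f(a\<^sub>1, \<dots>, a\<^sub>n) + (\<Sum>i<n. (-1)\<^sup>i\<^sup>+\<^sup>1 f(\<dots>, a\<^sub>i a\<^sub>i\<^sub>+\<^sub>1, \<dots>)) + (-1)\<^sup>n\<^sup>+\<^sup>1 f(a\<^sub>0, \<dots>, a\<^sub>n\<^sub>-\<^sub>1) a\<^sub>n\<close>.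
\<close>

definition coboundary ::
    "('a, 'm) normed_struct_scheme \<Rightarrow> ('a, 'x, 'n) bimodule_scheme \<Rightarrow> nat \<Rightarrow>
      ('a list \<Rightarrow> 'x) \<Rightarrow> 'a list \<Rightarrow> 'x" where
  "coboundary B X n f = (\<lambda>as\<in>tuples B (Suc n).
     lact X (hd as) (f (tl as)) \<oplus>\<^bsub>X\<^esub>
     (\<Oplus>\<^bsub>X\<^esub>i\<in>{..<n}. ((-1) ^ Suc i) \<odot>\<^bsub>X\<^esub>
         f (take i as @ [as ! i \<otimes>\<^bsub>B\<^esub> as ! Suc i] @ drop (i + 2) as)) \<oplus>\<^bsub>X\<^esub>
     ((-1) ^ Suc n) \<odot>\<^bsub>X\<^esub> ract X (f (butlast as)) (last as))"

definition cocycles ::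
    "('a, 'm) normed_struct_scheme \<Rightarrow> ('a, 'x, 'n) bimodule_scheme \<Rightarrow> nat \<Rightarrow> ('a list \<Rightarrow> 'x) set" where
  "cocycles B X n = {f \<in> cochains B X n. coboundary B X n f = \<one>\<^bsub>cochain_group B X (Suc n)\<^esub>}"

definition coboundaries ::
    "('a, 'm) normed_struct_scheme \<Rightarrow> ('a, 'x, 'n) bimodule_scheme \<Rightarrow> nat \<Rightarrow> ('a list \<Rightarrow> 'x) set" where
  "coboundaries B X n =
     (case n of 0 \<Rightarrow> {\<one>\<^bsub>cochain_group B X 0\<^esub>} | Suc m \<Rightarrow> coboundary B X m ` cochains B X m)"

definition hochschild_cohomology ::
    "('a, 'm) normed_struct_scheme \<Rightarrow> ('a, 'x, 'n) bimodule_scheme \<Rightarrow> nat \<Rightarrow>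
      ('a list \<Rightarrow> 'x) set monoid" where
  "hochschild_cohomology B X n =
     (cochain_group B X n)\<lparr>carrier := cocycles B X n\<rparr> Mod coboundaries B X n"

end

theory Submission
  imports Defs
begin

text \<open>
  A Banach algebra \<open>B\<close> is contractible exactly when all bounded derivations of \<open>B\<close> into Banach
  bimodules are inner, and this criterion replaces projective tensor products throughout. If \<open>B\<close> is
  contractible and \<open>D\<close> is a derivation into \<open>X\<close>, then twisting the right action on the direct sum of
  \<open>X\<close> and the unitization by \<open>D\<close> gives an extension of the unitization, and a bimodule splitting of
  it makes \<open>D\<close> inner (\<open>contractible_imp_inner\<close>). Conversely, if \<open>y\<close> is a preimage of the adjoined
  identity under an epimorphism onto the unitization, then the commutator with \<open>y\<close> is a derivation
  into the kernel. If it is inner there, \<open>y\<close> can be made central, and a central preimage is the same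
  as a bimodule splitting (\<open>inner_imp_contractible\<close>).

  Vanishing of the first cohomology is the criterion itself. The higher degrees follow by induction,
  because an \<open>n + 1\<close>-cocycle with values in \<open>X\<close> is an \<open>n\<close>-cocycle with values in the bimodule of
  bounded operators from \<open>B\<close> to \<open>X\<close> (\<open>dimension_shift\<close>).

  Twisted extensions and operator bimodules need not belong to the universe over which the modules
  range. But the proofs use only closed submodules generated by values that are indexed by elements
  or tuples of elements of the unitization. Their elements are limits of sequences of finite
  expressions, so they can be coded by sequences in the unitization, and those fit into the universe
  (\<open>small_submodule_in_universe\<close>).

  Let now the algebra of a locally trivial field be contractible. It has an identity, whose value at
  a point is the identity of a nonzero fibre and has norm at least 1. Since it vanishes at infinity,
  the base is compact. Near a point \<open>t0\<close> all fibres are copies of one algebra, so the values of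
  a section at \<open>t0\<close> and at nearby points can be subtracted. This difference is a derivation into a
  module of functions vanishing at \<open>t0\<close>, and it can be inner only if \<open>t0\<close> is isolated
  (\<open>contractible_imp_isolated\<close>). Hence the base is finite and discrete. The fibres are contractible
  because evaluation at a point has dense image (\<open>contractible_dense_image\<close>). Conversely, over
  a finite discrete base the algebra is the direct sum of the fibres, and a derivation is made inner
  on one fibre after another (\<open>finite_discrete_imp_contractible\<close>).
\<close>

section \<open>Banach spaces with explicit carriers\<close>

lemma complex_scalars_simps [simp]:
  "carrier complex_scalars = UNIV"
  "c \<otimes>\<^bsub>complex_scalars\<^esub> d = c * d"
  "c \<oplus>\<^bsub>complex_scalars\<^esub> d = c + d"
  "\<one>\<^bsub>complex_scalars\<^esub> = 1"
  "\<zero>\<^bsub>complex_scalars\<^esub> = 0"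
  by (simp_all add: complex_scalars_def)

lemma cring_complex_scalars: "cring complex_scalars"
proof (rule cringI)
  show "abelian_group complex_scalars"
  proof (rule abelian_groupI)
    fix x :: complex
    have "- x \<oplus>\<^bsub>complex_scalars\<^esub> x = \<zero>\<^bsub>complex_scalars\<^esub>"
      by simp
    then show "\<exists>y\<in>carrier complex_scalars. y \<oplus>\<^bsub>complex_scalars\<^esub> x = \<zero>\<^bsub>complex_scalars\<^esub>"
      by (metis UNIV_I complex_scalars_simps(1))
  qed simp_all
  show "comm_monoid complex_scalars"
    by (rule comm_monoidI) simp_all
qed (simp add: algebra_simps)

lemma null_squeeze:
  fixes f g :: "nat \<Rightarrow> real"
  assumes "\<And>n. \<bar>f n\<bar> \<le> g n" "g \<longlonglongrightarrow> 0"
  shows "f \<longlonglongrightarrow> 0"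
  by (rule Lim_null_comparison[of f g]) (use assms in auto)

text \<open>
  The distance of two elements. The additive inverse of a carrier-based group depends on the carrier,
  whereas the multiple by \<open>- 1\<close> does not, so in this form the distance stays the same when the
  carrier shrinks.
\<close>

definition gap :: "('a, 'm) normed_struct_scheme \<Rightarrow> 'a \<Rightarrow> 'a \<Rightarrow> real" where
  "gap E x y = nrm E (x \<oplus>\<^bsub>E\<^esub> (- 1) \<odot>\<^bsub>E\<^esub> y)"

definition converges :: "('a, 'm) normed_struct_scheme \<Rightarrow> (nat \<Rightarrow> 'a) \<Rightarrow> 'a \<Rightarrow> bool" where
  "converges E s l \<longleftrightarrow> (\<lambda>n. gap E (s n) l) \<longlonglongrightarrow> 0"

definition cauchy_seq :: "('a, 'm) normed_struct_scheme \<Rightarrow> (nat \<Rightarrow> 'a) \<Rightarrow> bool" where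
  "cauchy_seq E s \<longleftrightarrow> (\<forall>\<epsilon>>0. \<exists>N. \<forall>m\<ge>N. \<forall>n\<ge>N. gap E (s m) (s n) < \<epsilon>)"

context banach_space
begin

lemma smult_mem [simp, intro]: "x \<in> carrier E \<Longrightarrow> c \<odot> x \<in> carrier E"
  by (rule smult_closed) simp_all

lemma sm_add: "x \<in> carrier E \<Longrightarrow> (c + d) \<odot> x = c \<odot> x \<oplus> d \<odot> x"
  using smult_l_distr[of c d x] by simp

lemma sm_plus: "\<lbrakk>x \<in> carrier E; y \<in> carrier E\<rbrakk> \<Longrightarrow> c \<odot> (x \<oplus> y) = c \<odot> x \<oplus> c \<odot> y"
  using smult_r_distr[of c x y] by simp

lemma sm_sm: "x \<in> carrier E \<Longrightarrow> c \<odot> (d \<odot> x) = (c * d) \<odot> x"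
  using smult_assoc1[of c d x] by simp

lemma sm_1 [simp]: "x \<in> carrier E \<Longrightarrow> 1 \<odot> x = x"
  using smult_one[of x] by simp

lemma sm_0 [simp]: "x \<in> carrier E \<Longrightarrow> 0 \<odot> x = \<zero>\<^bsub>E\<^esub>"
  using smult_l_null[of x] by simp

lemma sm_zero [simp]: "c \<odot> \<zero>\<^bsub>E\<^esub> = \<zero>\<^bsub>E\<^esub>"
  using smult_r_null[of c] by simp

lemma cancel_neg [simp]:
  assumes "x \<in> carrier E"
  shows "x \<oplus> (- 1) \<odot> x = \<zero>\<^bsub>E\<^esub>" "(- 1) \<odot> x \<oplus> x = \<zero>\<^bsub>E\<^esub>"
  using sm_add[of x 1 "- 1"] sm_add[of x "- 1" 1] assms by simp_all

lemma cancel_neg2 [simp]: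
  assumes "x \<in> carrier E" "y \<in> carrier E"
  shows "x \<oplus> ((- 1) \<odot> x \<oplus> y) = y" "(- 1) \<odot> x \<oplus> (x \<oplus> y) = y"
  using assms by (simp_all add: M.a_assoc[symmetric])

lemma neg_eq_sm: "x \<in> carrier E \<Longrightarrow> \<ominus>\<^bsub>E\<^esub> x = (- 1) \<odot> x"
  by (rule M.minus_equality) simp_all

lemma minus_eq_sm: "\<lbrakk>x \<in> carrier E; y \<in> carrier E\<rbrakk> \<Longrightarrow> x \<ominus>\<^bsub>E\<^esub> y = x \<oplus> (- 1) \<odot> y"
  by (simp add: a_minus_def neg_eq_sm)

lemma eq_iff_diff: "\<lbrakk>x \<in> carrier E; y \<in> carrier E\<rbrakk> \<Longrightarrow> x = y \<longleftrightarrow> x \<oplus> (- 1) \<odot> y = \<zero>\<^bsub>E\<^esub>"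
proof -
  assume xy: "x \<in> carrier E" "y \<in> carrier E"
  have "x = y" if "x \<oplus> (- 1) \<odot> y = \<zero>\<^bsub>E\<^esub>"
  proof -
    have "(x \<oplus> (- 1) \<odot> y) \<oplus> y = x"
      using xy by (simp add: M.a_assoc)
    then show ?thesis
      using that xy by simp
  qed
  then show ?thesis
    using xy by auto
qed

lemma nrm_zero [simp]: "nrm E \<zero>\<^bsub>E\<^esub> = 0"
  using nrm_eq_0[of "\<zero>\<^bsub>E\<^esub>"] by simp

lemma gap_eq_nrm: "\<lbrakk>x \<in> carrier E; y \<in> carrier E\<rbrakk> \<Longrightarrow> gap E x y = nrm E (x \<ominus>\<^bsub>E\<^esub> y)"
  by (simp add: gap_def minus_eq_sm)

lemma gap_nonneg [simp]: "\<lbrakk>x \<in> carrier E; y \<in> carrier E\<rbrakk> \<Longrightarrow> 0 \<le> gap E x y"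
  by (simp add: gap_def nrm_nonneg)

lemma gap_0_iff: "\<lbrakk>x \<in> carrier E; y \<in> carrier E\<rbrakk> \<Longrightarrow> gap E x y = 0 \<longleftrightarrow> x = y"
  by (simp add: gap_def nrm_eq_0 flip: eq_iff_diff)

lemma gap_zero_right [simp]: "x \<in> carrier E \<Longrightarrow> gap E x \<zero>\<^bsub>E\<^esub> = nrm E x"
  by (simp add: gap_def)

lemma gap_smult: "\<lbrakk>x \<in> carrier E; y \<in> carrier E\<rbrakk> \<Longrightarrow> gap E (c \<odot> x) (c \<odot> y) = cmod c * gap E x y"
  using nrm_smult[of "x \<oplus> (- 1) \<odot> y" c]
  by (simp add: gap_def sm_plus sm_sm)

lemma gap_plus:
  assumes "x \<in> carrier E" "y \<in> carrier E" "x' \<in> carrier E" "y' \<in> carrier E"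
  shows "gap E (x \<oplus> y) (x' \<oplus> y') \<le> gap E x x' + gap E y y'"
proof -
  have "(x \<oplus> y) \<oplus> (- 1) \<odot> (x' \<oplus> y') = (x \<oplus> (- 1) \<odot> x') \<oplus> (y \<oplus> (- 1) \<odot> y')"
    using assms by (simp add: sm_plus M.a_ac)
  then show ?thesis
    using assms nrm_triangle[of "x \<oplus> (- 1) \<odot> x'" "y \<oplus> (- 1) \<odot> y'"] by (simp add: gap_def)
qed

lemma gap_commute: "\<lbrakk>x \<in> carrier E; y \<in> carrier E\<rbrakk> \<Longrightarrow> gap E x y = gap E y x"
proof -
  assume xy: "x \<in> carrier E" "y \<in> carrier E"
  then have "y \<oplus> (- 1) \<odot> x = (- 1) \<odot> (x \<oplus> (- 1) \<odot> y)"
    using M.a_comm[of y "(- 1) \<odot> x"] by (simp add: sm_plus sm_sm)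
  then have "nrm E (y \<oplus> (- 1) \<odot> x) = nrm E (x \<oplus> (- 1) \<odot> y)"
    using nrm_smult[of "x \<oplus> (- 1) \<odot> y" "- 1"] xy by simp
  then show ?thesis
    by (simp add: gap_def)
qed

lemma gap_triangle:
  assumes "x \<in> carrier E" "y \<in> carrier E" "z \<in> carrier E"
  shows "gap E x z \<le> gap E x y + gap E y z"
proof -
  have "x \<oplus> (- 1) \<odot> z = (x \<oplus> (- 1) \<odot> y) \<oplus> (y \<oplus> (- 1) \<odot> z)"
    using assms by (simp add: M.a_assoc)
  then show ?thesis
    using assms nrm_triangle[of "x \<oplus> (- 1) \<odot> y" "y \<oplus> (- 1) \<odot> z"] by (simp add: gap_def)
qed

lemma nrm_le_gap:
  assumes "x \<in> carrier E" "y \<in> carrier E"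
  shows "nrm E x \<le> nrm E y + gap E x y"
  using gap_triangle[of x y "\<zero>\<^bsub>E\<^esub>"] assms by simp

lemma converges_unique:
  assumes "converges E s l" "converges E s l'" "\<And>n. s n \<in> carrier E"
    "l \<in> carrier E" "l' \<in> carrier E"
  shows "l = l'"
proof -
  have "(\<lambda>n. gap E (s n) l + gap E (s n) l') \<longlonglongrightarrow> 0 + 0"
    using assms unfolding converges_def by (intro tendsto_add)
  moreover have "gap E l l' \<le> gap E (s n) l + gap E (s n) l'" for n
    using gap_triangle[of l "s n" l'] gap_commute[of l "s n"] assms by simp
  ultimately have "gap E l l' \<le> 0"
    by (intro LIMSEQ_le_const[where X = "\<lambda>n. gap E (s n) l + gap E (s n) l'"]) auto
  then show ?thesis
    using gap_0_iff[OF assms(4,5)] gap_nonneg[OF assms(4,5)] by linarith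
qed

lemma cauchy_seq_converges:
  assumes "cauchy_seq E s" and s: "\<And>n. s n \<in> carrier E"
  obtains l where "l \<in> carrier E" "converges E s l"
proof -
  interpret Metric_space "carrier E" "ndist E"
    by (rule Metric_space_ndist)
  have nd: "ndist E x y = gap E x y" if "x \<in> carrier E" "y \<in> carrier E" for x y
    using that by (simp add: ndist_def gap_eq_nrm)
  have "MCauchy s"
    using assms by (auto simp: MCauchy_def cauchy_seq_def nd)
  then obtain l where "limitin mtopology s l sequentially"
    using complete unfolding mcomplete_def by blast
  then have "l \<in> carrier E" "(\<lambda>n. ndist E (s n) l) \<longlonglongrightarrow> 0"
    by (auto simp: limitin_metric_dist_null)
  then show ?thesis
    using that[of l] s by (simp add: converges_def nd)
qed

lemma converges_plus:
  assumes "converges E s l" "converges E s' l'" "\<And>n. s n \<in> carrier E" "\<And>n. s' n \<in> carrier E"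
    "l \<in> carrier E" "l' \<in> carrier E"
  shows "converges E (\<lambda>n. s n \<oplus> s' n) (l \<oplus> l')"
proof -
  have lim: "(\<lambda>n. gap E (s n) l + gap E (s' n) l') \<longlonglongrightarrow> 0"
    using tendsto_add[of _ 0 _ _ 0] assms(1,2) unfolding converges_def by force
  have "\<bar>gap E (s n \<oplus> s' n) (l \<oplus> l')\<bar> \<le> gap E (s n) l + gap E (s' n) l'" for n
    using assms by (simp add: gap_plus)
  then show ?thesis
    unfolding converges_def using lim by (rule null_squeeze)
qed

lemma converges_const [simp]: "l \<in> carrier E \<Longrightarrow> converges E (\<lambda>n. l) l"
  by (simp add: converges_def gap_def)

end

text \<open>
  Negatives are multiples by \<open>- 1\<close>, and the triangle inequality for an element and its negative makes
  the norm nonnegative, so the remaining axioms of a Banach space follow from these.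
\<close>

lemma banach_spaceI:
  fixes E (structure)
  assumes zero: "\<zero> \<in> carrier E"
    and add: "\<And>x y. \<lbrakk>x \<in> carrier E; y \<in> carrier E\<rbrakk> \<Longrightarrow> x \<oplus> y \<in> carrier E"
    and sm: "\<And>c x. x \<in> carrier E \<Longrightarrow> c \<odot> x \<in> carrier E"
    and assoc: "\<And>x y z. \<lbrakk>x \<in> carrier E; y \<in> carrier E; z \<in> carrier E\<rbrakk> \<Longrightarrow> x \<oplus> y \<oplus> z = x \<oplus> (y \<oplus> z)"
    and comm: "\<And>x y. \<lbrakk>x \<in> carrier E; y \<in> carrier E\<rbrakk> \<Longrightarrow> x \<oplus> y = y \<oplus> x"
    and lz: "\<And>x. x \<in> carrier E \<Longrightarrow> \<zero> \<oplus> x = x"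
    and sm0: "\<And>x. x \<in> carrier E \<Longrightarrow> 0 \<odot> x = \<zero>"
    and sm1: "\<And>x. x \<in> carrier E \<Longrightarrow> 1 \<odot> x = x"
    and sml: "\<And>c d x. x \<in> carrier E \<Longrightarrow> (c + d) \<odot> x = c \<odot> x \<oplus> d \<odot> x"
    and smr: "\<And>c x y. \<lbrakk>x \<in> carrier E; y \<in> carrier E\<rbrakk> \<Longrightarrow> c \<odot> (x \<oplus> y) = c \<odot> x \<oplus> c \<odot> y"
    and sma: "\<And>c d x. x \<in> carrier E \<Longrightarrow> (c * d) \<odot> x = c \<odot> (d \<odot> x)"
    and n0: "\<And>x. \<lbrakk>x \<in> carrier E; nrm E x = 0\<rbrakk> \<Longrightarrow> x = \<zero>"
    and ntri: "\<And>x y. \<lbrakk>x \<in> carrier E; y \<in> carrier E\<rbrakk> \<Longrightarrow> nrm E (x \<oplus> y) \<le> nrm E x + nrm E y"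
    and nsm: "\<And>c x. x \<in> carrier E \<Longrightarrow> nrm E (c \<odot> x) = cmod c * nrm E x"
    and compl: "\<And>s. \<lbrakk>\<And>n. s n \<in> carrier E; cauchy_seq E s\<rbrakk> \<Longrightarrow> \<exists>l\<in>carrier E. converges E s l"
  shows "banach_space E"
proof -
  have neg: "(- 1) \<odot> x \<oplus> x = \<zero>" if "x \<in> carrier E" for x
    using sml[of x "- 1" 1] sm1 sm0 that by simp
  have ab: "abelian_group E"
  proof (rule abelian_groupI)
    show "\<exists>y\<in>carrier E. y \<oplus> x = \<zero>" if "x \<in> carrier E" for x
      using neg[OF that] sm[OF that] by blast
  qed (fact zero add assoc comm lz)+
  interpret Module.module complex_scalars E
    by (rule moduleI[OF cring_complex_scalars ab]) (simp_all add: sm sml smr sma sm1)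
  have nz: "nrm E \<zero> = 0"
    using nsm[of \<zero> 0] sm0 zero by simp
  have nn: "0 \<le> nrm E x" if "x \<in> carrier E" for x
    using ntri[of "(- 1) \<odot> x" x] neg[OF that] nsm[of x "- 1"] nz sm[of x "- 1"] that by simp
  have mi: "x \<ominus> y = x \<oplus> (- 1) \<odot> y" if "x \<in> carrier E" "y \<in> carrier E" for x y
    using M.minus_equality[OF neg] that sm by (simp add: a_minus_def)
  have nd: "ndist E x y = gap E x y" if "x \<in> carrier E" "y \<in> carrier E" for x y
    using that by (simp add: ndist_def gap_def mi)
  have neq: "x = y" if "x \<in> carrier E" "y \<in> carrier E" "x \<oplus> (- 1) \<odot> y = \<zero>" for x y
    using that neg[of y] assoc[of x "(- 1) \<odot> y" y] lz[of y] sm[of y "- 1"] by simp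
  have dneg: "nrm E (x \<oplus> (- 1) \<odot> y) = nrm E (y \<oplus> (- 1) \<odot> x)" if "x \<in> carrier E" "y \<in> carrier E" for x y
  proof -
    have "(- 1) \<odot> (x \<oplus> (- 1) \<odot> y) = y \<oplus> (- 1) \<odot> x"
      using that by (simp add: smr sm sm1 comm[of "(- 1) \<odot> x" y] sma[symmetric])
    then show ?thesis
      using nsm[of "x \<oplus> (- 1) \<odot> y" "- 1"] that add sm by simp
  qed
  have dtri: "gap E x z \<le> gap E x y + gap E y z"
    if "x \<in> carrier E" "y \<in> carrier E" "z \<in> carrier E" for x y z
  proof -
    have "(- 1) \<odot> y \<oplus> (y \<oplus> (- 1) \<odot> z) = (- 1) \<odot> z"
      using that by (simp add: assoc[symmetric] neg sm lz)
    then have "(x \<oplus> (- 1) \<odot> y) \<oplus> (y \<oplus> (- 1) \<odot> z) = x \<oplus> (- 1) \<odot> z"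
      using that by (simp add: assoc sm add)
    then show ?thesis
      using that ntri[of "x \<oplus> (- 1) \<odot> y" "y \<oplus> (- 1) \<odot> z"] by (simp add: gap_def sm add)
  qed
  interpret ms: Metric_space "carrier E" "ndist E"
  proof
    show "0 \<le> ndist E x y" for x y
      by (simp add: ndist_def nn)
    show "ndist E x y = ndist E y x" for x y
      using dneg[of x y] by (simp add: ndist_def mi)
    show "ndist E x y = 0 \<longleftrightarrow> x = y" if "x \<in> carrier E" "y \<in> carrier E" for x y
    proof
      assume "ndist E x y = 0"
      then show "x = y"
        using that neq[of x y] n0[of "x \<oplus> (- 1) \<odot> y"] by (simp add: nd gap_def sm add)
    next
      assume "x = y"
      then show "ndist E x y = 0"
        using that nz neg[of y] comm[of y "(- 1) \<odot> y"] by (simp add: nd gap_def sm)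
    qed
    show "ndist E x z \<le> ndist E x y + ndist E y z"
      if "x \<in> carrier E" "y \<in> carrier E" "z \<in> carrier E" for x y z
      using that by (simp add: nd dtri)
  qed
  have mc: "Metric_space.mcomplete (carrier E) (ndist E)"
  proof -
    show "Metric_space.mcomplete (carrier E) (ndist E)"
      unfolding ms.mcomplete_def
    proof (intro allI impI)
      fix s assume s: "ms.MCauchy s"
      then have sc: "s n \<in> carrier E" for n
        unfolding ms.MCauchy_def by (meson UNIV_I image_subset_iff)
      have "cauchy_seq E s"
        using s by (simp add: ms.MCauchy_def cauchy_seq_def nd sc)
      then obtain l where l: "l \<in> carrier E" "converges E s l"
        using compl[of s, OF sc] by (meson)
      then have "limitin ms.mtopology s l sequentially"
        using sc by (simp add: ms.limitin_metric_dist_null converges_def nd)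
      then show "\<exists>l. limitin ms.mtopology s l sequentially" ..
    qed
  qed
  show ?thesis
  proof (intro banach_space.intro banach_space_axioms.intro)
    show "nrm E x = 0 \<longleftrightarrow> x = \<zero>" if "x \<in> carrier E" for x
      using n0[OF that] nz by auto
  qed (fact module_axioms nn ntri nsm mc)+
qed

section \<open>Constructions of Banach spaces\<close>

lemma banach_subspace:
  fixes E (structure)
  assumes E: "banach_space E" and S: "S \<subseteq> carrier E" "\<zero> \<in> S"
    and add: "\<And>x y. \<lbrakk>x \<in> S; y \<in> S\<rbrakk> \<Longrightarrow> x \<oplus> y \<in> S"
    and sm: "\<And>c x. x \<in> S \<Longrightarrow> c \<odot> x \<in> S"
    and closed: "\<And>s l. \<lbrakk>\<And>n. s n \<in> S; l \<in> carrier E; converges E s l\<rbrakk> \<Longrightarrow> l \<in> S"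
  shows "banach_space (E\<lparr>carrier := S\<rparr>)"
proof -
  interpret banach_space E by (fact E)
  have SE: "x \<in> carrier E" if "x \<in> S" for x
    using that S by blast
  show ?thesis
  proof (rule banach_spaceI)
    fix s assume s: "\<And>n. s n \<in> carrier (E\<lparr>carrier := S\<rparr>)" "cauchy_seq (E\<lparr>carrier := S\<rparr>) s"
    then have "cauchy_seq E s"
      by (simp add: cauchy_seq_def gap_def)
    then obtain l where l: "l \<in> carrier E" "converges E s l"
      using cauchy_seq_converges[of s] s(1) SE by auto
    then have "l \<in> S"
      using closed[of s l] s(1) by simp
    then show "\<exists>l\<in>carrier (E\<lparr>carrier := S\<rparr>). converges (E\<lparr>carrier := S\<rparr>) s l"
      using l by (auto simp: converges_def gap_def)
  qed (auto simp: S add sm SE M.a_ac sm_add sm_plus sm_sm nrm_triangle nrm_smult nrm_eq_0)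
qed

text \<open>
  With the identity for \<open>f\<close>, this also exchanges the record that surrounds a Banach space.
\<close>

lemma banach_space_transfer:
  assumes E: "banach_space E" and f: "bij_betw f (carrier F) (carrier E)"
    and zero: "\<zero>\<^bsub>F\<^esub> \<in> carrier F" "f \<zero>\<^bsub>F\<^esub> = \<zero>\<^bsub>E\<^esub>"
    and add: "\<And>x y. \<lbrakk>x \<in> carrier F; y \<in> carrier F\<rbrakk> \<Longrightarrow> x \<oplus>\<^bsub>F\<^esub> y \<in> carrier F"
      "\<And>x y. \<lbrakk>x \<in> carrier F; y \<in> carrier F\<rbrakk> \<Longrightarrow> f (x \<oplus>\<^bsub>F\<^esub> y) = f x \<oplus>\<^bsub>E\<^esub> f y"
    and sm: "\<And>c x. x \<in> carrier F \<Longrightarrow> c \<odot>\<^bsub>F\<^esub> x \<in> carrier F"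
      "\<And>c x. x \<in> carrier F \<Longrightarrow> f (c \<odot>\<^bsub>F\<^esub> x) = c \<odot>\<^bsub>E\<^esub> f x"
    and nrm: "\<And>x. x \<in> carrier F \<Longrightarrow> nrm F x = nrm E (f x)"
  shows "banach_space F"
proof -
  interpret E: banach_space E by (fact E)
  have fE: "f x \<in> carrier E" if "x \<in> carrier F" for x
    using f that by (auto simp: bij_betw_def)
  have inj: "x = y" if "f x = f y" "x \<in> carrier F" "y \<in> carrier F" for x y
    using f that by (auto simp: bij_betw_def inj_on_def)
  have gap: "gap F x y = gap E (f x) (f y)" if "x \<in> carrier F" "y \<in> carrier F" for x y
    using that by (simp add: gap_def nrm add sm)
  show ?thesis
  proof (rule banach_spaceI)
    fix s assume s: "\<And>n. s n \<in> carrier F" "cauchy_seq F s"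
    then have "cauchy_seq E (\<lambda>n. f (s n))"
      by (simp add: cauchy_seq_def gap)
    then obtain l where l: "l \<in> carrier E" "converges E (\<lambda>n. f (s n)) l"
      using E.cauchy_seq_converges[of "\<lambda>n. f (s n)"] s(1) fE by auto
    then obtain l' where "l' \<in> carrier F" "l = f l'"
      using f by (auto simp: bij_betw_def)
    then show "\<exists>l\<in>carrier F. converges F s l"
      using l s(1) by (auto simp: converges_def gap)
  next
    fix x y z assume "x \<in> carrier F" "y \<in> carrier F" "z \<in> carrier F"
    then show "x \<oplus>\<^bsub>F\<^esub> y \<oplus>\<^bsub>F\<^esub> z = x \<oplus>\<^bsub>F\<^esub> (y \<oplus>\<^bsub>F\<^esub> z)"
      by (intro inj) (simp_all add: add fE E.M.a_assoc)
  next
    fix x y assume "x \<in> carrier F" "y \<in> carrier F"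
    then show "x \<oplus>\<^bsub>F\<^esub> y = y \<oplus>\<^bsub>F\<^esub> x"
      by (intro inj) (simp_all add: add fE E.M.a_comm)
  next
    fix x c d assume x: "x \<in> carrier F"
    then show "(c + d) \<odot>\<^bsub>F\<^esub> x = c \<odot>\<^bsub>F\<^esub> x \<oplus>\<^bsub>F\<^esub> d \<odot>\<^bsub>F\<^esub> x"
      by (intro inj) (simp_all add: add sm fE E.sm_add)
    show "(c * d) \<odot>\<^bsub>F\<^esub> x = c \<odot>\<^bsub>F\<^esub> (d \<odot>\<^bsub>F\<^esub> x)"
      using x by (intro inj) (simp_all add: add sm fE E.sm_sm)
  next
    fix c x y assume "x \<in> carrier F" "y \<in> carrier F"
    then show "c \<odot>\<^bsub>F\<^esub> (x \<oplus>\<^bsub>F\<^esub> y) = c \<odot>\<^bsub>F\<^esub> x \<oplus>\<^bsub>F\<^esub> c \<odot>\<^bsub>F\<^esub> y"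
      by (intro inj) (simp_all add: add sm fE E.sm_plus)
  next
    fix x assume x: "x \<in> carrier F"
    then show "\<zero>\<^bsub>F\<^esub> \<oplus>\<^bsub>F\<^esub> x = x"
      by (intro inj) (simp_all add: add zero fE)
    show "0 \<odot>\<^bsub>F\<^esub> x = \<zero>\<^bsub>F\<^esub>"
      using x by (intro inj) (simp_all add: sm zero fE)
    show "1 \<odot>\<^bsub>F\<^esub> x = x"
      using x by (intro inj) (simp_all add: sm fE)
    show "x = \<zero>\<^bsub>F\<^esub>" if "nrm F x = 0"
      using that x by (intro inj) (simp_all add: nrm zero fE E.nrm_eq_0)
  qed (simp_all add: zero add sm nrm fE E.nrm_triangle E.nrm_smult)
qed

definition dsum :: "('a, 'm) normed_struct_scheme \<Rightarrow> ('b, 'n) normed_struct_scheme \<Rightarrow> ('a \<times> 'b) normed_struct" where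
  "dsum E F = \<lparr>carrier = carrier E \<times> carrier F, mult = undefined, one = undefined,
     zero = (\<zero>\<^bsub>E\<^esub>, \<zero>\<^bsub>F\<^esub>),
     add = (\<lambda>p q. (fst p \<oplus>\<^bsub>E\<^esub> fst q, snd p \<oplus>\<^bsub>F\<^esub> snd q)),
     smult = (\<lambda>c p. (c \<odot>\<^bsub>E\<^esub> fst p, c \<odot>\<^bsub>F\<^esub> snd p)),
     nrm = (\<lambda>p. nrm E (fst p) + nrm F (snd p))\<rparr>"

lemma banach_space_dsum:
  assumes "banach_space E" "banach_space F"
  shows "banach_space (dsum E F)"
proof -
  interpret E: banach_space E by fact
  interpret F: banach_space F by fact
  have gap: "gap (dsum E F) p q = gap E (fst p) (fst q) + gap F (snd p) (snd q)" for p q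
    by (simp add: gap_def dsum_def)
  show ?thesis
  proof (rule banach_spaceI)
    fix s assume s: "\<And>n. s n \<in> carrier (dsum E F)" "cauchy_seq (dsum E F) s"
    have c: "fst (s n) \<in> carrier E" "snd (s n) \<in> carrier F" for n
      using s(1)[of n] by (auto simp: dsum_def)
    have le: "gap E (fst (s m)) (fst (s n)) \<le> gap (dsum E F) (s m) (s n)"
      "gap F (snd (s m)) (snd (s n)) \<le> gap (dsum E F) (s m) (s n)" for m n
      using c by (simp_all add: gap)
    have "cauchy_seq E (\<lambda>n. fst (s n))" "cauchy_seq F (\<lambda>n. snd (s n))"
      using s(2) le unfolding cauchy_seq_def by (meson order_le_less_trans)+
    then obtain l l' where l: "l \<in> carrier E" "converges E (\<lambda>n. fst (s n)) l"
      "l' \<in> carrier F" "converges F (\<lambda>n. snd (s n)) l'"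
      using E.cauchy_seq_converges[of "\<lambda>n. fst (s n)"] F.cauchy_seq_converges[of "\<lambda>n. snd (s n)"] c
      by metis
    then have "converges (dsum E F) s (l, l')"
      using tendsto_add[of "\<lambda>n. gap E (fst (s n)) l" 0 sequentially "\<lambda>n. gap F (snd (s n)) l'" 0]
      by (simp add: converges_def gap)
    moreover have "(l, l') \<in> carrier (dsum E F)"
      using l by (simp add: dsum_def)
    ultimately show "\<exists>l\<in>carrier (dsum E F). converges (dsum E F) s l"
      by blast
  next
    fix x assume "x \<in> carrier (dsum E F)" "nrm (dsum E F) x = 0"
    then show "x = \<zero>\<^bsub>dsum E F\<^esub>"
      using E.nrm_nonneg[of "fst x"] F.nrm_nonneg[of "snd x"] E.nrm_eq_0[of "fst x"] F.nrm_eq_0[of "snd x"]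
      by (auto simp: dsum_def)
  next
    fix x y assume "x \<in> carrier (dsum E F)" "y \<in> carrier (dsum E F)"
    then show "nrm (dsum E F) (x \<oplus>\<^bsub>dsum E F\<^esub> y) \<le> nrm (dsum E F) x + nrm (dsum E F) y"
      using E.nrm_triangle[of "fst x" "fst y"] F.nrm_triangle[of "snd x" "snd y"]
      by (auto simp: dsum_def)
  qed (auto simp: dsum_def E.M.a_ac F.M.a_ac E.sm_add F.sm_add
      E.sm_plus F.sm_plus E.sm_sm F.sm_sm E.nrm_smult F.nrm_smult algebra_simps)
qed

definition complex_space :: "complex normed_struct" where
  "complex_space = \<lparr>carrier = UNIV, mult = undefined, one = undefined, zero = 0, add = (+),
     smult = (*), nrm = cmod\<rparr>"

lemma banach_space_complex: "banach_space complex_space"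
proof (rule banach_spaceI)
  fix s assume s: "cauchy_seq complex_space s"
  have gap: "gap complex_space x y = dist x y" for x y
    by (simp add: gap_def complex_space_def dist_norm)
  have "Cauchy s"
    using s by (simp add: cauchy_seq_def gap Cauchy_def)
  then obtain l where "s \<longlonglongrightarrow> l"
    using Cauchy_convergent convergent_def by blast
  then have "converges complex_space s l"
    using tendsto_dist_iff[of s l sequentially] by (simp add: converges_def gap)
  then show "\<exists>l\<in>carrier complex_space. converges complex_space s l"
    by (auto simp: complex_space_def)
qed (auto simp: complex_space_def algebra_simps norm_triangle_ineq norm_mult)

subsection \<open>Bounded families\<close>

text \<open>
  Algebras of fields, bounded operators and the function modules below are closed subspaces of these
  spaces, and inherit completeness from them.
\<close>

definition linf :: "'t set \<Rightarrow> ('t \<Rightarrow> 'a normed_struct) \<Rightarrow> ('t \<Rightarrow> 'a) normed_struct" where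
  "linf I E = (prod_struct I E)\<lparr>carrier := {x \<in> \<Pi>\<^sub>E t\<in>I. carrier (E t). \<exists>C. \<forall>t\<in>I. nrm (E t) (x t) \<le> C}\<rparr>"

lemma linf_simps [simp]:
  "carrier (linf I E) = {x \<in> \<Pi>\<^sub>E t\<in>I. carrier (E t). \<exists>C. \<forall>t\<in>I. nrm (E t) (x t) \<le> C}"
  "zero (linf I E) = (\<lambda>t\<in>I. \<zero>\<^bsub>E t\<^esub>)"
  "add (linf I E) = (\<lambda>x y. \<lambda>t\<in>I. x t \<oplus>\<^bsub>E t\<^esub> y t)"
  "smult (linf I E) = (\<lambda>c x. \<lambda>t\<in>I. c \<odot>\<^bsub>E t\<^esub> x t)"
  by (simp_all add: linf_def prod_struct_def)

lemma nrm_linf: "nrm (linf I E) x = Sup (insert 0 ((\<lambda>t. nrm (E t) (x t)) ` I))"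
  by (simp add: linf_def prod_struct_def)

lemma nrm_linf_upper:
  assumes "x \<in> carrier (linf I E)" "t \<in> I"
  shows "nrm (E t) (x t) \<le> nrm (linf I E) x"
proof -
  obtain C where "\<forall>t\<in>I. nrm (E t) (x t) \<le> C"
    using assms by auto
  then have "bdd_above (insert 0 ((\<lambda>t. nrm (E t) (x t)) ` I))"
    by (intro bdd_aboveI[of _ "max 0 C"]) auto
  then show ?thesis
    using assms unfolding nrm_linf by (intro cSup_upper) auto
qed

lemma nrm_linf_nonneg:
  assumes "x \<in> carrier (linf I E)"
  shows "0 \<le> nrm (linf I E) x"
proof -
  obtain C where "\<forall>t\<in>I. nrm (E t) (x t) \<le> C"
    using assms by auto
  then have "bdd_above (insert 0 ((\<lambda>t. nrm (E t) (x t)) ` I))"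
    by (intro bdd_aboveI[of _ "max 0 C"]) auto
  then show ?thesis
    using assms unfolding nrm_linf by (intro cSup_upper) auto
qed

lemma nrm_linf_least:
  assumes "0 \<le> C" "\<And>t. t \<in> I \<Longrightarrow> nrm (E t) (x t) \<le> C"
  shows "nrm (linf I E) x \<le> C"
  unfolding nrm_linf using assms by (intro cSup_least) auto

text \<open>
  A Cauchy sequence converges at every index, and the Cauchy estimate, which is uniform in the index,
  passes to the pointwise limit.
\<close>

lemma banach_space_linf:
  assumes E: "\<And>t. t \<in> I \<Longrightarrow> banach_space (E t)"
  shows "banach_space (linf I E)"
proof -
  have tri: "nrm (E t) (x t \<oplus>\<^bsub>E t\<^esub> y t) \<le> nrm (linf I E) x + nrm (linf I E) y"
    if "x \<in> carrier (linf I E)" "y \<in> carrier (linf I E)" "t \<in> I" for x y t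
  proof -
    interpret Et: banach_space "E t" using E that by blast
    have "x t \<in> carrier (E t)" "y t \<in> carrier (E t)"
      using that by auto
    then show ?thesis
      using Et.nrm_triangle[of "x t" "y t"] nrm_linf_upper[of x I E t] nrm_linf_upper[of y I E t] that
      by linarith
  qed
  have sm: "nrm (E t) (c \<odot>\<^bsub>E t\<^esub> x t) \<le> cmod c * nrm (linf I E) x"
    if "x \<in> carrier (linf I E)" "t \<in> I" for c x t
  proof -
    interpret Et: banach_space "E t" using E that by blast
    have "x t \<in> carrier (E t)"
      using that by auto
    then show ?thesis
      using Et.nrm_smult[of "x t" c] nrm_linf_upper[of x I E t] that by (simp add: mult_left_mono)
  qed
  have addc: "x \<oplus>\<^bsub>linf I E\<^esub> y \<in> carrier (linf I E)"
    if "x \<in> carrier (linf I E)" "y \<in> carrier (linf I E)" for x y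
  proof -
    have "x t \<oplus>\<^bsub>E t\<^esub> y t \<in> carrier (E t)" if "t \<in> I" for t
    proof -
      interpret Et: banach_space "E t" using E that by blast
      show ?thesis
        using \<open>x \<in> _\<close> \<open>y \<in> _\<close> that by (auto simp: PiE_iff)
    qed
    then show ?thesis
      using tri[OF that] by (auto intro!: exI[of _ "nrm (linf I E) x + nrm (linf I E) y"])
  qed
  have smult_mem: "c \<odot>\<^bsub>linf I E\<^esub> x \<in> carrier (linf I E)" if "x \<in> carrier (linf I E)" for c x
  proof -
    have "c \<odot>\<^bsub>E t\<^esub> x t \<in> carrier (E t)" if "t \<in> I" for t
    proof -
      interpret Et: banach_space "E t" using E that by blast
      show ?thesis
        using \<open>x \<in> _\<close> that by (auto simp: PiE_iff)
    qed
    then show ?thesis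
      using sm[OF that] by (auto intro!: exI[of _ "cmod c * nrm (linf I E) x"])
  qed
  have smle: "nrm (linf I E) (c \<odot>\<^bsub>linf I E\<^esub> x) \<le> cmod c * nrm (linf I E) x"
    if "x \<in> carrier (linf I E)" for c x
    by (rule nrm_linf_least) (use sm[OF that] nrm_linf_nonneg[OF that] in auto)
  have ext: "x = y" if "x \<in> carrier (linf I E)" "y \<in> carrier (linf I E)" "\<And>t. t \<in> I \<Longrightarrow> x t = y t" for x y
    using that by (auto intro: PiE_ext)
  have zc: "\<zero>\<^bsub>linf I E\<^esub> \<in> carrier (linf I E)"
  proof -
    have "\<zero>\<^bsub>E t\<^esub> \<in> carrier (E t) \<and> nrm (E t) \<zero>\<^bsub>E t\<^esub> \<le> 0" if "t \<in> I" for t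
    proof -
      interpret Et: banach_space "E t" using E that by blast
      show ?thesis by simp
    qed
    then show ?thesis by auto
  qed
  note cl = zc addc smult_mem
  note ops = PiE_iff banach_space.sm_add[OF E] banach_space.sm_plus[OF E] banach_space.sm_sm[OF E]
    banach_space.sm_0[OF E] banach_space.sm_1[OF E]
  have am: "abelian_monoid (E t)" if "t \<in> I" for t
  proof -
    interpret Et: banach_space "E t" using E that by blast
    show ?thesis ..
  qed
  show ?thesis
  proof (rule banach_spaceI)
    fix x y z assume x: "x \<in> carrier (linf I E)" and y: "y \<in> carrier (linf I E)"
      and z: "z \<in> carrier (linf I E)"
    show "x \<oplus>\<^bsub>linf I E\<^esub> y \<oplus>\<^bsub>linf I E\<^esub> z = x \<oplus>\<^bsub>linf I E\<^esub> (y \<oplus>\<^bsub>linf I E\<^esub> z)"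
      by (rule ext, (intro cl x y z)+) (use x y z abelian_monoid.a_assoc[OF am] in \<open>simp add: PiE_iff\<close>)
  next
    fix x y assume x: "x \<in> carrier (linf I E)" and y: "y \<in> carrier (linf I E)"
    show "x \<oplus>\<^bsub>linf I E\<^esub> y = y \<oplus>\<^bsub>linf I E\<^esub> x"
      by (rule ext, (intro cl x y)+) (use x y abelian_monoid.a_comm[OF am] in \<open>simp add: PiE_iff\<close>)
    show "c \<odot>\<^bsub>linf I E\<^esub> (x \<oplus>\<^bsub>linf I E\<^esub> y) = c \<odot>\<^bsub>linf I E\<^esub> x \<oplus>\<^bsub>linf I E\<^esub> c \<odot>\<^bsub>linf I E\<^esub> y" for c
      by (rule ext, (intro cl x y)+) (use x y in \<open>simp add: ops\<close>)
    show "nrm (linf I E) (x \<oplus>\<^bsub>linf I E\<^esub> y) \<le> nrm (linf I E) x + nrm (linf I E) y"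
      by (rule nrm_linf_least)
        (use tri[OF x y] nrm_linf_nonneg[OF x] nrm_linf_nonneg[OF y] in auto)
  next
    fix x assume x: "x \<in> carrier (linf I E)"
    show "\<zero>\<^bsub>linf I E\<^esub> \<oplus>\<^bsub>linf I E\<^esub> x = x"
      by (rule ext, (intro cl x)+) (use x abelian_monoid.l_zero[OF am] in \<open>simp add: PiE_iff\<close>)
    show "0 \<odot>\<^bsub>linf I E\<^esub> x = \<zero>\<^bsub>linf I E\<^esub>" "1 \<odot>\<^bsub>linf I E\<^esub> x = x"
      "(c + d) \<odot>\<^bsub>linf I E\<^esub> x = c \<odot>\<^bsub>linf I E\<^esub> x \<oplus>\<^bsub>linf I E\<^esub> d \<odot>\<^bsub>linf I E\<^esub> x"
      "(c * d) \<odot>\<^bsub>linf I E\<^esub> x = c \<odot>\<^bsub>linf I E\<^esub> (d \<odot>\<^bsub>linf I E\<^esub> x)" for c d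
      by (rule ext, (intro cl x)+, use x in \<open>simp add: ops\<close>)+
  next
    show "x = \<zero>\<^bsub>linf I E\<^esub>" if x: "x \<in> carrier (linf I E)" and n: "nrm (linf I E) x = 0" for x
    proof (rule ext)
      fix t assume t: "t \<in> I"
      interpret Et: banach_space "E t" using E t by blast
      have "x t \<in> carrier (E t)"
        using x t by auto
      then have "nrm (E t) (x t) = 0"
        using nrm_linf_upper[OF x t] n Et.nrm_nonneg[of "x t"] by simp
      then show "x t = \<zero>\<^bsub>linf I E\<^esub> t"
        using \<open>x t \<in> _\<close> t by (simp add: Et.nrm_eq_0)
    qed (intro zc x)+
    show "nrm (linf I E) (c \<odot>\<^bsub>linf I E\<^esub> x) = cmod c * nrm (linf I E) x"
      if x: "x \<in> carrier (linf I E)" for c x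
    proof (cases "c = 0")
      case True
      then show ?thesis
        using smle[OF x, of c] nrm_linf_nonneg[OF smult_mem[OF x, of c]] by simp
    next
      case False
      have "inverse c \<odot>\<^bsub>linf I E\<^esub> (c \<odot>\<^bsub>linf I E\<^esub> x) = x"
      proof (rule ext)
        fix t assume t: "t \<in> I"
        interpret Et: banach_space "E t" using E t by blast
        show "(inverse c \<odot>\<^bsub>linf I E\<^esub> (c \<odot>\<^bsub>linf I E\<^esub> x)) t = x t"
          using x t False by (simp add: PiE_iff Et.sm_sm)
      qed (intro smult_mem x)+
      then have "nrm (linf I E) x \<le> cmod (inverse c) * nrm (linf I E) (c \<odot>\<^bsub>linf I E\<^esub> x)"
        using smle[OF smult_mem[OF x, of c], of "inverse c"] by simp
      then have "cmod c * nrm (linf I E) x \<le> nrm (linf I E) (c \<odot>\<^bsub>linf I E\<^esub> x)"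
        using False by (simp add: norm_inverse norm_divide field_simps)
      then show ?thesis
        using smle[OF x, of c] by linarith
    qed
  next
    fix s assume s: "\<And>n. s n \<in> carrier (linf I E)" "cauchy_seq (linf I E) s"
    have sc: "s n t \<in> carrier (E t)" if "t \<in> I" for n t
      using s(1)[of n] that by auto
    have dc: "s m \<oplus>\<^bsub>linf I E\<^esub> (- 1) \<odot>\<^bsub>linf I E\<^esub> s n \<in> carrier (linf I E)" for m n
      by (intro addc smult_mem s)
    have pt: "gap (E t) (s m t) (s n t) \<le> gap (linf I E) (s m) (s n)" if "t \<in> I" for m n t
      using nrm_linf_upper[OF dc that, of m n] that by (simp add: gap_def)
    have "cauchy_seq (E t) (\<lambda>n. s n t)" if "t \<in> I" for t
      using s(2) pt[OF that] unfolding cauchy_seq_def by (meson order_le_less_trans)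
    then have "\<exists>l. l \<in> carrier (E t) \<and> converges (E t) (\<lambda>n. s n t) l" if "t \<in> I" for t
      using banach_space.cauchy_seq_converges[OF E[OF that], of "\<lambda>n. s n t"] sc[OF that] that by metis
    then obtain l where l: "\<And>t. t \<in> I \<Longrightarrow> l t \<in> carrier (E t)"
      "\<And>t. t \<in> I \<Longrightarrow> converges (E t) (\<lambda>n. s n t) (l t)"
      by metis
    define L where "L = restrict l I"
    have unif: "gap (E t) (s m t) (l t) \<le> \<epsilon>"
      if N: "\<And>m n. m \<ge> N \<Longrightarrow> n \<ge> N \<Longrightarrow> gap (linf I E) (s m) (s n) < \<epsilon>" and "m \<ge> N" "t \<in> I" for \<epsilon> N m t
    proof -
      interpret Et: banach_space "E t" using E that by blast
      have "(\<lambda>n. \<epsilon> + gap (E t) (s n t) (l t)) \<longlonglongrightarrow> \<epsilon> + 0"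
        using l(2)[OF \<open>t \<in> I\<close>] unfolding converges_def by (intro tendsto_add tendsto_const)
      moreover have "gap (E t) (s m t) (l t) \<le> \<epsilon> + gap (E t) (s n t) (l t)" if "n \<ge> N" for n
        using Et.gap_triangle[of "s m t" "s n t" "l t"] sc[OF \<open>t \<in> I\<close>] l(1)[OF \<open>t \<in> I\<close>]
          pt[OF \<open>t \<in> I\<close>, of m n] N[OF \<open>m \<ge> N\<close> that] by fastforce
      ultimately show ?thesis
        by (intro LIMSEQ_le_const[where X = "\<lambda>n. \<epsilon> + gap (E t) (s n t) (l t)"]) auto
    qed
    have "L \<in> carrier (linf I E)"
    proof -
      obtain N where N: "\<And>m n. m \<ge> N \<Longrightarrow> n \<ge> N \<Longrightarrow> gap (linf I E) (s m) (s n) < 1"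
        using s(2) unfolding cauchy_seq_def by (meson zero_less_one)
      have "nrm (E t) (l t) \<le> nrm (linf I E) (s N) + 1" if "t \<in> I" for t
      proof -
        interpret Et: banach_space "E t" using E that by blast
        show ?thesis
          using Et.nrm_le_gap[of "l t" "s N t"] Et.gap_commute[of "l t" "s N t"] l(1)[OF that] sc[OF that]
            unif[of N 1 N t] N that nrm_linf_upper[OF s(1)[of N] that] by fastforce
      qed
      then show ?thesis
        using l(1) by (auto simp: L_def intro!: exI[of _ "nrm (linf I E) (s N) + 1"])
    qed
    moreover have "converges (linf I E) s L"
      unfolding converges_def
    proof (rule LIMSEQ_I)
      fix r :: real assume "r > 0"
      then obtain N where N: "\<And>m n. m \<ge> N \<Longrightarrow> n \<ge> N \<Longrightarrow> gap (linf I E) (s m) (s n) < r / 2"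
        using s(2) unfolding cauchy_seq_def by (meson half_gt_zero)
      have le: "gap (linf I E) (s m) L \<le> r / 2" if "m \<ge> N" for m
        unfolding gap_def
        by (rule nrm_linf_least) (use unif[OF N that] \<open>r > 0\<close> in \<open>auto simp: L_def gap_def\<close>)
      have nn: "0 \<le> gap (linf I E) (s m) L" for m
        unfolding gap_def by (intro nrm_linf_nonneg addc smult_mem s \<open>L \<in> _\<close>)
      have "norm (gap (linf I E) (s m) L - 0) < r" if "m \<ge> N" for m
        using \<open>r > 0\<close> le[OF that] nn[of m] by simp
      then show "\<exists>N. \<forall>m\<ge>N. norm (gap (linf I E) (s m) L - 0) < r"
        by blast
    qed
    ultimately show "\<exists>l\<in>carrier (linf I E). converges (linf I E) s l"
      by blast
  qed (fact cl)+
qed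

section \<open>Submodules generated by small sets\<close>

lemma banach_bimodule_gap_bound:
  assumes "banach_bimodule B X" "a \<in> carrier B"
  obtains C where "C \<ge> 0"
    "\<And>x y. \<lbrakk>x \<in> carrier X; y \<in> carrier X\<rbrakk> \<Longrightarrow> gap X (lact X a x) (lact X a y) \<le> C * gap X x y"
    "\<And>x y. \<lbrakk>x \<in> carrier X; y \<in> carrier X\<rbrakk> \<Longrightarrow> gap X (ract X x a) (ract X y a) \<le> C * gap X x y"
proof -
  interpret banach_bimodule B X by fact
  obtain C where C: "\<And>a x. \<lbrakk>a \<in> carrier B; x \<in> carrier X\<rbrakk> \<Longrightarrow>
      nrm X (lact X a x) \<le> C * nrm B a * nrm X x \<and> nrm X (ract X x a) \<le> C * nrm B a * nrm X x"
    using act_bounded by blast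
  have le: "C * nrm B a * t \<le> \<bar>C\<bar> * nrm B a * t" if "t \<ge> 0" for t
    using that B.nrm_nonneg[OF assms(2)] by (simp add: mult_right_mono)
  show ?thesis
  proof (rule that[of "\<bar>C\<bar> * nrm B a"])
    show "0 \<le> \<bar>C\<bar> * nrm B a"
      using B.nrm_nonneg[OF assms(2)] by simp
    fix x y assume xy: "x \<in> carrier X" "y \<in> carrier X"
    have 1: "lact X a x \<oplus>\<^bsub>X\<^esub> (- 1) \<odot>\<^bsub>X\<^esub> lact X a y = lact X a (x \<oplus>\<^bsub>X\<^esub> (- 1) \<odot>\<^bsub>X\<^esub> y)"
      using xy assms(2) by (simp add: lact_add lact_smult)
    have 2: "ract X x a \<oplus>\<^bsub>X\<^esub> (- 1) \<odot>\<^bsub>X\<^esub> ract X y a = ract X (x \<oplus>\<^bsub>X\<^esub> (- 1) \<odot>\<^bsub>X\<^esub> y) a"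
      using xy assms(2) by (simp add: ract_add ract_smult)
    have d: "x \<oplus>\<^bsub>X\<^esub> (- 1) \<odot>\<^bsub>X\<^esub> y \<in> carrier X"
      using xy by simp
    show "gap X (lact X a x) (lact X a y) \<le> \<bar>C\<bar> * nrm B a * gap X x y"
      "gap X (ract X x a) (ract X y a) \<le> \<bar>C\<bar> * nrm B a * gap X x y"
      unfolding gap_def 1 2 using C[OF assms(2) d] le[OF X.nrm_nonneg[OF d]] by linarith+
  qed
qed

lemma banach_bimodule_sub:
  assumes X: "banach_bimodule B X" and sub: "banach_space (X\<lparr>carrier := S\<rparr>)" "S \<subseteq> carrier X"
    and act: "\<And>a x. \<lbrakk>a \<in> carrier B; x \<in> S\<rbrakk> \<Longrightarrow> lact X a x \<in> S"
      "\<And>a x. \<lbrakk>a \<in> carrier B; x \<in> S\<rbrakk> \<Longrightarrow> ract X x a \<in> S"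
  shows "banach_bimodule B (X\<lparr>carrier := S\<rparr>)"
proof -
  interpret banach_bimodule B X by (fact X)
  have S: "x \<in> carrier X" if "x \<in> S" for x
    using that sub by blast
  obtain C where C: "\<forall>a\<in>carrier B. \<forall>x\<in>carrier X.
      nrm X (lact X a x) \<le> C * nrm B a * nrm X x \<and> nrm X (ract X x a) \<le> C * nrm B a * nrm X x"
    using act_bounded by blast
  show ?thesis
  proof (intro banach_bimodule.intro sub(1) banach_bimodule_axioms.intro)
    show "banach_algebra B" ..
    show "\<exists>C. \<forall>a\<in>carrier B. \<forall>x\<in>carrier (X\<lparr>carrier := S\<rparr>).
        nrm (X\<lparr>carrier := S\<rparr>) (lact (X\<lparr>carrier := S\<rparr>) a x) \<le> C * nrm B a * nrm (X\<lparr>carrier := S\<rparr>) x \<and>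
        nrm (X\<lparr>carrier := S\<rparr>) (ract (X\<lparr>carrier := S\<rparr>) x a) \<le> C * nrm B a * nrm (X\<lparr>carrier := S\<rparr>) x"
      using C S by (intro exI[of _ C]) simp
  qed (simp_all add: act S lact_add add_lact lact_smult smult_lact ract_add add_ract ract_smult
      smult_ract lact_assoc ract_assoc lact_ract)
qed

lemma banach_bimodule_transfer:
  assumes X: "banach_bimodule B X" and Y: "banach_space Y"
    and f: "bij_betw f (carrier Y) (carrier X)"
    and add: "\<And>x y. \<lbrakk>x \<in> carrier Y; y \<in> carrier Y\<rbrakk> \<Longrightarrow> f (x \<oplus>\<^bsub>Y\<^esub> y) = f x \<oplus>\<^bsub>X\<^esub> f y"
    and sm: "\<And>c x. x \<in> carrier Y \<Longrightarrow> f (c \<odot>\<^bsub>Y\<^esub> x) = c \<odot>\<^bsub>X\<^esub> f x"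
    and nrm: "\<And>x. x \<in> carrier Y \<Longrightarrow> nrm Y x = nrm X (f x)"
    and act: "\<And>a x. \<lbrakk>a \<in> carrier B; x \<in> carrier Y\<rbrakk> \<Longrightarrow> lact Y a x \<in> carrier Y"
      "\<And>a x. \<lbrakk>a \<in> carrier B; x \<in> carrier Y\<rbrakk> \<Longrightarrow> ract Y x a \<in> carrier Y"
      "\<And>a x. \<lbrakk>a \<in> carrier B; x \<in> carrier Y\<rbrakk> \<Longrightarrow> f (lact Y a x) = lact X a (f x)"
      "\<And>a x. \<lbrakk>a \<in> carrier B; x \<in> carrier Y\<rbrakk> \<Longrightarrow> f (ract Y x a) = ract X (f x) a"
  shows "banach_bimodule B Y"
proof -
  interpret banach_bimodule B X by (fact X)
  interpret Y: banach_space Y by (fact Y)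
  have fX [simp]: "f x \<in> carrier X" if "x \<in> carrier Y" for x
    using f that by (auto simp: bij_betw_def)
  have inj: "x = y" if "f x = f y" "x \<in> carrier Y" "y \<in> carrier Y" for x y
    using f that by (auto simp: bij_betw_def inj_on_def)
  obtain C where C: "\<forall>a\<in>carrier B. \<forall>x\<in>carrier X.
      nrm X (lact X a x) \<le> C * nrm B a * nrm X x \<and> nrm X (ract X x a) \<le> C * nrm B a * nrm X x"
    using act_bounded by blast
  note facts = add sm act lact_add add_lact lact_smult smult_lact ract_add add_ract ract_smult
      smult_ract lact_assoc ract_assoc lact_ract B.mult_closed
  show ?thesis
  proof (intro banach_bimodule.intro Y banach_bimodule_axioms.intro)
    show "banach_algebra B" ..
    show "\<exists>C. \<forall>a\<in>carrier B. \<forall>x\<in>carrier Y.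
        nrm Y (lact Y a x) \<le> C * nrm B a * nrm Y x \<and> nrm Y (ract Y x a) \<le> C * nrm B a * nrm Y x"
      using C by (intro exI[of _ C]) (simp add: nrm act)
  qed ((rule act; assumption) | (rule inj; simp add: facts))+
qed

text \<open>
  The universe of modules has room for the sequences over \<open>'b \<times> complex\<close>, which are the sequences of
  elements of a unitization. Small sets are those whose elements such sequences can code.
\<close>

definition small :: "'b itself \<Rightarrow> 'x set \<Rightarrow> bool" where
  "small b S \<longleftrightarrow> (\<exists>g :: (nat \<Rightarrow> 'b \<times> complex) \<Rightarrow> 'x. S \<subseteq> range g)"

lemma smallI: "S \<subseteq> range (g :: (nat \<Rightarrow> 'b \<times> complex) \<Rightarrow> 'x) \<Longrightarrow> small TYPE('b) S"
  unfolding small_def by (rule exI)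

lemma small_subset: "small b T \<Longrightarrow> S \<subseteq> T \<Longrightarrow> small b S"
  unfolding small_def by (meson subset_trans)

lemma small_image:
  fixes S :: "'x set"
  assumes "small TYPE('b) S"
  shows "small TYPE('b) (f ` S)"
proof -
  obtain g :: "(nat \<Rightarrow> 'b \<times> complex) \<Rightarrow> 'x" where "S \<subseteq> range g"
    using assms unfolding small_def by (elim exE) blast
  then have "f ` S \<subseteq> range (f \<circ> g)"
    by auto
  then show ?thesis
    by (rule smallI)
qed

lemma small_range: "small TYPE('b) (range (g :: (nat \<Rightarrow> 'b \<times> complex) \<Rightarrow> 'x))"
  by (rule smallI[of _ g]) (rule subset_refl)

text \<open>
  A sequence of sequences is one sequence, by pairing the indices. This keeps small sets small when the
  limits of their sequences are added.
\<close>

lemma small_sequences: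
  fixes S :: "'x set"
  assumes "small TYPE('b) S"
  shows "small TYPE('b) {s :: nat \<Rightarrow> 'x. \<forall>n. s n \<in> S}"
proof -
  obtain g :: "(nat \<Rightarrow> 'b \<times> complex) \<Rightarrow> 'x" where g: "S \<subseteq> range g"
    using assms unfolding small_def by (elim exE) blast
  define G where "G f = (\<lambda>n. g (\<lambda>m. f (prod_encode (n, m))))" for f
  have 1: "s \<in> range G" if "\<forall>n. s n \<in> S" for s
  proof -
    have "\<forall>n. \<exists>c. s n = g c"
      using that g by blast
    then obtain c where c: "\<And>n. s n = g (c n)"
      by metis
    define f where "f k = c (fst (prod_decode k)) (snd (prod_decode k))" for k
    have "s = G f"
      by (simp add: G_def f_def c fun_eq_iff)
    then show ?thesis
      by blast
  qed
  show ?thesis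
    by (rule smallI, rule subsetI, rule 1) simp
qed

lemma small_nat: "small TYPE('b) (UNIV :: nat set)"
proof -
  have 1: "n \<in> range (\<lambda>f :: nat \<Rightarrow> 'b \<times> complex. nat \<lfloor>Re (snd (f 0))\<rfloor>)" for n
    by (rule range_eqI[of _ _ "\<lambda>_. (undefined, of_nat n)"]) simp
  show ?thesis
    by (rule smallI, rule subsetI, rule 1)
qed

lemma small_complex: "small TYPE('b) (UNIV :: complex set)"
proof -
  have 1: "z \<in> range (\<lambda>f :: nat \<Rightarrow> 'b \<times> complex. snd (f 0))" for z
    by (rule range_eqI[of _ _ "\<lambda>_. (undefined, z)"]) simp
  show ?thesis
    by (rule smallI, rule subsetI, rule 1)
qed

lemma small_self: "small TYPE('b) (S :: 'b set)"
proof -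
  have 1: "z \<in> range (\<lambda>f :: nat \<Rightarrow> 'b \<times> complex. fst (f 0))" for z
    by (rule range_eqI[of _ _ "\<lambda>_. (z, 0)"]) simp
  show ?thesis
    by (rule smallI, rule subsetI, rule 1)
qed

lemma small_Times:
  fixes S :: "'x set" and T :: "'y set"
  assumes "small TYPE('b) S" "small TYPE('b) T"
  shows "small TYPE('b) (S \<times> T)"
proof -
  obtain g :: "(nat \<Rightarrow> 'b \<times> complex) \<Rightarrow> 'x" where g: "S \<subseteq> range g"
    using assms unfolding small_def by (elim exE) blast
  obtain h :: "(nat \<Rightarrow> 'b \<times> complex) \<Rightarrow> 'y" where h: "T \<subseteq> range h"
    using assms unfolding small_def by (elim exE) blast
  have "small TYPE('b) {s :: nat \<Rightarrow> nat \<Rightarrow> 'b \<times> complex. \<forall>n. s n \<in> range id}"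
    by (rule small_sequences[OF small_range])
  then have "small TYPE('b) ((\<lambda>s. (g (s 0), h (s 1))) ` {s :: nat \<Rightarrow> nat \<Rightarrow> 'b \<times> complex. \<forall>n. s n \<in> range id})"
    by (rule small_image)
  moreover have "S \<times> T \<subseteq> (\<lambda>s. (g (s 0), h (s 1))) ` {s :: nat \<Rightarrow> nat \<Rightarrow> 'b \<times> complex. \<forall>n. s n \<in> range id}"
  proof clarify
    fix x y assume "x \<in> S" "y \<in> T"
    then obtain c d where cd: "x = g c" "y = h d"
      using g h by blast
    show "(x, y) \<in> (\<lambda>s. (g (s 0), h (s 1))) ` {s :: nat \<Rightarrow> nat \<Rightarrow> 'b \<times> complex. \<forall>n. s n \<in> range id}"
      by (rule image_eqI[of _ _ "\<lambda>n. if n = 0 then c else d"]) (auto simp: cd)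
  qed
  ultimately show ?thesis
    by (rule small_subset)
qed

lemma small_UN:
  fixes S :: "nat \<Rightarrow> 'x set"
  assumes "\<And>n. small TYPE('b) (S n)"
  shows "small TYPE('b) (\<Union>n. S n)"
proof -
  obtain g :: "nat \<Rightarrow> (nat \<Rightarrow> 'b \<times> complex) \<Rightarrow> 'x" where g: "\<And>n. S n \<subseteq> range (g n)"
    using assms unfolding small_def by metis
  have "small TYPE('b) ((UNIV :: nat set) \<times> range (id :: (nat \<Rightarrow> 'b \<times> complex) \<Rightarrow> _))"
    by (intro small_Times small_nat small_range)
  then have "small TYPE('b) ((\<lambda>(n, f). g n f) ` ((UNIV :: nat set) \<times> range id))"
    by (rule small_image)
  then show ?thesis
    by (rule small_subset) (use g in force)
qed

lemma small_Un:
  assumes "small TYPE('b) S" "small TYPE('b) T"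
  shows "small TYPE('b) (S \<union> T)"
proof -
  have "small TYPE('b) (\<Union>n::nat. if n = 0 then S else T)"
    using assms by (intro small_UN) simp
  then show ?thesis
    by (rule small_subset) (auto split: if_splits)
qed

lemma small_tuples: "small TYPE('b) (tuples B n :: 'b list set)"
proof -
  have "small TYPE('b) ((\<lambda>s. map s [0..<n]) ` {s :: nat \<Rightarrow> 'b. \<forall>n. s n \<in> UNIV})"
    by (intro small_image small_sequences small_self)
  moreover have "tuples B n \<subseteq> (\<lambda>s. map s [0..<n]) ` {s :: nat \<Rightarrow> 'b. \<forall>n. s n \<in> UNIV}"
  proof
    fix as assume "as \<in> tuples B n"
    then have "as = map ((!) as) [0..<n]"
      using map_nth[of as] by (simp add: tuples_def)
    then show "as \<in> (\<lambda>s. map s [0..<n]) ` {s :: nat \<Rightarrow> 'b. \<forall>n. s n \<in> UNIV}"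
      by blast
  qed
  ultimately show ?thesis
    by (rule small_subset)
qed

definition bimodule_step ::
    "('b, 'm) normed_struct_scheme \<Rightarrow> ('b, 'x, 'n) bimodule_scheme \<Rightarrow> 'x set \<Rightarrow> 'x set" where
  "bimodule_step B X S = S \<union> ((\<lambda>(x, y). x \<oplus>\<^bsub>X\<^esub> y) ` (S \<times> S) \<union> ((\<lambda>(c, x). c \<odot>\<^bsub>X\<^esub> x) ` (UNIV \<times> S) \<union>
     ((\<lambda>(a, x). lact X a x) ` (carrier B \<times> S) \<union> (\<lambda>(a, x). ract X x a) ` (carrier B \<times> S))))"

text \<open>
  Countably many rounds of the module operations keep a set small and yield a submodule. The limits of
  its sequences form a closed submodule, since the operations are continuous, and stay small.
\<close>

lemma small_closed_submodule:
  fixes B :: "('b, 'm) normed_struct_scheme" and X :: "('b, 'x, 'n) bimodule_scheme"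
  assumes X: "banach_bimodule B X" and G: "small TYPE('b) G" "G \<subseteq> carrier X"
  obtains S where "G \<subseteq> S" "S \<subseteq> carrier X" "small TYPE('b) S" "banach_bimodule B (X\<lparr>carrier := S\<rparr>)"
proof -
  interpret banach_bimodule B X by (fact X)
  define T where "T k = (bimodule_step B X ^^ k) (insert \<zero>\<^bsub>X\<^esub> G)" for k
  have T0: "T 0 = insert \<zero>\<^bsub>X\<^esub> G" and TS: "T (Suc k) = bimodule_step B X (T k)" for k
    by (simp_all add: T_def)
  have Tc: "T k \<subseteq> carrier X" for k
  proof (induction k)
    case (Suc k)
    then show ?case
      unfolding TS bimodule_step_def
      by (auto simp: subset_iff lact_closed ract_closed)
  qed (use G in \<open>simp add: T0\<close>)
  have Ts: "small TYPE('b) (T k)" for k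
  proof (induction k)
    case 0
    have "small TYPE('b) {\<zero>\<^bsub>X\<^esub>}"
      by (rule small_subset[OF small_range[of "\<lambda>_. \<zero>\<^bsub>X\<^esub>"]]) simp
    from small_Un[OF this G(1)] show ?case
      by (simp add: T0)
  next
    case (Suc k)
    then show ?case
      unfolding TS bimodule_step_def
      by (intro small_Un small_image small_Times small_complex small_self)
  qed
  have mono: "T k \<subseteq> T (k + j)" for k j
    by (induction j) (auto simp: TS bimodule_step_def)
  define S0 where "S0 = (\<Union>k. T k)"
  have S0c: "x \<in> carrier X" if "x \<in> S0" for x
    using that Tc by (auto simp: S0_def)
  have add0: "x \<oplus>\<^bsub>X\<^esub> y \<in> S0" if xy: "x \<in> S0" "y \<in> S0" for x y
  proof -
    obtain k j where "x \<in> T k" "y \<in> T j"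
      using xy unfolding S0_def by blast
    then have "x \<in> T (k + j)" "y \<in> T (k + j)"
      using mono[of k j] mono[of j k] by (auto simp: add.commute)
    then have "x \<oplus>\<^bsub>X\<^esub> y \<in> T (Suc (k + j))"
      unfolding TS bimodule_step_def by force
    then show ?thesis
      unfolding S0_def by blast
  qed
  have op0: "c \<odot>\<^bsub>X\<^esub> x \<in> S0" "a \<in> carrier B \<Longrightarrow> lact X a x \<in> S0" "a \<in> carrier B \<Longrightarrow> ract X x a \<in> S0"
    if x: "x \<in> S0" for x c a
  proof -
    obtain k where "x \<in> T k"
      using x unfolding S0_def by blast
    then have "c \<odot>\<^bsub>X\<^esub> x \<in> T (Suc k)" "a \<in> carrier B \<Longrightarrow> lact X a x \<in> T (Suc k)"
      "a \<in> carrier B \<Longrightarrow> ract X x a \<in> T (Suc k)"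
      unfolding TS bimodule_step_def by force+
    then show "c \<odot>\<^bsub>X\<^esub> x \<in> S0" "a \<in> carrier B \<Longrightarrow> lact X a x \<in> S0" "a \<in> carrier B \<Longrightarrow> ract X x a \<in> S0"
      unfolding S0_def by blast+
  qed
  define S where "S = {l \<in> carrier X. \<exists>s. (\<forall>n. s n \<in> S0) \<and> converges X s l}"
  have SI: "l \<in> S" if "\<And>n. s n \<in> S0" "l \<in> carrier X" "converges X s l" for s l
    using that unfolding S_def by blast
  have S0S: "S0 \<subseteq> S"
  proof
    fix x assume "x \<in> S0"
    then show "x \<in> S"
      using S0c by (intro SI[of "\<lambda>_. x"]) simp_all
  qed
  have map: "f l \<in> S" if l: "l \<in> S" and f: "\<And>x. x \<in> carrier X \<Longrightarrow> f x \<in> carrier X" "\<And>x. x \<in> S0 \<Longrightarrow> f x \<in> S0"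
    "\<And>x y. x \<in> carrier X \<Longrightarrow> y \<in> carrier X \<Longrightarrow> gap X (f x) (f y) \<le> C * gap X x y" for f l C
  proof -
    obtain s where s: "\<And>n. s n \<in> S0" "converges X s l" "l \<in> carrier X"
      using l unfolding S_def by blast
    have 1: "\<bar>gap X (f (s n)) (f l)\<bar> \<le> C * gap X (s n) l" for n
      using f(3)[of "s n" l] s S0c f(1) by simp
    have 2: "(\<lambda>n. C * gap X (s n) l) \<longlonglongrightarrow> 0"
      using s(2) tendsto_mult_right_zero unfolding converges_def by blast
    have "converges X (\<lambda>n. f (s n)) (f l)"
      unfolding converges_def by (rule null_squeeze[OF 1 2])
    then show ?thesis
      using s f by (intro SI[of "\<lambda>n. f (s n)"]) simp_all
  qed
  have Ss: "small TYPE('b) S"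
  proof -
    have "small TYPE('b) S0"
      unfolding S0_def by (rule small_UN[OF Ts])
    then have "small TYPE('b) ((\<lambda>s. THE l. l \<in> carrier X \<and> converges X s l) ` {s. \<forall>n. s n \<in> S0})"
      by (intro small_image small_sequences)
    moreover have "S \<subseteq> (\<lambda>s. THE l. l \<in> carrier X \<and> converges X s l) ` {s. \<forall>n. s n \<in> S0}"
    proof
      fix l assume "l \<in> S"
      then obtain s where s: "\<And>n. s n \<in> S0" "converges X s l" "l \<in> carrier X"
        unfolding S_def by blast
      have "(THE l. l \<in> carrier X \<and> converges X s l) = l"
        using s X.converges_unique[of s] S0c by (intro the_equality) blast+
      then show "l \<in> (\<lambda>s. THE l. l \<in> carrier X \<and> converges X s l) ` {s. \<forall>n. s n \<in> S0}"
        using s(1) by (intro image_eqI[of _ _ s]) simp_all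
    qed
    ultimately show ?thesis
      by (rule small_subset)
  qed
  have Sc: "S \<subseteq> carrier X"
    unfolding S_def by blast
  have sub: "banach_space (X\<lparr>carrier := S\<rparr>)"
  proof (rule banach_subspace[OF X.banach_space_axioms Sc])
    show "\<zero>\<^bsub>X\<^esub> \<in> S"
      using S0S T0 unfolding S0_def by blast
    show "x \<oplus>\<^bsub>X\<^esub> y \<in> S" if xy: "x \<in> S" "y \<in> S" for x y
    proof -
      obtain s t where s: "\<And>n. s n \<in> S0" "converges X s x" "x \<in> carrier X"
        and t: "\<And>n. t n \<in> S0" "converges X t y" "y \<in> carrier X"
        using xy unfolding S_def by blast
      show ?thesis
        using s t S0c by (intro SI[of "\<lambda>n. s n \<oplus>\<^bsub>X\<^esub> t n"] add0 X.converges_plus) simp_all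
    qed
    show "c \<odot>\<^bsub>X\<^esub> x \<in> S" if "x \<in> S" for c x
      using that by (intro map[of x "\<lambda>x. c \<odot>\<^bsub>X\<^esub> x" "cmod c"]) (simp_all add: op0 X.gap_smult)
    fix s l assume s: "\<And>n. s n \<in> S" "l \<in> carrier X" "converges X s l"
    have "\<exists>y\<in>S0. gap X y (s n) < 1 / real (Suc n)" for n
    proof -
      obtain t where t: "\<And>m. t m \<in> S0" "converges X t (s n)"
        using s(1)[of n] unfolding S_def by blast
      obtain N where "\<And>m. m \<ge> N \<Longrightarrow> norm (gap X (t m) (s n) - 0) < 1 / real (Suc n)"
        using LIMSEQ_D[of "\<lambda>m. gap X (t m) (s n)" 0 "1 / real (Suc n)"] t(2) unfolding converges_def by auto
      from this[of N] show ?thesis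
        using t(1)[of N] by (intro bexI[of _ "t N"]) simp_all
    qed
    then obtain y where y: "\<And>n. y n \<in> S0" "\<And>n. gap X (y n) (s n) < 1 / real (Suc n)"
      by metis
    have 1: "\<bar>gap X (y n) l\<bar> \<le> 1 / real (Suc n) + gap X (s n) l" for n
      using X.gap_triangle[of "y n" "s n" l] y(2)[of n] S0c[OF y(1)[of n]] s(1)[of n] s(2) Sc
        X.gap_nonneg[of "y n" l] by fastforce
    have 2: "(\<lambda>n. 1 / real (Suc n) + gap X (s n) l) \<longlonglongrightarrow> 0"
      using tendsto_add[OF LIMSEQ_Suc[OF lim_1_over_n] s(3)[unfolded converges_def]] by simp
    show "l \<in> S"
      by (rule SI[OF y(1) s(2)]) (unfold converges_def, rule null_squeeze[OF 1 2])
  qed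
  have act: "lact X a x \<in> S" "ract X x a \<in> S" if ax: "a \<in> carrier B" "x \<in> S" for a x
  proof -
    obtain C where C: "C \<ge> 0"
      "\<And>x y. \<lbrakk>x \<in> carrier X; y \<in> carrier X\<rbrakk> \<Longrightarrow> gap X (lact X a x) (lact X a y) \<le> C * gap X x y"
      "\<And>x y. \<lbrakk>x \<in> carrier X; y \<in> carrier X\<rbrakk> \<Longrightarrow> gap X (ract X x a) (ract X y a) \<le> C * gap X x y"
      using banach_bimodule_gap_bound[OF X ax(1)] by blast
    show "lact X a x \<in> S"
      using that C by (intro map[of x "\<lambda>x. lact X a x" C]) (simp_all add: op0 lact_closed)
    show "ract X x a \<in> S"
      using that C by (intro map[of x "\<lambda>x. ract X x a" C]) (simp_all add: op0 ract_closed)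
  qed
  have "G \<subseteq> S"
    using S0S T0 unfolding S0_def by blast
  then show ?thesis
    using that[of S] Sc Ss banach_bimodule_sub[OF X sub Sc act] by blast
qed

text \<open>
  A bimodule of any size may be replaced by the closed submodule that a small set generates, and the
  universe \<open>'u\<close> contains a copy of the latter.
\<close>

lemma small_submodule_in_universe:
  fixes B :: "('b, 'm) normed_struct_scheme" and X :: "('b, 'x, 'n) bimodule_scheme"
  assumes X: "banach_bimodule B X" and G: "small TYPE('b) G" "G \<subseteq> carrier X"
    and univ: "\<exists>h :: (nat \<Rightarrow> 'b \<times> complex) \<Rightarrow> 'u. inj h"
  obtains Y :: "('b, 'u) bimodule" and e where "banach_bimodule B Y" "bimodule_morphism B Y X e"
    "inj_on e (carrier Y)" "\<And>y. y \<in> carrier Y \<Longrightarrow> nrm X (e y) = nrm Y y" "G \<subseteq> e ` carrier Y"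
proof -
  obtain S where S: "G \<subseteq> S" "S \<subseteq> carrier X" "small TYPE('b) S" "banach_bimodule B (X\<lparr>carrier := S\<rparr>)"
    using small_closed_submodule[OF X G] by blast
  interpret S: banach_bimodule B "X\<lparr>carrier := S\<rparr>" by (fact S)
  obtain h :: "(nat \<Rightarrow> 'b \<times> complex) \<Rightarrow> 'u" where h: "inj h"
    using univ by blast
  obtain g :: "(nat \<Rightarrow> 'b \<times> complex) \<Rightarrow> 'x" where g: "S \<subseteq> range g"
    using S(3) unfolding small_def by blast
  define j where "j = h \<circ> inv_into UNIV g"
  have "inj_on (inv_into UNIV g) S"
    using g by (rule inj_on_inv_into)
  then have "inj_on j S"
    unfolding j_def using h by (intro comp_inj_on) (auto intro: inj_on_subset)
  define e where "e = inv_into S j"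
  have ej [simp]: "e (j x) = x" if "x \<in> S" for x
    using \<open>inj_on j S\<close> that by (simp add: e_def)
  define Y :: "('b, 'u) bimodule" where
    "Y = \<lparr>carrier = j ` S, mult = undefined, one = undefined, zero = j \<zero>\<^bsub>X\<^esub>,
       add = (\<lambda>x y. j (e x \<oplus>\<^bsub>X\<^esub> e y)), smult = (\<lambda>c x. j (c \<odot>\<^bsub>X\<^esub> e x)), nrm = (\<lambda>x. nrm X (e x)),
       lact = (\<lambda>a x. j (lact X a (e x))), ract = (\<lambda>x a. j (ract X (e x) a))\<rparr>"
  have eS: "e y \<in> S" if "y \<in> carrier Y" for y
    using that by (auto simp: Y_def)
  have cl: "x \<oplus>\<^bsub>X\<^esub> y \<in> S" "c \<odot>\<^bsub>X\<^esub> x \<in> S" "\<zero>\<^bsub>X\<^esub> \<in> S" "a \<in> carrier B \<Longrightarrow> lact X a x \<in> S"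
    "a \<in> carrier B \<Longrightarrow> ract X x a \<in> S" if "x \<in> S" "y \<in> S" for x y c a
    using that S.X.M.a_closed[of x y] S.X.smult_mem[of x c] S.X.M.zero_closed S.lact_closed[of a x] S.ract_closed[of a x]
    by simp_all
  have zS: "\<zero>\<^bsub>X\<^esub> \<in> S"
    using S.X.M.zero_closed by simp
  have bij: "bij_betw e (carrier Y) (carrier (X\<lparr>carrier := S\<rparr>))"
    unfolding bij_betw_def by (auto simp: Y_def inj_on_def image_image)
  have Yb: "banach_space Y"
    by (rule banach_space_transfer[OF S.X.banach_space_axioms bij]) (auto simp: Y_def cl zS)
  have YB: "banach_bimodule B Y"
    by (rule banach_bimodule_transfer[OF S(4) Yb bij]) (auto simp: Y_def cl)
  moreover have "bimodule_morphism B Y X e"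
    unfolding bimodule_morphism_def bounded_linear_map_def
  proof (intro conjI ballI allI)
    show "e \<in> carrier Y \<rightarrow> carrier X"
      using eS S(2) by blast
    show "\<exists>C. \<forall>x\<in>carrier Y. nrm X (e x) \<le> C * nrm Y x"
      by (intro exI[of _ 1]) (simp add: Y_def)
  qed (auto simp: Y_def cl)
  moreover have "G \<subseteq> e ` carrier Y"
  proof
    fix x assume "x \<in> G"
    then have "x \<in> S" using S by blast
    then show "x \<in> e ` carrier Y"
      by (intro image_eqI[of _ _ "j x"]) (simp_all add: Y_def)
  qed
  ultimately show ?thesis
    using that[of Y e] bij by (simp add: bij_betw_def Y_def)
qed

section \<open>The unitization as a bimodule\<close>

lemma unitization_bimodule_simps [simp]:
  "carrier (unitization_bimodule B) = carrier B \<times> UNIV"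
  "zero (unitization_bimodule B) = (\<zero>\<^bsub>B\<^esub>, 0)"
  "p \<oplus>\<^bsub>unitization_bimodule B\<^esub> q = (fst p \<oplus>\<^bsub>B\<^esub> fst q, snd p + snd q)"
  "c \<odot>\<^bsub>unitization_bimodule B\<^esub> p = (c \<odot>\<^bsub>B\<^esub> fst p, c * snd p)"
  "nrm (unitization_bimodule B) p = nrm B (fst p) + cmod (snd p)"
  by (simp_all add: unitization_bimodule_def unitization_def normed_struct.extend_def split_beta)

lemma (in banach_algebra) zero_mult [simp]:
  assumes "a \<in> carrier A"
  shows "\<zero> \<otimes> a = \<zero>" "a \<otimes> \<zero> = \<zero>"
  using smult_mult_left[of \<zero> a 0] smult_mult_right[of a \<zero> 0] assms mult_closed by simp_all

lemma (in banach_algebra) unitization_act [simp]: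
  assumes "a \<in> carrier A" "fst p \<in> carrier A"
  shows "lact (unitization_bimodule A) a p = (a \<otimes> fst p \<oplus> snd p \<odot> a, 0)"
    "ract (unitization_bimodule A) p a = (fst p \<otimes> a \<oplus> snd p \<odot> a, 0)"
  using assms
  by (simp_all add: unitization_bimodule_def unitization_def normed_struct.extend_def split_beta)

lemma (in banach_algebra) banach_space_unitization_bimodule: "banach_space (unitization_bimodule A)"
  by (rule banach_space_transfer[OF banach_space_dsum[OF banach_space_axioms banach_space_complex], of id])
    (auto simp: dsum_def complex_space_def)

lemma (in banach_algebra) banach_bimodule_unitization: "banach_bimodule A (unitization_bimodule A)"
proof (intro banach_bimodule.intro banach_space_unitization_bimodule banach_bimodule_axioms.intro)
  show "banach_algebra A" ..
  have 1: "nrm A (a \<otimes> b \<oplus> s \<odot> a) \<le> nrm A a * (nrm A b + cmod s)"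
    "nrm A (b \<otimes> a \<oplus> s \<odot> a) \<le> nrm A a * (nrm A b + cmod s)"
    if ab: "a \<in> carrier A" "b \<in> carrier A" for a b s
    using nrm_triangle[of "a \<otimes> b" "s \<odot> a"] nrm_triangle[of "b \<otimes> a" "s \<odot> a"] nrm_smult[of a s]
      nrm_mult[OF ab] nrm_mult[OF ab(2) ab(1)] ab
    by (simp_all add: mult_closed algebra_simps)
  show "\<exists>C. \<forall>a\<in>carrier A. \<forall>x\<in>carrier (unitization_bimodule A).
       nrm (unitization_bimodule A) (lact (unitization_bimodule A) a x)
       \<le> C * nrm A a * nrm (unitization_bimodule A) x \<and>
       nrm (unitization_bimodule A) (ract (unitization_bimodule A) x a)
       \<le> C * nrm A a * nrm (unitization_bimodule A) x"
    by (intro exI[of _ 1]) (auto simp: 1)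
qed (auto simp: mult_closed mult_distl mult_distr mult_assoc smult_mult_left smult_mult_right
    sm_plus sm_add sm_sm M.a_ac mult.commute)

section \<open>Derivations and contractibility\<close>

definition derivation ::
    "('b, 'm) normed_struct_scheme \<Rightarrow> ('b, 'x, 'n) bimodule_scheme \<Rightarrow> ('b \<Rightarrow> 'x) \<Rightarrow> bool" where
  "derivation B X D \<longleftrightarrow> bounded_linear_map B X D \<and>
     (\<forall>a\<in>carrier B. \<forall>b\<in>carrier B. D (a \<otimes>\<^bsub>B\<^esub> b) = lact X a (D b) \<oplus>\<^bsub>X\<^esub> ract X (D a) b)"

definition commutator ::
    "('b, 'x, 'n) bimodule_scheme \<Rightarrow> 'x \<Rightarrow> 'b \<Rightarrow> 'x" where
  "commutator X x a = lact X a x \<oplus>\<^bsub>X\<^esub> (- 1) \<odot>\<^bsub>X\<^esub> ract X x a"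

definition inner_derivation ::
    "('b, 'm) normed_struct_scheme \<Rightarrow> ('b, 'x, 'n) bimodule_scheme \<Rightarrow> ('b \<Rightarrow> 'x) \<Rightarrow> bool" where
  "inner_derivation B X D \<longleftrightarrow> (\<exists>x\<in>carrier X. \<forall>a\<in>carrier B. D a = commutator X x a)"

lemma bounded_linear_mapD:
  assumes "bounded_linear_map E F f"
  shows "x \<in> carrier E \<Longrightarrow> f x \<in> carrier F"
    "\<lbrakk>x \<in> carrier E; y \<in> carrier E\<rbrakk> \<Longrightarrow> f (x \<oplus>\<^bsub>E\<^esub> y) = f x \<oplus>\<^bsub>F\<^esub> f y"
    "x \<in> carrier E \<Longrightarrow> f (c \<odot>\<^bsub>E\<^esub> x) = c \<odot>\<^bsub>F\<^esub> f x"
  using assms unfolding bounded_linear_map_def by auto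

lemma bounded_linear_map_bound:
  assumes "bounded_linear_map E F f" "banach_space E"
  obtains C where "C \<ge> 0" "\<And>x. x \<in> carrier E \<Longrightarrow> nrm F (f x) \<le> C * nrm E x"
proof -
  interpret E: banach_space E by fact
  obtain C where C: "\<And>x. x \<in> carrier E \<Longrightarrow> nrm F (f x) \<le> C * nrm E x"
    using assms unfolding bounded_linear_map_def by blast
  have "nrm F (f x) \<le> \<bar>C\<bar> * nrm E x" if "x \<in> carrier E" for x
    using C[OF that] mult_right_mono[of C "\<bar>C\<bar>" "nrm E x"] E.nrm_nonneg[OF that] by linarith
  then show ?thesis
    using that[of "\<bar>C\<bar>"] by simp
qed

lemma bounded_linear_map_gap:
  assumes f: "bounded_linear_map E F f" and E: "banach_space E"
  obtains C where "C \<ge> 0"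
    "\<And>x y. \<lbrakk>x \<in> carrier E; y \<in> carrier E\<rbrakk> \<Longrightarrow> gap F (f x) (f y) \<le> C * gap E x y"
proof -
  interpret E: banach_space E by fact
  obtain C where C: "C \<ge> 0" "\<And>x. x \<in> carrier E \<Longrightarrow> nrm F (f x) \<le> C * nrm E x"
    using bounded_linear_map_bound[OF assms] by blast
  have "gap F (f x) (f y) \<le> C * gap E x y" if "x \<in> carrier E" "y \<in> carrier E" for x y
    using C(2)[of "x \<oplus>\<^bsub>E\<^esub> (- 1) \<odot>\<^bsub>E\<^esub> y"] that by (simp add: gap_def bounded_linear_mapD[OF f])
  then show ?thesis
    using that C(1) by blast
qed

context banach_bimodule
begin

lemmas act_closed [simp] = lact_closed ract_closed

definition unital_lact :: "'a \<times> complex \<Rightarrow> 'x \<Rightarrow> 'x" where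
  "unital_lact p x = lact X (fst p) x \<oplus>\<^bsub>X\<^esub> snd p \<odot>\<^bsub>X\<^esub> x"

lemma bounds:
  obtains C where "C \<ge> 0"
    "\<And>a x. \<lbrakk>a \<in> carrier B; x \<in> carrier X\<rbrakk> \<Longrightarrow> nrm X (lact X a x) \<le> C * nrm B a * nrm X x"
    "\<And>a x. \<lbrakk>a \<in> carrier B; x \<in> carrier X\<rbrakk> \<Longrightarrow> nrm X (ract X x a) \<le> C * nrm B a * nrm X x"
proof -
  obtain C where C: "\<And>a x. \<lbrakk>a \<in> carrier B; x \<in> carrier X\<rbrakk> \<Longrightarrow>
      nrm X (lact X a x) \<le> C * nrm B a * nrm X x \<and> nrm X (ract X x a) \<le> C * nrm B a * nrm X x"
    using act_bounded by blast
  have le: "C * nrm B a * nrm X x \<le> \<bar>C\<bar> * nrm B a * nrm X x" if "a \<in> carrier B" "x \<in> carrier X" for a x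
    using that by (intro mult_right_mono B.nrm_nonneg X.nrm_nonneg) auto
  show ?thesis
  proof (rule that[of "\<bar>C\<bar>"])
    fix a x assume ax: "a \<in> carrier B" "x \<in> carrier X"
    show "nrm X (lact X a x) \<le> \<bar>C\<bar> * nrm B a * nrm X x" "nrm X (ract X x a) \<le> \<bar>C\<bar> * nrm B a * nrm X x"
      using C[OF ax] le[OF ax] by linarith+
  qed simp
qed

lemma unital_lact_closed [simp]: "fst p \<in> carrier B \<Longrightarrow> x \<in> carrier X \<Longrightarrow> unital_lact p x \<in> carrier X"
  by (simp add: unital_lact_def)

lemma lact_zero [simp]: "a \<in> carrier B \<Longrightarrow> lact X a \<zero>\<^bsub>X\<^esub> = \<zero>\<^bsub>X\<^esub>"
  using lact_smult[of a "\<zero>\<^bsub>X\<^esub>" 0] by simp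

lemma ract_zero [simp]: "a \<in> carrier B \<Longrightarrow> ract X \<zero>\<^bsub>X\<^esub> a = \<zero>\<^bsub>X\<^esub>"
  using ract_smult[of a "\<zero>\<^bsub>X\<^esub>" 0] by simp

lemma zero_lact [simp]: "x \<in> carrier X \<Longrightarrow> lact X \<zero>\<^bsub>B\<^esub> x = \<zero>\<^bsub>X\<^esub>"
  using smult_lact[of "\<zero>\<^bsub>B\<^esub>" x 0] by simp

lemma zero_ract [simp]: "x \<in> carrier X \<Longrightarrow> ract X x \<zero>\<^bsub>B\<^esub> = \<zero>\<^bsub>X\<^esub>"
  using smult_ract[of "\<zero>\<^bsub>B\<^esub>" x 0] by simp

text \<open>
  The right action on this extension of the unitization by \<open>X\<close> is twisted by the derivation \<open>D\<close>,
  and a bimodule splitting of the extension makes \<open>D\<close> inner.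
\<close>

definition twisted_extension :: "('a \<Rightarrow> 'x) \<Rightarrow> ('a, 'x \<times> 'a \<times> complex) bimodule" where
  "twisted_extension D =
     \<lparr>carrier = carrier X \<times> carrier B \<times> UNIV, mult = undefined, one = undefined,
      zero = (\<zero>\<^bsub>X\<^esub>, \<zero>\<^bsub>B\<^esub>, 0),
      add = (\<lambda>p q. (fst p \<oplus>\<^bsub>X\<^esub> fst q, snd p \<oplus>\<^bsub>unitization_bimodule B\<^esub> snd q)),
      smult = (\<lambda>c p. (c \<odot>\<^bsub>X\<^esub> fst p, c \<odot>\<^bsub>unitization_bimodule B\<^esub> snd p)),
      nrm = (\<lambda>p. nrm X (fst p) + nrm (unitization_bimodule B) (snd p)),
      lact = (\<lambda>a p. (lact X a (fst p), lact (unitization_bimodule B) a (snd p))),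
      ract = (\<lambda>p a. (ract X (fst p) a \<oplus>\<^bsub>X\<^esub> unital_lact (snd p) (D a), ract (unitization_bimodule B) (snd p) a))\<rparr>"

lemma banach_bimodule_twisted:
  assumes D: "derivation B X D"
  shows "banach_bimodule B (twisted_extension D)" (is "banach_bimodule B ?Y")
proof -
  interpret U: banach_bimodule B "unitization_bimodule B"
    by (rule B.banach_bimodule_unitization)
  have Dl: "bounded_linear_map B X D"
    and Dm: "\<And>a b. \<lbrakk>a \<in> carrier B; b \<in> carrier B\<rbrakk> \<Longrightarrow> D (a \<otimes>\<^bsub>B\<^esub> b) = lact X a (D b) \<oplus>\<^bsub>X\<^esub> ract X (D a) b"
    using D unfolding derivation_def by auto
  note Ds = bounded_linear_mapD[OF Dl]
  show ?thesis
  proof (intro banach_bimodule.intro banach_bimodule_axioms.intro)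
    show "banach_algebra B" ..
    show "banach_space ?Y"
      by (rule banach_space_transfer[OF banach_space_dsum[OF X.banach_space_axioms U.X.banach_space_axioms], of id])
        (auto simp: twisted_extension_def dsum_def)
    obtain C where C: "C \<ge> 0"
      "\<And>a x. \<lbrakk>a \<in> carrier B; x \<in> carrier X\<rbrakk> \<Longrightarrow> nrm X (lact X a x) \<le> C * nrm B a * nrm X x"
      "\<And>a x. \<lbrakk>a \<in> carrier B; x \<in> carrier X\<rbrakk> \<Longrightarrow> nrm X (ract X x a) \<le> C * nrm B a * nrm X x"
      using bounds by blast
    obtain K where K: "K \<ge> 0"
      "\<And>a p. \<lbrakk>a \<in> carrier B; p \<in> carrier (unitization_bimodule B)\<rbrakk> \<Longrightarrow>
        nrm (unitization_bimodule B) (lact (unitization_bimodule B) a p) \<le> K * nrm B a * nrm (unitization_bimodule B) p"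
      "\<And>a p. \<lbrakk>a \<in> carrier B; p \<in> carrier (unitization_bimodule B)\<rbrakk> \<Longrightarrow>
        nrm (unitization_bimodule B) (ract (unitization_bimodule B) p a) \<le> K * nrm B a * nrm (unitization_bimodule B) p"
      using U.bounds by blast
    obtain L where L: "L \<ge> 0" "\<And>a. a \<in> carrier B \<Longrightarrow> nrm X (D a) \<le> L * nrm B a"
      using bounded_linear_map_bound[OF Dl B.banach_space_axioms] by blast
    let ?N = "C + K + (C + 1) * L"
    show "\<exists>C. \<forall>a\<in>carrier B. \<forall>x\<in>carrier ?Y.
        nrm ?Y (lact ?Y a x) \<le> C * nrm B a * nrm ?Y x \<and> nrm ?Y (ract ?Y x a) \<le> C * nrm B a * nrm ?Y x"
    proof (intro exI[of _ ?N] ballI)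
      fix a y assume a: "a \<in> carrier B" and y: "y \<in> carrier ?Y"
      obtain x p where xp: "y = (x, p)" "x \<in> carrier X" "p \<in> carrier (unitization_bimodule B)" "fst p \<in> carrier B"
        using y by (cases y) (auto simp: twisted_extension_def)
      define \<alpha> \<xi> \<pi> where "\<alpha> = nrm B a" and "\<xi> = nrm X x" and "\<pi> = nrm (unitization_bimodule B) p"
      have nn: "\<alpha> \<ge> 0" "\<xi> \<ge> 0" "\<pi> \<ge> 0"
        using a xp B.nrm_nonneg X.nrm_nonneg U.X.nrm_nonneg by (auto simp only: \<alpha>_def \<xi>_def \<pi>_def)
      have ny: "nrm ?Y y = \<xi> + \<pi>"
        by (simp add: twisted_extension_def xp \<xi>_def \<pi>_def)
      have Da: "D a \<in> carrier X" "nrm X (D a) \<le> L * \<alpha>"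
        using L(2)[OF a] Ds(1)[OF a] by (simp_all add: \<alpha>_def)
      have "nrm X (unital_lact p (D a)) \<le> C * nrm B (fst p) * nrm X (D a) + cmod (snd p) * nrm X (D a)"
        using X.nrm_triangle[of "lact X (fst p) (D a)" "snd p \<odot>\<^bsub>X\<^esub> D a"] C(2)[of "fst p" "D a"] xp Da
          X.nrm_smult[of "D a" "snd p"]
        unfolding unital_lact_def by simp
      also have "\<dots> = (C * nrm B (fst p) + cmod (snd p)) * nrm X (D a)"
        by (simp add: algebra_simps)
      also have "\<dots> \<le> ((C + 1) * \<pi>) * (L * \<alpha>)"
        using C(1) B.nrm_nonneg[OF xp(4)] Da X.nrm_nonneg[OF Da(1)]
        by (intro mult_mono) (auto simp: \<pi>_def algebra_simps)
      finally have u: "nrm X (unital_lact p (D a)) \<le> (C + 1) * L * \<alpha> * \<pi>"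
        by (simp add: mult_ac)
      have le: "C * \<alpha> * \<xi> + K * \<alpha> * \<pi> + (C + 1) * L * \<alpha> * \<pi> \<le> ?N * \<alpha> * (\<xi> + \<pi>)"
      proof -
        have "?N * \<alpha> * (\<xi> + \<pi>) - (C * \<alpha> * \<xi> + K * \<alpha> * \<pi> + (C + 1) * L * \<alpha> * \<pi>) =
            C * \<alpha> * \<pi> + K * \<alpha> * \<xi> + (C + 1) * L * \<alpha> * \<xi>"
          by (simp add: algebra_simps)
        also have "\<dots> \<ge> 0"
          using nn C(1) K(1) L(1) by (intro add_nonneg_nonneg mult_nonneg_nonneg) auto
        finally show ?thesis by linarith
      qed
      have le0: "(C + 1) * L * \<alpha> * \<pi> \<ge> 0"
        using nn C(1) K(1) L(1) by (intro add_nonneg_nonneg mult_nonneg_nonneg) auto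
      have "nrm ?Y (lact ?Y a y) \<le> C * \<alpha> * \<xi> + K * \<alpha> * \<pi>"
        using C(2)[OF a xp(2)] K(2)[OF a xp(3)]
        unfolding twisted_extension_def xp \<alpha>_def \<xi>_def \<pi>_def bimodule.simps normed_struct.simps fst_conv snd_conv
        by (rule add_mono)
      moreover have "nrm ?Y (ract ?Y y a) \<le> (C * \<alpha> * \<xi> + (C + 1) * L * \<alpha> * \<pi>) + K * \<alpha> * \<pi>"
      proof -
        have "nrm X (ract X x a \<oplus>\<^bsub>X\<^esub> unital_lact p (D a)) \<le> C * \<alpha> * \<xi> + (C + 1) * L * \<alpha> * \<pi>"
          using X.nrm_triangle[of "ract X x a" "unital_lact p (D a)"] C(3)[OF a xp(2)] u a xp Da
          unfolding \<alpha>_def \<xi>_def by simp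
        then show ?thesis
          using K(3)[OF a xp(3)]
          unfolding twisted_extension_def xp(1) bimodule.simps normed_struct.simps fst_conv snd_conv
          unfolding \<alpha>_def[symmetric] \<pi>_def[symmetric]
          by (rule add_mono)
      qed
      ultimately show "nrm ?Y (lact ?Y a y) \<le> ?N * nrm B a * nrm ?Y y \<and> nrm ?Y (ract ?Y y a) \<le> ?N * nrm B a * nrm ?Y y"
        unfolding \<alpha>_def[symmetric] ny using le le0 by (intro conjI) linarith+
    qed
  qed (auto simp: twisted_extension_def B.mult_closed lact_add add_lact lact_smult smult_lact ract_add
      add_ract ract_smult smult_ract lact_assoc ract_assoc lact_ract B.mult_distl B.mult_distr
      B.mult_assoc B.smult_mult_left B.smult_mult_right B.sm_plus B.sm_add B.sm_sm B.M.a_ac mult.commute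
      unital_lact_def X.sm_plus X.sm_add X.sm_sm X.M.a_ac Ds Dm)
qed

end

text \<open>
  A bimodule splitting of the twisted extension sends the adjoined identity to some \<open>(x, 1)\<close>, on
  which both actions of \<open>a\<close> agree. This says that \<open>D\<close> is the commutator with \<open>x\<close>.
\<close>

lemma contractible_imp_inner:
  fixes B :: "('b, 'm) normed_struct_scheme" and X :: "('b, 'x, 'n) bimodule_scheme"
  assumes con: "contractible_algebra TYPE('u) B"
    and univ: "\<exists>h :: (nat \<Rightarrow> 'b \<times> complex) \<Rightarrow> 'u. inj h"
    and X: "banach_bimodule B X" and D: "derivation B X D"
  shows "inner_derivation B X D"
proof -
  interpret banach_bimodule B X by (fact X)
  have Dl: "bounded_linear_map B X D"
    using D unfolding derivation_def by auto
  let ?U = "unitization_bimodule B" and ?Y = "twisted_extension D"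
  interpret U: banach_bimodule B ?U
    by (rule B.banach_bimodule_unitization)
  \<comment> \<open>The submodule that \<open>G\<close> generates still maps onto the unitization and contains the values of a linear section.\<close>
  define G where "G = (\<lambda>p. (\<zero>\<^bsub>X\<^esub>, p)) ` carrier ?U"
  have Gs: "small TYPE('b) G"
    unfolding G_def unitization_bimodule_simps
    by (intro small_image small_Times small_self small_complex)
  have Gc: "G \<subseteq> carrier ?Y"
    by (auto simp: G_def twisted_extension_def)
  obtain Y' :: "('b, 'u) bimodule" and e where Y': "banach_bimodule B Y'" "bimodule_morphism B Y' ?Y e"
    "inj_on e (carrier Y')" "\<And>y. y \<in> carrier Y' \<Longrightarrow> nrm ?Y (e y) = nrm Y' y" "G \<subseteq> e ` carrier Y'"
    using small_submodule_in_universe[OF banach_bimodule_twisted[OF D] Gs Gc univ] by blast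
  interpret Y': banach_bimodule B Y' by (fact Y')
  have el: "bounded_linear_map Y' ?Y e"
    and em: "\<And>a y. \<lbrakk>a \<in> carrier B; y \<in> carrier Y'\<rbrakk> \<Longrightarrow> e (lact Y' a y) = lact ?Y a (e y)"
      "\<And>a y. \<lbrakk>a \<in> carrier B; y \<in> carrier Y'\<rbrakk> \<Longrightarrow> e (ract Y' y a) = ract ?Y (e y) a"
    using Y'(2) unfolding bimodule_morphism_def by auto
  note es = bounded_linear_mapD[OF el]
  have ec: "fst (e y) \<in> carrier X" "snd (e y) \<in> carrier ?U" if "y \<in> carrier Y'" for y
    using es(1)[OF that] by (auto simp: twisted_extension_def)
  define \<phi> where "\<phi> y = snd (e y)" for y
  define \<sigma> where "\<sigma> p = inv_into (carrier Y') e (\<zero>\<^bsub>X\<^esub>, p)" for p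
  have \<sigma>: "\<sigma> p \<in> carrier Y'" "e (\<sigma> p) = (\<zero>\<^bsub>X\<^esub>, p)" if "p \<in> carrier ?U" for p
  proof -
    have "(\<zero>\<^bsub>X\<^esub>, p) \<in> e ` carrier Y'"
      using Y'(5) that unfolding G_def by blast
    then show "\<sigma> p \<in> carrier Y'" "e (\<sigma> p) = (\<zero>\<^bsub>X\<^esub>, p)"
      unfolding \<sigma>_def by (rule inv_into_into, rule f_inv_into_f)
  qed
  have inj: "x = y" if "e x = e y" "x \<in> carrier Y'" "y \<in> carrier Y'" for x y
    using Y'(3) that by (auto simp: inj_on_def)
  have "bimodule_morphism B Y' ?U \<phi>"
    unfolding bimodule_morphism_def bounded_linear_map_def
  proof (intro conjI ballI allI)
    show "\<phi> \<in> carrier Y' \<rightarrow> carrier ?U"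
      using ec by (auto simp: \<phi>_def)
    have "nrm ?U (\<phi> y) \<le> nrm Y' y" if "y \<in> carrier Y'" for y
    proof -
      have "nrm ?U (\<phi> y) \<le> nrm ?Y (e y)"
        using X.nrm_nonneg[OF ec(1)[OF that]] by (simp add: twisted_extension_def \<phi>_def)
      then show ?thesis
        using Y'(4)[OF that] by simp
    qed
    then show "\<exists>C. \<forall>x\<in>carrier Y'. nrm ?U (\<phi> x) \<le> C * nrm Y' x"
      by (intro exI[of _ 1]) simp
  qed (simp_all add: \<phi>_def es em, simp_all add: twisted_extension_def)
  moreover have "bounded_linear_map ?U Y' \<sigma>"
    unfolding bounded_linear_map_def
  proof (intro conjI ballI allI)
    show "\<sigma> \<in> carrier ?U \<rightarrow> carrier Y'"
      using \<sigma>(1) by blast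
    fix p q c assume p: "p \<in> carrier ?U" and q: "q \<in> carrier ?U"
    show "\<sigma> (p \<oplus>\<^bsub>?U\<^esub> q) = \<sigma> p \<oplus>\<^bsub>Y'\<^esub> \<sigma> q"
    proof (rule inj)
      show "e (\<sigma> (p \<oplus>\<^bsub>?U\<^esub> q)) = e (\<sigma> p \<oplus>\<^bsub>Y'\<^esub> \<sigma> q)"
        unfolding es(2)[OF \<sigma>(1)[OF p] \<sigma>(1)[OF q]] \<sigma>(2)[OF p] \<sigma>(2)[OF q] \<sigma>(2)[OF U.X.M.a_closed[OF p q]]
        by (simp add: twisted_extension_def)
    qed (intro \<sigma>(1) U.X.M.a_closed Y'.X.M.a_closed p q)+
  next
    fix p c assume p: "p \<in> carrier ?U"
    show "\<sigma> (c \<odot>\<^bsub>?U\<^esub> p) = c \<odot>\<^bsub>Y'\<^esub> \<sigma> p"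
    proof (rule inj)
      show "e (\<sigma> (c \<odot>\<^bsub>?U\<^esub> p)) = e (c \<odot>\<^bsub>Y'\<^esub> \<sigma> p)"
        unfolding es(3)[OF \<sigma>(1)[OF p]] \<sigma>(2)[OF p] \<sigma>(2)[OF U.X.smult_mem[OF p]]
        by (simp add: twisted_extension_def)
    qed (intro \<sigma>(1) U.X.smult_mem Y'.X.smult_mem p)+
  next
    have "nrm Y' (\<sigma> p) = nrm ?U p" if "p \<in> carrier ?U" for p
      using Y'(4)[OF \<sigma>(1)[OF that]] unfolding \<sigma>(2)[OF that] by (simp add: twisted_extension_def)
    then show "\<exists>C. \<forall>x\<in>carrier ?U. nrm Y' (\<sigma> x) \<le> C * nrm ?U x"
      by (intro exI[of _ 1]) simp
  qed
  moreover have "\<forall>p\<in>carrier ?U. \<phi> (\<sigma> p) = p"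
    by (intro ballI) (simp only: \<phi>_def \<sigma> snd_conv)
  moreover have "\<phi> ` carrier Y' = carrier ?U"
  proof
    show "\<phi> ` carrier Y' \<subseteq> carrier ?U"
      using ec(2) by (auto simp only: \<phi>_def)
    show "carrier ?U \<subseteq> \<phi> ` carrier Y'"
    proof
      fix p assume "p \<in> carrier ?U"
      then show "p \<in> \<phi> ` carrier Y'"
        using \<sigma>[of p] by (intro image_eqI[of _ _ "\<sigma> p"]) (simp_all only: \<phi>_def snd_conv)
    qed
  qed
  ultimately obtain \<rho> where \<rho>: "bimodule_morphism B ?U Y' \<rho>" "\<forall>p\<in>carrier ?U. \<phi> (\<rho> p) = p"
    using con Y'(1) unfolding contractible_algebra_def projective_bimodule_def by blast
  have \<rho>l: "bounded_linear_map ?U Y' \<rho>"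
    and \<rho>m: "\<And>a p. \<lbrakk>a \<in> carrier B; p \<in> carrier ?U\<rbrakk> \<Longrightarrow> \<rho> (lact ?U a p) = lact Y' a (\<rho> p)"
      "\<And>a p. \<lbrakk>a \<in> carrier B; p \<in> carrier ?U\<rbrakk> \<Longrightarrow> \<rho> (ract ?U p a) = ract Y' (\<rho> p) a"
    using \<rho>(1) unfolding bimodule_morphism_def by auto
  let ?u = "(\<zero>\<^bsub>B\<^esub>, 1) :: 'b \<times> complex"
  have 1: "?u \<in> carrier ?U"
    by simp
  define x where "x = fst (e (\<rho> ?u))"
  have \<rho>1: "\<rho> ?u \<in> carrier Y'"
    by (rule bounded_linear_mapD(1)[OF \<rho>l 1])
  have x: "x \<in> carrier X" "e (\<rho> ?u) = (x, ?u)"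
  proof -
    show "x \<in> carrier X"
      unfolding x_def by (rule ec(1)[OF \<rho>1])
    show "e (\<rho> ?u) = (x, ?u)"
      using \<rho>(2) 1 unfolding x_def \<phi>_def by (metis prod.collapse)
  qed
  have "D a = commutator X x a" if a: "a \<in> carrier B" for a
  proof -
    have "lact ?U a ?u = ract ?U ?u a"
      using a by simp
    then have "lact ?Y a (x, ?u) = ract ?Y (x, ?u) a"
      using \<rho>m[OF a 1] em[OF a \<rho>1] x(2) by simp
    then have eq: "lact X a x = ract X x a \<oplus>\<^bsub>X\<^esub> unital_lact ?u (D a)"
      by (simp add: twisted_extension_def)
    have Da: "D a \<in> carrier X"
      by (rule bounded_linear_mapD(1)[OF Dl a])
    show ?thesis
      unfolding commutator_def eq using Da x(1) a
      by (simp add: unital_lact_def X.M.a_ac)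
  qed
  then show ?thesis
    unfolding inner_derivation_def using x(1) by blast
qed

lemma (in banach_bimodule) commutator_closed [simp]:
  "\<lbrakk>x \<in> carrier X; a \<in> carrier B\<rbrakk> \<Longrightarrow> commutator X x a \<in> carrier X"
  by (simp add: commutator_def)

lemma (in banach_bimodule) derivation_commutator:
  assumes x: "x \<in> carrier X"
  shows "derivation B X (commutator X x)"
  unfolding derivation_def bounded_linear_map_def
proof (intro conjI ballI allI)
  show "commutator X x \<in> carrier B \<rightarrow> carrier X"
    using x by simp
  obtain C where C: "C \<ge> 0"
    "\<And>a x. \<lbrakk>a \<in> carrier B; x \<in> carrier X\<rbrakk> \<Longrightarrow> nrm X (lact X a x) \<le> C * nrm B a * nrm X x"
    "\<And>a x. \<lbrakk>a \<in> carrier B; x \<in> carrier X\<rbrakk> \<Longrightarrow> nrm X (ract X x a) \<le> C * nrm B a * nrm X x"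
    using bounds by blast
  have "nrm X (commutator X x a) \<le> 2 * C * nrm X x * nrm B a" if a: "a \<in> carrier B" for a
    using X.nrm_triangle[of "lact X a x" "(- 1) \<odot>\<^bsub>X\<^esub> ract X x a"] X.nrm_smult[of "ract X x a" "- 1"]
      C(2,3)[OF a x] a x
    unfolding commutator_def by (simp add: algebra_simps)
  then show "\<exists>C. \<forall>a\<in>carrier B. nrm X (commutator X x a) \<le> C * nrm B a"
    by blast
  fix a b assume ab: "a \<in> carrier B" "b \<in> carrier B"
  show "commutator X x (a \<oplus>\<^bsub>B\<^esub> b) = commutator X x a \<oplus>\<^bsub>X\<^esub> commutator X x b"
    using ab x by (simp add: commutator_def add_lact add_ract X.sm_plus X.M.a_ac)
  show "commutator X x (a \<otimes>\<^bsub>B\<^esub> b) = lact X a (commutator X x b) \<oplus>\<^bsub>X\<^esub> ract X (commutator X x a) b"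
    using ab x by (simp add: commutator_def lact_add ract_add lact_smult ract_smult lact_assoc
        ract_assoc lact_ract X.M.a_assoc)
next
  fix a c assume a: "a \<in> carrier B"
  show "commutator X x (c \<odot>\<^bsub>B\<^esub> a) = c \<odot>\<^bsub>X\<^esub> commutator X x a"
    using a x by (simp add: commutator_def smult_lact smult_ract X.sm_plus X.sm_sm mult.commute)
qed

text \<open>
  Given an epimorphism \<open>\<phi>\<close> onto the unitization and a preimage \<open>y\<close> of the adjoined identity, the
  commutator with \<open>y\<close> is a derivation into the kernel of \<open>\<phi>\<close>. If it is the commutator with some
  \<open>k\<close> in the kernel, then \<open>y - k\<close> is a central preimage, and it determines a splitting.
\<close>

lemma inner_imp_contractible:
  fixes B :: "('b, 'm) normed_struct_scheme"
  assumes B: "banach_algebra B"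
    and inner: "\<And>X D. \<lbrakk>banach_bimodule B (X :: ('b, 'u) bimodule); derivation B X D\<rbrakk> \<Longrightarrow> inner_derivation B X D"
  shows "contractible_algebra TYPE('u) B"
proof -
  interpret B: banach_algebra B by (fact B)
  let ?U = "unitization_bimodule B"
  interpret U: banach_bimodule B ?U
    by (rule B.banach_bimodule_unitization)
  let ?u = "(\<zero>\<^bsub>B\<^esub>, 1) :: 'b \<times> complex"
  have "\<exists>\<rho>. bimodule_morphism B ?U Y \<rho> \<and> (\<forall>p\<in>carrier ?U. \<phi> (\<rho> p) = p)"
    if Y: "banach_bimodule B (Y :: ('b, 'u) bimodule)" and \<phi>: "bimodule_morphism B Y ?U \<phi>"
      and surj: "\<phi> ` carrier Y = carrier ?U" for Y \<phi>
  proof -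
    interpret Y: banach_bimodule B Y by (fact Y)
    have \<phi>l: "bounded_linear_map Y ?U \<phi>"
      and \<phi>m: "\<And>a y. \<lbrakk>a \<in> carrier B; y \<in> carrier Y\<rbrakk> \<Longrightarrow> \<phi> (lact Y a y) = lact ?U a (\<phi> y)"
        "\<And>a y. \<lbrakk>a \<in> carrier B; y \<in> carrier Y\<rbrakk> \<Longrightarrow> \<phi> (ract Y y a) = ract ?U (\<phi> y) a"
      using \<phi> unfolding bimodule_morphism_def by auto
    note \<phi>s = bounded_linear_mapD[OF \<phi>l]
    have "?u \<in> \<phi> ` carrier Y"
      unfolding surj by simp
    then obtain y where y: "y \<in> carrier Y" "\<phi> y = ?u"
      by (metis imageE)
    have \<phi>z: "\<phi> \<zero>\<^bsub>Y\<^esub> = \<zero>\<^bsub>?U\<^esub>"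
      using \<phi>s(3)[of "\<zero>\<^bsub>Y\<^esub>" 0] \<phi>s(1)[of "\<zero>\<^bsub>Y\<^esub>"] by (simp add: mem_Times_iff)
    define K where "K = {k \<in> carrier Y. \<phi> k = \<zero>\<^bsub>?U\<^esub>}"
    have Kc: "K \<subseteq> carrier Y"
      unfolding K_def by blast
    have Ks: "banach_space (Y\<lparr>carrier := K\<rparr>)"
    proof (rule banach_subspace[OF Y.X.banach_space_axioms Kc])
      fix s l assume s: "\<And>n. s n \<in> K" "l \<in> carrier Y" "converges Y s l"
      obtain C where C: "C \<ge> 0" "\<And>x y. \<lbrakk>x \<in> carrier Y; y \<in> carrier Y\<rbrakk> \<Longrightarrow> gap ?U (\<phi> x) (\<phi> y) \<le> C * gap Y x y"
        using bounded_linear_map_gap[OF \<phi>l Y.X.banach_space_axioms] by blast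
      have sY: "s n \<in> carrier Y" "\<phi> (s n) = \<zero>\<^bsub>?U\<^esub>" for n
        using s(1)[of n] by (simp_all add: K_def)
      have 1: "\<bar>gap ?U (\<phi> (s n)) (\<phi> l)\<bar> \<le> C * gap Y (s n) l" for n
        using C(2)[OF sY(1) s(2)] U.X.gap_nonneg[OF \<phi>s(1)[OF sY(1)] \<phi>s(1)[OF s(2)]] by simp
      have 2: "(\<lambda>n. C * gap Y (s n) l) \<longlonglongrightarrow> 0"
        using s(3) tendsto_mult_right_zero unfolding converges_def by blast
      have "converges ?U (\<lambda>n. \<phi> (s n)) (\<phi> l)"
        unfolding converges_def by (rule null_squeeze[OF 1 2])
      moreover have "converges ?U (\<lambda>n. \<phi> (s n)) \<zero>\<^bsub>?U\<^esub>"
        unfolding sY(2) by (rule U.X.converges_const[OF U.X.M.zero_closed])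
      ultimately have "\<phi> l = \<zero>\<^bsub>?U\<^esub>"
        by (rule U.X.converges_unique) (intro \<phi>s(1) sY s(2) U.X.M.zero_closed)+
      then show "l \<in> K"
        using s(2) by (simp add: K_def)
    qed (use \<phi>z in \<open>auto simp: K_def \<phi>s\<close>)
    have Kb: "banach_bimodule B (Y\<lparr>carrier := K\<rparr>)"
      by (rule banach_bimodule_sub[OF Y Ks Kc]) (auto simp: K_def \<phi>m Y.lact_closed Y.ract_closed)
    define D where "D = commutator Y y"
    have Dc: "D a \<in> carrier Y" if "a \<in> carrier B" for a
      using that y by (simp add: D_def commutator_def)
    have DK: "D a \<in> K" if a: "a \<in> carrier B" for a
      using a y Dc[OF a] by (simp add: K_def D_def commutator_def \<phi>s \<phi>m)
    have "derivation B (Y\<lparr>carrier := K\<rparr>) D"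
      using Y.derivation_commutator[OF y(1)] DK
      unfolding D_def[symmetric] derivation_def bounded_linear_map_def by simp
    from inner[OF Kb this] obtain k where k: "k \<in> carrier Y" "\<phi> k = \<zero>\<^bsub>?U\<^esub>"
      "\<And>a. a \<in> carrier B \<Longrightarrow> D a = commutator Y k a"
      unfolding inner_derivation_def by (auto simp: K_def commutator_def)
    define z where "z = y \<oplus>\<^bsub>Y\<^esub> (- 1) \<odot>\<^bsub>Y\<^esub> k"
    have z: "z \<in> carrier Y" "\<phi> z = ?u"
      using y k by (simp_all add: z_def \<phi>s)
    have cz: "lact Y a z = ract Y z a" if a: "a \<in> carrier B" for a
    proof -
      have "lact Y a z \<oplus>\<^bsub>Y\<^esub> (- 1) \<odot>\<^bsub>Y\<^esub> ract Y z a = commutator Y y a \<oplus>\<^bsub>Y\<^esub> (- 1) \<odot>\<^bsub>Y\<^esub> commutator Y k a"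
        using a y(1) k(1)
        by (simp add: z_def commutator_def Y.lact_add Y.ract_add Y.lact_smult Y.ract_smult Y.X.sm_plus
            Y.X.sm_sm Y.X.M.a_ac)
      also have "\<dots> = \<zero>\<^bsub>Y\<^esub>"
        using k(3)[OF a] Dc[OF a] unfolding D_def by simp
      finally show ?thesis
        using a z(1) Y.X.eq_iff_diff[of "lact Y a z" "ract Y z a"] by simp
    qed
    define \<rho> where "\<rho> p = Y.unital_lact p z" for p
    have \<rho>c: "\<rho> p \<in> carrier Y" if "p \<in> carrier ?U" for p
      using that z(1) by (simp add: \<rho>_def mem_Times_iff)
    have "bimodule_morphism B ?U Y \<rho>"
      unfolding bimodule_morphism_def bounded_linear_map_def
    proof (intro conjI ballI allI)
      show "\<rho> \<in> carrier ?U \<rightarrow> carrier Y"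
        using \<rho>c by blast
      obtain C where C: "C \<ge> 0"
        "\<And>a x. \<lbrakk>a \<in> carrier B; x \<in> carrier Y\<rbrakk> \<Longrightarrow> nrm Y (lact Y a x) \<le> C * nrm B a * nrm Y x"
        "\<And>a x. \<lbrakk>a \<in> carrier B; x \<in> carrier Y\<rbrakk> \<Longrightarrow> nrm Y (ract Y x a) \<le> C * nrm B a * nrm Y x"
        using Y.bounds by blast
      have "nrm Y (\<rho> p) \<le> ((C + 1) * nrm Y z) * nrm ?U p" if p: "p \<in> carrier ?U" for p
      proof -
        have fp: "fst p \<in> carrier B"
          using p by auto
        have "nrm Y (\<rho> p) \<le> C * nrm B (fst p) * nrm Y z + cmod (snd p) * nrm Y z"
          using Y.X.nrm_triangle[of "lact Y (fst p) z" "snd p \<odot>\<^bsub>Y\<^esub> z"] Y.X.nrm_smult[of z "snd p"] C(2)[OF fp z(1)] fp z(1)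
          unfolding \<rho>_def Y.unital_lact_def by simp
        also have "\<dots> = (C * nrm B (fst p) + cmod (snd p)) * nrm Y z"
          by (simp add: algebra_simps)
        also have "\<dots> \<le> ((C + 1) * (nrm B (fst p) + cmod (snd p))) * nrm Y z"
          using C(1) B.nrm_nonneg[OF fp] by (intro mult_right_mono Y.X.nrm_nonneg z) (simp add: algebra_simps)
        finally show ?thesis
          by (simp add: mult_ac)
      qed
      then show "\<exists>C. \<forall>x\<in>carrier ?U. nrm Y (\<rho> x) \<le> C * nrm ?U x"
        by blast
      fix p q c assume p: "p \<in> carrier ?U" and q: "q \<in> carrier ?U"
      then show "\<rho> (p \<oplus>\<^bsub>?U\<^esub> q) = \<rho> p \<oplus>\<^bsub>Y\<^esub> \<rho> q"
        using z(1) by (simp add: mem_Times_iff \<rho>_def Y.unital_lact_def Y.add_lact Y.X.sm_add Y.X.M.a_ac)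
    next
      fix p c assume p: "p \<in> carrier ?U"
      then show "\<rho> (c \<odot>\<^bsub>?U\<^esub> p) = c \<odot>\<^bsub>Y\<^esub> \<rho> p"
        using z(1) by (simp add: mem_Times_iff \<rho>_def Y.unital_lact_def Y.smult_lact Y.X.sm_plus Y.X.sm_sm)
    next
      fix a p assume a: "a \<in> carrier B" and p: "p \<in> carrier ?U"
      then show "\<rho> (lact ?U a p) = lact Y a (\<rho> p)"
        using z(1) by (simp add: mem_Times_iff \<rho>_def Y.unital_lact_def Y.add_lact Y.smult_lact Y.lact_add Y.lact_smult Y.lact_assoc B.mult_closed)
      show "\<rho> (ract ?U p a) = ract Y (\<rho> p) a"
        using a p z(1) cz[OF a]
        by (simp add: mem_Times_iff \<rho>_def Y.unital_lact_def Y.add_lact Y.smult_lact Y.ract_add Y.ract_smult Y.lact_assoc B.mult_closed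
            Y.lact_ract[symmetric])
    qed
    moreover have "\<phi> (\<rho> p) = p" if "p \<in> carrier ?U" for p
      using that z by (auto simp: \<rho>_def Y.unital_lact_def \<phi>s \<phi>m)
    ultimately show ?thesis
      by blast
  qed
  then show ?thesis
    unfolding contractible_algebra_def projective_bimodule_def using B.banach_bimodule_unitization by blast
qed

section \<open>Bounded operators as a bimodule\<close>

text \<open>
  A Banach space is rescaled at each point \<open>b\<close> by the norm of \<open>b\<close>, so that the operator norm becomes
  a supremum norm. The weight at 0 is an arbitrary positive number, since an operator vanishes there.
\<close>

definition scaled ::
    "('b, 'm) normed_struct_scheme \<Rightarrow> ('x, 'n) normed_struct_scheme \<Rightarrow> 'b \<Rightarrow> 'x normed_struct" where
  "scaled B X b = \<lparr>carrier = carrier X, mult = undefined, one = undefined, zero = \<zero>\<^bsub>X\<^esub>,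
     add = add X, smult = smult X, nrm = (\<lambda>x. nrm X x / (if b = \<zero>\<^bsub>B\<^esub> then 1 else nrm B b))\<rparr>"

text \<open>
  The right action \<open>(g a)(b) = g (a b) - g(a) b\<close> is the one for which currying the last argument of
  a cochain is compatible with the coboundary.
\<close>

definition operator_bimodule ::
    "('b, 'm) normed_struct_scheme \<Rightarrow> ('b, 'x, 'n) bimodule_scheme \<Rightarrow> ('b, 'b \<Rightarrow> 'x) bimodule" where
  "operator_bimodule B X =
     \<lparr>carrier = {g \<in> carrier B \<rightarrow>\<^sub>E carrier X. bounded_linear_map B X g},
      mult = undefined, one = undefined,
      zero = (\<lambda>b\<in>carrier B. \<zero>\<^bsub>X\<^esub>),
      add = (\<lambda>g h. \<lambda>b\<in>carrier B. g b \<oplus>\<^bsub>X\<^esub> h b),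
      smult = (\<lambda>c g. \<lambda>b\<in>carrier B. c \<odot>\<^bsub>X\<^esub> g b),
      nrm = nrm (linf (carrier B) (scaled B X)),
      lact = (\<lambda>a g. \<lambda>b\<in>carrier B. lact X a (g b)),
      ract = (\<lambda>g a. \<lambda>b\<in>carrier B. g (a \<otimes>\<^bsub>B\<^esub> b) \<oplus>\<^bsub>X\<^esub> (- 1) \<odot>\<^bsub>X\<^esub> ract X (g a) b)\<rparr>"

lemma operator_bimodule_simps [simp]:
  "carrier (operator_bimodule B X) = {g \<in> carrier B \<rightarrow>\<^sub>E carrier X. bounded_linear_map B X g}"
  "zero (operator_bimodule B X) = (\<lambda>b\<in>carrier B. \<zero>\<^bsub>X\<^esub>)"
  "add (operator_bimodule B X) = (\<lambda>g h. \<lambda>b\<in>carrier B. g b \<oplus>\<^bsub>X\<^esub> h b)"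
  "smult (operator_bimodule B X) = (\<lambda>c g. \<lambda>b\<in>carrier B. c \<odot>\<^bsub>X\<^esub> g b)"
  "lact (operator_bimodule B X) = (\<lambda>a g. \<lambda>b\<in>carrier B. lact X a (g b))"
  "ract (operator_bimodule B X) =
     (\<lambda>g a. \<lambda>b\<in>carrier B. g (a \<otimes>\<^bsub>B\<^esub> b) \<oplus>\<^bsub>X\<^esub> (- 1) \<odot>\<^bsub>X\<^esub> ract X (g a) b)"
  by (simp_all add: operator_bimodule_def)

context banach_bimodule
begin

lemma banach_space_scaled:
  assumes b: "b \<in> carrier B"
  shows "banach_space (scaled B X b)"
proof -
  define w where "w = (if b = \<zero>\<^bsub>B\<^esub> then 1 else nrm B b)"
  have w: "w > 0"
    using B.nrm_nonneg[OF b] B.nrm_eq_0[OF b] by (auto simp: w_def)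
  have gap: "gap (scaled B X b) x y = gap X x y / w" for x y
    by (simp add: gap_def scaled_def w_def)
  have n: "nrm (scaled B X b) x = nrm X x / w" for x
    by (simp add: scaled_def w_def)
  have s: "carrier (scaled B X b) = carrier X" "\<zero>\<^bsub>scaled B X b\<^esub> = \<zero>\<^bsub>X\<^esub>"
    "add (scaled B X b) = add X" "smult (scaled B X b) = smult X"
    by (simp_all add: scaled_def)
  show ?thesis
  proof (rule banach_spaceI, unfold s n)
    fix f assume f: "\<And>n. f n \<in> carrier X" "cauchy_seq (scaled B X b) f"
    have cf: "cauchy_seq X f"
      unfolding cauchy_seq_def
    proof (intro allI impI)
      fix \<epsilon> :: real assume "\<epsilon> > 0"
      then have "\<epsilon> / w > 0"
        using w by simp
      then obtain N where "\<forall>m\<ge>N. \<forall>n\<ge>N. gap (scaled B X b) (f m) (f n) < \<epsilon> / w"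
        using f(2) unfolding cauchy_seq_def by meson
      then show "\<exists>N. \<forall>m\<ge>N. \<forall>n\<ge>N. gap X (f m) (f n) < \<epsilon>"
        using w by (auto simp: gap divide_less_cancel)
    qed
    obtain l where l: "l \<in> carrier X" "converges X f l"
      by (rule X.cauchy_seq_converges[OF cf f(1)])
    have "converges (scaled B X b) f l"
      using tendsto_divide[OF l(2)[unfolded converges_def] tendsto_const[of w]] w
      by (simp add: converges_def gap)
    then show "\<exists>l\<in>carrier X. converges (scaled B X b) f l"
      using l(1) by blast
  next
    fix x y assume "x \<in> carrier X" "y \<in> carrier X"
    then have "nrm X (x \<oplus>\<^bsub>X\<^esub> y) / w \<le> (nrm X x + nrm X y) / w"
      using w by (intro divide_right_mono X.nrm_triangle) auto
    then show "nrm X (x \<oplus>\<^bsub>X\<^esub> y) / w \<le> nrm X x / w + nrm X y / w"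
      by (simp add: add_divide_distrib)
  qed (use w in \<open>auto simp: X.M.a_ac X.sm_add X.sm_plus X.sm_sm X.nrm_smult X.nrm_eq_0\<close>)
qed

lemma operator_in_linf:
  assumes "g \<in> carrier (operator_bimodule B X)"
  shows "g \<in> carrier (linf (carrier B) (scaled B X))"
proof -
  have g: "g \<in> carrier B \<rightarrow>\<^sub>E carrier X" "bounded_linear_map B X g"
    using assms by simp_all
  obtain C where C: "C \<ge> 0" "\<And>b. b \<in> carrier B \<Longrightarrow> nrm X (g b) \<le> C * nrm B b"
    using bounded_linear_map_bound[OF g(2) B.banach_space_axioms] by blast
  have "nrm (scaled B X b) (g b) \<le> C" if b: "b \<in> carrier B" for b
    using C(1) C(2)[OF b] B.nrm_nonneg[OF b] B.nrm_eq_0[OF b]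
    by (auto simp: scaled_def divide_le_eq)
  then have "\<exists>C. \<forall>b\<in>carrier B. nrm (scaled B X b) (g b) \<le> C"
    by blast
  moreover have "carrier (scaled B X b) = carrier X" for b
    by (simp add: scaled_def)
  ultimately show ?thesis
    using g(1) by simp
qed

lemma nrm_operator_apply:
  assumes "g \<in> carrier (operator_bimodule B X)" "b \<in> carrier B"
  shows "nrm X (g b) \<le> nrm (operator_bimodule B X) g * nrm B b"
proof (cases "b = \<zero>\<^bsub>B\<^esub>")
  case True
  have "bounded_linear_map B X g"
    using assms by simp
  then have "g \<zero>\<^bsub>B\<^esub> = \<zero>\<^bsub>X\<^esub>"
    using bounded_linear_mapD(1,3)[of B X g "\<zero>\<^bsub>B\<^esub>"] X.sm_0 B.sm_zero[of 0] by (metis B.M.zero_closed)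
  then show ?thesis
    using True by simp
next
  case False
  then have "nrm B b > 0"
    using B.nrm_nonneg[OF assms(2)] B.nrm_eq_0[OF assms(2)] by simp
  moreover have "nrm (scaled B X b) (g b) \<le> nrm (operator_bimodule B X) g"
    using nrm_linf_upper[OF operator_in_linf[OF assms(1)] assms(2)] by (simp add: operator_bimodule_def)
  ultimately show ?thesis
    using False by (simp add: scaled_def divide_le_eq)
qed

lemma nrm_operator_least:
  assumes "0 \<le> C" "\<And>b. b \<in> carrier B \<Longrightarrow> nrm X (g b) \<le> C * nrm B b"
  shows "nrm (operator_bimodule B X) g \<le> C"
proof -
  have "nrm (scaled B X b) (g b) \<le> C" if b: "b \<in> carrier B" for b
    using assms(1) assms(2)[OF b] B.nrm_nonneg[OF b] B.nrm_eq_0[OF b]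
    by (auto simp: scaled_def divide_le_eq)
  then show ?thesis
    using nrm_linf_least[OF assms(1), of "carrier B" "scaled B X" g] by (simp add: operator_bimodule_def)
qed

lemma operatorI:
  assumes "\<And>b. b \<in> carrier B \<Longrightarrow> g b \<in> carrier X"
    "\<And>a b. \<lbrakk>a \<in> carrier B; b \<in> carrier B\<rbrakk> \<Longrightarrow> g (a \<oplus>\<^bsub>B\<^esub> b) = g a \<oplus>\<^bsub>X\<^esub> g b"
    "\<And>c b. b \<in> carrier B \<Longrightarrow> g (c \<odot>\<^bsub>B\<^esub> b) = c \<odot>\<^bsub>X\<^esub> g b"
    "\<And>b. b \<in> carrier B \<Longrightarrow> nrm X (g b) \<le> C * nrm B b"
  shows "restrict g (carrier B) \<in> carrier (operator_bimodule B X)"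
  using assms unfolding operator_bimodule_simps bounded_linear_map_def
  by (auto intro!: exI[of _ C])

lemma operatorD:
  assumes "g \<in> carrier (operator_bimodule B X)"
  shows "b \<in> carrier B \<Longrightarrow> g b \<in> carrier X"
    "\<lbrakk>a \<in> carrier B; b \<in> carrier B\<rbrakk> \<Longrightarrow> g (a \<oplus>\<^bsub>B\<^esub> b) = g a \<oplus>\<^bsub>X\<^esub> g b"
    "b \<in> carrier B \<Longrightarrow> g (c \<odot>\<^bsub>B\<^esub> b) = c \<odot>\<^bsub>X\<^esub> g b"
    "g \<in> extensional (carrier B)"
  using assms bounded_linear_mapD[of B X g] by (auto simp: PiE_iff)

lemma operator_eqI:
  assumes "g \<in> extensional (carrier B)" "h \<in> extensional (carrier B)"
    "\<And>b. b \<in> carrier B \<Longrightarrow> g b = h b"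
  shows "g = h"
  using assms by (rule extensionalityI)

lemma operator_add_closed:
  assumes g: "g \<in> carrier (operator_bimodule B X)" and h: "h \<in> carrier (operator_bimodule B X)"
  shows "g \<oplus>\<^bsub>operator_bimodule B X\<^esub> h \<in> carrier (operator_bimodule B X)"
  unfolding operator_bimodule_simps(3)
proof (rule operatorI)
  fix b assume b: "b \<in> carrier B"
  show "nrm X (g b \<oplus>\<^bsub>X\<^esub> h b) \<le> (nrm (operator_bimodule B X) g + nrm (operator_bimodule B X) h) * nrm B b"
    using X.nrm_triangle[OF operatorD(1)[OF g b] operatorD(1)[OF h b]]
      nrm_operator_apply[OF g b] nrm_operator_apply[OF h b] by (simp add: algebra_simps)
qed (simp_all add: operatorD[OF g] operatorD[OF h] X.M.a_ac X.sm_plus)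

lemma operator_smult_closed:
  assumes g: "g \<in> carrier (operator_bimodule B X)"
  shows "c \<odot>\<^bsub>operator_bimodule B X\<^esub> g \<in> carrier (operator_bimodule B X)"
  unfolding operator_bimodule_simps(4)
proof (rule operatorI)
  fix b assume b: "b \<in> carrier B"
  show "nrm X (c \<odot>\<^bsub>X\<^esub> g b) \<le> (cmod c * nrm (operator_bimodule B X) g) * nrm B b"
    using X.nrm_smult[OF operatorD(1)[OF g b], of c] mult_left_mono[OF nrm_operator_apply[OF g b], of "cmod c"]
    by (simp add: mult_ac)
qed (simp_all add: operatorD[OF g] X.sm_sm X.sm_plus mult.commute)

lemma banach_space_operator: "banach_space (operator_bimodule B X)"
proof -
  let ?L = "linf (carrier B) (scaled B X)" and ?O = "operator_bimodule B X"
  interpret L: banach_space ?L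
    by (rule banach_space_linf) (rule banach_space_scaled)
  have op: "add ?L = add ?O" "smult ?L = smult ?O" "zero ?L = zero ?O" "nrm ?L = nrm ?O"
    by (simp_all add: scaled_def) (simp add: operator_bimodule_def scaled_def)
  have sub: "banach_space (?L\<lparr>carrier := carrier ?O\<rparr>)"
  proof (rule banach_subspace[OF L.banach_space_axioms])
    show "carrier ?O \<subseteq> carrier ?L"
      using operator_in_linf by blast
    show "\<zero>\<^bsub>?L\<^esub> \<in> carrier ?O"
      unfolding op operator_bimodule_simps(2) by (rule operatorI[of _ 0]) simp_all
    show "g \<oplus>\<^bsub>?L\<^esub> h \<in> carrier ?O" if "g \<in> carrier ?O" "h \<in> carrier ?O" for g h
      unfolding op using that by (rule operator_add_closed)
    show "c \<odot>\<^bsub>?L\<^esub> g \<in> carrier ?O" if "g \<in> carrier ?O" for c g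
      unfolding op using that by (rule operator_smult_closed)
    fix s l assume s: "\<And>n. s n \<in> carrier ?O" and l: "l \<in> carrier ?L" and c: "converges ?L s l"
    have lX: "l b \<in> carrier X" if "b \<in> carrier B" for b
      using l that by (auto simp: scaled_def)
    have pt: "converges X (\<lambda>n. s n b) (l b)" if b: "b \<in> carrier B" for b
    proof -
      define w where "w = (if b = \<zero>\<^bsub>B\<^esub> then 1 else nrm B b)"
      have w: "w > 0"
        using B.nrm_nonneg[OF b] B.nrm_eq_0[OF b] by (auto simp: w_def)
      have 1: "\<bar>gap X (s n b) (l b)\<bar> \<le> w * gap ?L (s n) l" for n
      proof -
        have "s n \<oplus>\<^bsub>?L\<^esub> (- 1) \<odot>\<^bsub>?L\<^esub> l \<in> carrier ?L"
          by (intro L.M.a_closed L.smult_mem l operator_in_linf s)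
        from nrm_linf_upper[OF this b] have "gap X (s n b) (l b) / w \<le> gap ?L (s n) l"
          using b by (simp add: gap_def scaled_def w_def)
        then show ?thesis
          using w X.gap_nonneg[OF operatorD(1)[OF s b] lX[OF b], of n] by (simp add: divide_le_eq mult.commute)
      qed
      have 2: "(\<lambda>n. w * gap ?L (s n) l) \<longlonglongrightarrow> 0"
        using c tendsto_mult_right_zero unfolding converges_def by blast
      show ?thesis
        unfolding converges_def by (rule null_squeeze[OF 1 2])
    qed
    obtain C where C: "\<And>b. b \<in> carrier B \<Longrightarrow> nrm (scaled B X b) (l b) \<le> C"
      using l by auto
    have add: "l (a \<oplus>\<^bsub>B\<^esub> b) = l a \<oplus>\<^bsub>X\<^esub> l b" if ab: "a \<in> carrier B" "b \<in> carrier B" for a b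
    proof (rule X.converges_unique)
      show "converges X (\<lambda>n. s n (a \<oplus>\<^bsub>B\<^esub> b)) (l (a \<oplus>\<^bsub>B\<^esub> b))"
        by (intro pt B.M.a_closed ab)
      show "converges X (\<lambda>n. s n (a \<oplus>\<^bsub>B\<^esub> b)) (l a \<oplus>\<^bsub>X\<^esub> l b)"
        unfolding operatorD(2)[OF s ab] by (intro X.converges_plus pt ab operatorD(1)[OF s] lX)
    qed (intro operatorD(1)[OF s] lX B.M.a_closed X.M.a_closed ab)+
    have sm: "l (c \<odot>\<^bsub>B\<^esub> b) = c \<odot>\<^bsub>X\<^esub> l b" if b: "b \<in> carrier B" for c b
    proof (rule X.converges_unique)
      show "converges X (\<lambda>n. s n (c \<odot>\<^bsub>B\<^esub> b)) (l (c \<odot>\<^bsub>B\<^esub> b))"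
        by (intro pt B.smult_mem b)
      have "(\<lambda>n. cmod c * gap X (s n b) (l b)) \<longlonglongrightarrow> 0"
        using pt[OF b] tendsto_mult_right_zero unfolding converges_def by blast
      then show "converges X (\<lambda>n. s n (c \<odot>\<^bsub>B\<^esub> b)) (c \<odot>\<^bsub>X\<^esub> l b)"
        unfolding operatorD(3)[OF s b] converges_def X.gap_smult[OF operatorD(1)[OF s b] lX[OF b]] .
    qed (intro operatorD(1)[OF s] lX B.smult_mem X.smult_mem b)+
    have "restrict l (carrier B) \<in> carrier ?O"
    proof (rule operatorI[of _ C])
      fix b assume b: "b \<in> carrier B"
      show "nrm X (l b) \<le> C * nrm B b"
      proof (cases "b = \<zero>\<^bsub>B\<^esub>")
        case True
        then have "l b = \<zero>\<^bsub>X\<^esub>"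
          using sm[OF b, of 0] lX[OF b] by simp
        then show ?thesis
          using True by simp
      next
        case False
        then show ?thesis
          using C[OF b] B.nrm_nonneg[OF b] B.nrm_eq_0[OF b] by (simp add: scaled_def divide_le_eq)
      qed
    qed (simp_all add: lX add sm)
    then show "l \<in> carrier ?O"
      using l by (simp add: PiE_restrict[of l "carrier B" "\<lambda>_. carrier X"] scaled_def)
  qed
  have z: "\<zero>\<^bsub>?O\<^esub> \<in> carrier ?O"
    unfolding operator_bimodule_simps(2) by (rule operatorI[of _ 0]) simp_all
  show ?thesis
    by (rule banach_space_transfer[OF sub, of id])
      (simp_all add: op z operator_add_closed operator_smult_closed del: operator_bimodule_simps linf_simps)
qed

lemma operator_lact_closed:
  assumes a: "a \<in> carrier B" and g: "g \<in> carrier (operator_bimodule B X)"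
    and C: "C \<ge> 0" "\<And>a x. \<lbrakk>a \<in> carrier B; x \<in> carrier X\<rbrakk> \<Longrightarrow> nrm X (lact X a x) \<le> C * nrm B a * nrm X x"
  shows "lact (operator_bimodule B X) a g \<in> carrier (operator_bimodule B X)"
    "nrm (operator_bimodule B X) (lact (operator_bimodule B X) a g) \<le> C * nrm B a * nrm (operator_bimodule B X) g"
proof -
  interpret O: banach_space "operator_bimodule B X"
    by (rule banach_space_operator)
  have le: "nrm X (lact X a (g b)) \<le> (C * nrm B a * nrm (operator_bimodule B X) g) * nrm B b"
    if b: "b \<in> carrier B" for b
  proof -
    have "nrm X (lact X a (g b)) \<le> C * nrm B a * nrm X (g b)"
      by (intro C a operatorD(1)[OF g] b)
    also have "\<dots> \<le> C * nrm B a * (nrm (operator_bimodule B X) g * nrm B b)"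
      using C(1) B.nrm_nonneg[OF a] by (intro mult_left_mono nrm_operator_apply g b) simp
    finally show ?thesis
      by (simp add: mult_ac)
  qed
  show "lact (operator_bimodule B X) a g \<in> carrier (operator_bimodule B X)"
    unfolding operator_bimodule_simps(5)
    by (rule operatorI[OF _ _ _ le]) (simp_all add: operatorD[OF g] a lact_add lact_smult)
  show "nrm (operator_bimodule B X) (lact (operator_bimodule B X) a g) \<le> C * nrm B a * nrm (operator_bimodule B X) g"
    using C(1) B.nrm_nonneg[OF a] O.nrm_nonneg[OF g] le
    by (intro nrm_operator_least mult_nonneg_nonneg) simp_all
qed

lemma operator_ract_closed:
  assumes a: "a \<in> carrier B" and g: "g \<in> carrier (operator_bimodule B X)"
    and C: "C \<ge> 0" "\<And>a x. \<lbrakk>a \<in> carrier B; x \<in> carrier X\<rbrakk> \<Longrightarrow> nrm X (ract X x a) \<le> C * nrm B a * nrm X x"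
  shows "ract (operator_bimodule B X) g a \<in> carrier (operator_bimodule B X)"
    "nrm (operator_bimodule B X) (ract (operator_bimodule B X) g a) \<le> (C + 1) * nrm B a * nrm (operator_bimodule B X) g"
proof -
  interpret O: banach_space "operator_bimodule B X"
    by (rule banach_space_operator)
  let ?n = "nrm (operator_bimodule B X) g"
  have ab: "a \<otimes>\<^bsub>B\<^esub> b \<in> carrier B" if "b \<in> carrier B" for b
    using a that by (rule B.mult_closed)
  have le: "nrm X (g (a \<otimes>\<^bsub>B\<^esub> b) \<oplus>\<^bsub>X\<^esub> (- 1) \<odot>\<^bsub>X\<^esub> ract X (g a) b) \<le> ((C + 1) * nrm B a * ?n) * nrm B b"
    if b: "b \<in> carrier B" for b
  proof -
    have ga: "g a \<in> carrier X"
      by (rule operatorD(1)[OF g a])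
    have "nrm X (ract X (g a) b) \<le> C * nrm B b * nrm X (g a)"
      by (intro C b ga)
    also have "\<dots> \<le> C * nrm B b * (?n * nrm B a)"
      using C(1) B.nrm_nonneg[OF b] by (intro mult_left_mono nrm_operator_apply g a) simp
    finally have 1: "nrm X (ract X (g a) b) \<le> C * nrm B b * (?n * nrm B a)" .
    have "nrm X (g (a \<otimes>\<^bsub>B\<^esub> b)) \<le> ?n * nrm B (a \<otimes>\<^bsub>B\<^esub> b)"
      by (intro nrm_operator_apply g ab b)
    also have "\<dots> \<le> ?n * (nrm B a * nrm B b)"
      by (intro mult_left_mono B.nrm_mult a b O.nrm_nonneg g)
    finally have 2: "nrm X (g (a \<otimes>\<^bsub>B\<^esub> b)) \<le> ?n * (nrm B a * nrm B b)" .
    have "nrm X (g (a \<otimes>\<^bsub>B\<^esub> b) \<oplus>\<^bsub>X\<^esub> (- 1) \<odot>\<^bsub>X\<^esub> ract X (g a) b) \<le> nrm X (g (a \<otimes>\<^bsub>B\<^esub> b)) + nrm X (ract X (g a) b)"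
      using X.nrm_triangle[of "g (a \<otimes>\<^bsub>B\<^esub> b)" "(- 1) \<odot>\<^bsub>X\<^esub> ract X (g a) b"] X.nrm_smult[of "ract X (g a) b" "- 1"]
        operatorD(1)[OF g ab[OF b]] ga b by simp
    then show ?thesis
      using 1 2 by (simp add: algebra_simps)
  qed
  show "ract (operator_bimodule B X) g a \<in> carrier (operator_bimodule B X)"
    unfolding operator_bimodule_simps(6)
    by (rule operatorI[OF _ _ _ le])
      (simp_all add: operatorD[OF g] a ab add_ract smult_ract X.sm_plus X.sm_sm X.M.a_ac
        B.mult_distr B.smult_mult_right mult.commute)
  show "nrm (operator_bimodule B X) (ract (operator_bimodule B X) g a) \<le> (C + 1) * nrm B a * ?n"
    using C(1) B.nrm_nonneg[OF a] O.nrm_nonneg[OF g] le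
    by (intro nrm_operator_least mult_nonneg_nonneg) simp_all
qed

lemma banach_bimodule_operator: "banach_bimodule B (operator_bimodule B X)"
proof -
  let ?O = "operator_bimodule B X"
  obtain C where C: "C \<ge> 0"
    "\<And>a x. \<lbrakk>a \<in> carrier B; x \<in> carrier X\<rbrakk> \<Longrightarrow> nrm X (lact X a x) \<le> C * nrm B a * nrm X x"
    "\<And>a x. \<lbrakk>a \<in> carrier B; x \<in> carrier X\<rbrakk> \<Longrightarrow> nrm X (ract X x a) \<le> C * nrm B a * nrm X x"
    using bounds by blast
  interpret O: banach_space ?O
    by (rule banach_space_operator)
  note facts = lact_add add_lact lact_smult smult_lact ract_add add_ract ract_smult
      smult_ract lact_assoc ract_assoc lact_ract B.mult_closed B.mult_distl B.mult_distr
      B.smult_mult_left B.smult_mult_right B.mult_assoc X.sm_plus X.sm_add X.sm_sm X.M.a_ac mult.commute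
  show ?thesis
  proof (intro banach_bimodule.intro banach_space_operator banach_bimodule_axioms.intro)
    show "banach_algebra B" ..
    show "\<exists>C. \<forall>a\<in>carrier B. \<forall>x\<in>carrier ?O.
        nrm ?O (lact ?O a x) \<le> C * nrm B a * nrm ?O x \<and> nrm ?O (ract ?O x a) \<le> C * nrm B a * nrm ?O x"
    proof (intro exI[of _ "C + 1"] ballI conjI)
      fix a g assume a: "a \<in> carrier B" and g: "g \<in> carrier ?O"
      have "C * nrm B a * nrm ?O g \<le> (C + 1) * nrm B a * nrm ?O g"
        by (intro mult_right_mono B.nrm_nonneg a O.nrm_nonneg g) simp
      then show "nrm ?O (lact ?O a g) \<le> (C + 1) * nrm B a * nrm ?O g"
        using operator_lact_closed(2)[OF a g C(1,2)] by linarith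
      show "nrm ?O (ract ?O g a) \<le> (C + 1) * nrm B a * nrm ?O g"
        by (rule operator_ract_closed(2)[OF a g C(1,3)])
    qed
    fix a g assume a: "a \<in> carrier B" and g: "g \<in> carrier ?O"
    show "lact ?O a g \<in> carrier ?O"
      by (rule operator_lact_closed(1)[OF a g C(1,2)])
    show "ract ?O g a \<in> carrier ?O"
      by (rule operator_ract_closed(1)[OF a g C(1,3)])
    fix c
    show "lact ?O a (c \<odot>\<^bsub>?O\<^esub> g) = c \<odot>\<^bsub>?O\<^esub> lact ?O a g"
      using a operatorD[OF g] by (intro operator_eqI) (simp_all add: facts)
    show "lact ?O (c \<odot>\<^bsub>B\<^esub> a) g = c \<odot>\<^bsub>?O\<^esub> lact ?O a g"
      using a operatorD[OF g] by (intro operator_eqI) (simp_all add: facts)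
    show "ract ?O (c \<odot>\<^bsub>?O\<^esub> g) a = c \<odot>\<^bsub>?O\<^esub> ract ?O g a"
      using a operatorD[OF g] by (intro operator_eqI) (simp_all add: facts)
    show "ract ?O g (c \<odot>\<^bsub>B\<^esub> a) = c \<odot>\<^bsub>?O\<^esub> ract ?O g a"
      using a operatorD[OF g] by (intro operator_eqI) (simp_all add: facts)
  next
    fix a g h assume a: "a \<in> carrier B" and g: "g \<in> carrier ?O" and h: "h \<in> carrier ?O"
    show "lact ?O a (g \<oplus>\<^bsub>?O\<^esub> h) = lact ?O a g \<oplus>\<^bsub>?O\<^esub> lact ?O a h"
      using a operatorD[OF g] operatorD[OF h] by (intro operator_eqI) (simp_all add: facts)
    show "ract ?O (g \<oplus>\<^bsub>?O\<^esub> h) a = ract ?O g a \<oplus>\<^bsub>?O\<^esub> ract ?O h a"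
      using a operatorD[OF g] operatorD[OF h] by (intro operator_eqI) (simp_all add: facts)
  next
    fix a b g assume a: "a \<in> carrier B" and b: "b \<in> carrier B" and g: "g \<in> carrier ?O"
    show "lact ?O (a \<oplus>\<^bsub>B\<^esub> b) g = lact ?O a g \<oplus>\<^bsub>?O\<^esub> lact ?O b g"
      using a b operatorD[OF g] by (intro operator_eqI) (simp_all add: facts)
    show "ract ?O g (a \<oplus>\<^bsub>B\<^esub> b) = ract ?O g a \<oplus>\<^bsub>?O\<^esub> ract ?O g b"
      using a b operatorD[OF g] by (intro operator_eqI) (simp_all add: facts)
    show "lact ?O (a \<otimes>\<^bsub>B\<^esub> b) g = lact ?O a (lact ?O b g)"
      using a b operatorD[OF g] by (intro operator_eqI) (simp_all add: facts)
    show "ract ?O g (a \<otimes>\<^bsub>B\<^esub> b) = ract ?O (ract ?O g a) b"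
      using a b operatorD[OF g] by (intro operator_eqI) (simp_all add: facts)
    show "lact ?O a (ract ?O g b) = ract ?O (lact ?O a g) b"
      using a b operatorD[OF g] by (intro operator_eqI) (simp_all add: facts)
  qed
qed

end

section \<open>Hochschild cohomology by dimension shifting\<close>

text \<open>
  The coset of any element of \<open>N\<close> is \<open>N\<close>, so the quotient has only one element when \<open>Z\<close> is part of \<open>N\<close>.
\<close>

lemma trivial_group_Mod:
  fixes G :: "('g, 'm) monoid_scheme"
  assumes one: "\<one>\<^bsub>G\<^esub> \<in> N"
    and mult: "\<And>h k. \<lbrakk>h \<in> N; k \<in> N\<rbrakk> \<Longrightarrow> h \<otimes>\<^bsub>G\<^esub> k \<in> N"
    and div: "\<And>h k. \<lbrakk>h \<in> N; k \<in> N\<rbrakk> \<Longrightarrow> \<exists>h'\<in>N. h = h' \<otimes>\<^bsub>G\<^esub> k"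
    and Z: "Z \<subseteq> N" "Z \<noteq> {}"
  shows "trivial_group (G\<lparr>carrier := Z\<rparr> Mod N)"
proof -
  have cos: "N #>\<^bsub>G\<lparr>carrier := Z\<rparr>\<^esub> z = N" if "z \<in> N" for z
    using mult div that unfolding r_coset_def by fastforce
  have car: "carrier (G\<lparr>carrier := Z\<rparr> Mod N) = {N}"
    unfolding carrier_FactGroup using cos Z by fastforce
  have sq: "N <#>\<^bsub>G\<^esub> N = N"
    using mult div[OF _ one] one unfolding set_mult_def by fastforce
  have "group (G\<lparr>carrier := Z\<rparr> Mod N)"
    by (rule groupI) (simp_all add: car sq)
  then show ?thesis
    by (simp add: trivial_group_def car)
qed

lemma trivial_group_Mod_D:
  fixes G :: "('g, 'm) monoid_scheme"
  assumes triv: "trivial_group (G\<lparr>carrier := Z\<rparr> Mod N)" and one: "\<one>\<^bsub>G\<^esub> \<in> N"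
    and z: "z \<in> Z" "\<one>\<^bsub>G\<^esub> \<otimes>\<^bsub>G\<^esub> z = z"
  shows "z \<in> N"
proof -
  have "N #>\<^bsub>G\<lparr>carrier := Z\<rparr>\<^esub> z \<in> carrier (G\<lparr>carrier := Z\<rparr> Mod N)"
    unfolding carrier_FactGroup using z by simp
  then have "N #>\<^bsub>G\<lparr>carrier := Z\<rparr>\<^esub> z = N"
    using triv by (simp add: trivial_group_def)
  moreover have "z \<in> N #>\<^bsub>G\<lparr>carrier := Z\<rparr>\<^esub> z"
    using one z(2) unfolding r_coset_def by force
  ultimately show ?thesis by simp
qed

lemma finsum_additive:
  assumes Y: "abelian_group Y" and X: "abelian_group X"
    and e: "\<And>y. y \<in> carrier Y \<Longrightarrow> e y \<in> carrier X" "e \<zero>\<^bsub>Y\<^esub> = \<zero>\<^bsub>X\<^esub>"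
      "\<And>x y. \<lbrakk>x \<in> carrier Y; y \<in> carrier Y\<rbrakk> \<Longrightarrow> e (x \<oplus>\<^bsub>Y\<^esub> y) = e x \<oplus>\<^bsub>X\<^esub> e y"
    and A: "finite A" "\<And>i. i \<in> A \<Longrightarrow> F i \<in> carrier Y"
  shows "e (\<Oplus>\<^bsub>Y\<^esub>i\<in>A. F i) = (\<Oplus>\<^bsub>X\<^esub>i\<in>A. e (F i))"
proof -
  interpret Y: abelian_group Y by (fact Y)
  interpret X: abelian_group X by (fact X)
  show ?thesis
    using A
  proof (induction A rule: finite_induct)
    case (insert i A)
    have "F \<in> A \<rightarrow> carrier Y"
      using insert by auto
    then have "e (\<Oplus>\<^bsub>Y\<^esub>i\<in>insert i A. F i) = e (F i) \<oplus>\<^bsub>X\<^esub> e (\<Oplus>\<^bsub>Y\<^esub>i\<in>A. F i)"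
      using insert by (simp add: e)
    also have "\<dots> = (\<Oplus>\<^bsub>X\<^esub>i\<in>insert i A. e (F i))"
      using insert by (simp add: e(1) Pi_def)
    finally show ?case .
  qed (simp add: e)
qed

lemma tuples_Suc: "cs \<in> tuples B (Suc n) \<longleftrightarrow> (\<exists>as b. cs = as @ [b] \<and> as \<in> tuples B n \<and> b \<in> carrier B)"
proof
  assume cs: "cs \<in> tuples B (Suc n)"
  then have "cs \<noteq> []"
    by (auto simp: tuples_def)
  then have "cs = butlast cs @ [last cs]" "last cs \<in> set cs"
    by simp_all
  moreover have "set (butlast cs) \<subseteq> set cs"
    by (auto dest: in_set_butlastD)
  ultimately show "\<exists>as b. cs = as @ [b] \<and> as \<in> tuples B n \<and> b \<in> carrier B"
    using cs by (intro exI[of _ "butlast cs"] exI[of _ "last cs"]) (auto simp: tuples_def)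
qed (auto simp: tuples_def)

lemma tuples_snoc: "\<lbrakk>as \<in> tuples B n; b \<in> carrier B\<rbrakk> \<Longrightarrow> as @ [b] \<in> tuples B (Suc n)"
  by (auto simp: tuples_def)

lemma tuples_update: "\<lbrakk>as \<in> tuples B n; a \<in> carrier B\<rbrakk> \<Longrightarrow> as[i := a] \<in> tuples B n"
  using set_update_subset_insert[of as i a] by (auto simp: tuples_def)

lemma tuples_nth: "\<lbrakk>as \<in> tuples B n; i < n\<rbrakk> \<Longrightarrow> as ! i \<in> carrier B"
  by (auto simp: tuples_def)

lemma tuples_merge:
  assumes "as \<in> tuples B (Suc n)" "i < n" "c \<in> carrier B"
  shows "take i as @ [c] @ drop (i + 2) as \<in> tuples B n"
  using assms set_take_subset[of i as] set_drop_subset[of "i + 2" as] by (auto simp: tuples_def)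

lemma tuples_hd_tl:
  assumes "as \<in> tuples B (Suc n)"
  shows "hd as \<in> carrier B" "tl as \<in> tuples B n" "last as \<in> carrier B" "butlast as \<in> tuples B n"
proof -
  show "hd as \<in> carrier B" "tl as \<in> tuples B n"
    using assms by (cases as; auto simp: tuples_def)+
  show "last as \<in> carrier B" "butlast as \<in> tuples B n"
    using assms unfolding tuples_Suc by auto
qed

lemma cochainsI:
  assumes "f \<in> tuples B n \<rightarrow>\<^sub>E carrier X"
    "\<And>as i a b. \<lbrakk>as \<in> tuples B n; i < n; a \<in> carrier B; b \<in> carrier B\<rbrakk> \<Longrightarrow>
       f (as[i := a \<oplus>\<^bsub>B\<^esub> b]) = f (as[i := a]) \<oplus>\<^bsub>X\<^esub> f (as[i := b])"
    "\<And>as i a c. \<lbrakk>as \<in> tuples B n; i < n; a \<in> carrier B\<rbrakk> \<Longrightarrow>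
       f (as[i := c \<odot>\<^bsub>B\<^esub> a]) = c \<odot>\<^bsub>X\<^esub> f (as[i := a])"
    "\<And>as. as \<in> tuples B n \<Longrightarrow> nrm X (f as) \<le> C * (\<Prod>i<n. nrm B (as ! i))"
  shows "f \<in> cochains B X n"
  unfolding cochains_def using assms by blast

lemma cochainsD:
  assumes "f \<in> cochains B X n"
  shows "f \<in> extensional (tuples B n)"
    "as \<in> tuples B n \<Longrightarrow> f as \<in> carrier X"
    "\<lbrakk>as \<in> tuples B n; i < n; a \<in> carrier B; b \<in> carrier B\<rbrakk> \<Longrightarrow>
       f (as[i := a \<oplus>\<^bsub>B\<^esub> b]) = f (as[i := a]) \<oplus>\<^bsub>X\<^esub> f (as[i := b])"
    "\<lbrakk>as \<in> tuples B n; i < n; a \<in> carrier B\<rbrakk> \<Longrightarrow>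
       f (as[i := c \<odot>\<^bsub>B\<^esub> a]) = c \<odot>\<^bsub>X\<^esub> f (as[i := a])"
  using assms unfolding cochains_def by (auto simp: PiE_iff)

context banach_bimodule
begin

lemma prod_nrm_nonneg: "as \<in> tuples B n \<Longrightarrow> 0 \<le> (\<Prod>i<n. nrm B (as ! i))"
  by (intro prod_nonneg) (auto intro: B.nrm_nonneg tuples_nth)

lemma cochain_bound:
  assumes "f \<in> cochains B X n"
  obtains C where "C \<ge> 0" "\<And>as. as \<in> tuples B n \<Longrightarrow> nrm X (f as) \<le> C * (\<Prod>i<n. nrm B (as ! i))"
proof -
  obtain C where C: "\<And>as. as \<in> tuples B n \<Longrightarrow> nrm X (f as) \<le> C * (\<Prod>i<n. nrm B (as ! i))"
    using assms unfolding cochains_def by blast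
  have "nrm X (f as) \<le> \<bar>C\<bar> * (\<Prod>i<n. nrm B (as ! i))" if "as \<in> tuples B n" for as
    using C[OF that] mult_right_mono[of C "\<bar>C\<bar>" "\<Prod>i<n. nrm B (as ! i)"] prod_nrm_nonneg[OF that]
    by linarith
  then show ?thesis
    using that[of "\<bar>C\<bar>"] by simp
qed

lemma cochain_add:
  assumes f: "f \<in> cochains B X n" and g: "g \<in> cochains B X n"
  shows "(\<lambda>as\<in>tuples B n. f as \<oplus>\<^bsub>X\<^esub> g as) \<in> cochains B X n"
proof -
  obtain C where C: "\<And>as. as \<in> tuples B n \<Longrightarrow> nrm X (f as) \<le> C * (\<Prod>i<n. nrm B (as ! i))"
    using cochain_bound[OF f] by metis
  obtain D where D: "\<And>as. as \<in> tuples B n \<Longrightarrow> nrm X (g as) \<le> D * (\<Prod>i<n. nrm B (as ! i))"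
    using cochain_bound[OF g] by metis
  note fg = cochainsD[OF f] cochainsD[OF g]
  show ?thesis
  proof (rule cochainsI)
    fix as assume as: "as \<in> tuples B n"
    show "nrm X ((\<lambda>as\<in>tuples B n. f as \<oplus>\<^bsub>X\<^esub> g as) as) \<le> (C + D) * (\<Prod>i<n. nrm B (as ! i))"
      using as X.nrm_triangle[OF cochainsD(2)[OF f as] cochainsD(2)[OF g as]] C[OF as] D[OF as]
      by (simp add: algebra_simps)
  qed (simp_all add: fg tuples_update X.M.a_ac X.sm_plus)
qed

lemma cochain_smult:
  assumes f: "f \<in> cochains B X n"
  shows "(\<lambda>as\<in>tuples B n. c \<odot>\<^bsub>X\<^esub> f as) \<in> cochains B X n"
proof -
  obtain C where C: "\<And>as. as \<in> tuples B n \<Longrightarrow> nrm X (f as) \<le> C * (\<Prod>i<n. nrm B (as ! i))"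
    using cochain_bound[OF f] by metis
  note fs = cochainsD[OF f]
  show ?thesis
  proof (rule cochainsI)
    fix as assume as: "as \<in> tuples B n"
    show "nrm X ((\<lambda>as\<in>tuples B n. c \<odot>\<^bsub>X\<^esub> f as) as) \<le> (cmod c * C) * (\<Prod>i<n. nrm B (as ! i))"
      using as X.nrm_smult[OF fs(2)[OF as], of c] mult_left_mono[OF C[OF as], of "cmod c"]
      by (simp add: mult_ac)
  qed (simp_all add: fs tuples_update X.sm_sm X.sm_plus mult.commute)
qed

lemma cochain_zero: "(\<lambda>as\<in>tuples B n. \<zero>\<^bsub>X\<^esub>) \<in> cochains B X n"
  by (rule cochainsI[of _ _ _ _ 0]) (auto simp: tuples_update)

lemma merge_closed:
  assumes "f \<in> tuples B n \<rightarrow> carrier X" "as \<in> tuples B (Suc n)" "i < n"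
  shows "f (take i as @ [as ! i \<otimes>\<^bsub>B\<^esub> as ! Suc i] @ drop (i + 2) as) \<in> carrier X"
proof -
  have "as ! i \<otimes>\<^bsub>B\<^esub> as ! Suc i \<in> carrier B"
    using assms by (intro B.mult_closed tuples_nth[of as B "Suc n"]) auto
  with assms(2,3) have "take i as @ [as ! i \<otimes>\<^bsub>B\<^esub> as ! Suc i] @ drop (i + 2) as \<in> tuples B n"
    by (rule tuples_merge)
  with assms(1) show ?thesis
    by (rule funcset_mem)
qed

lemma coboundary_add:
  assumes f: "f \<in> cochains B X n" and g: "g \<in> cochains B X n" and as: "as \<in> tuples B (Suc n)"
  shows "coboundary B X n (\<lambda>as\<in>tuples B n. f as \<oplus>\<^bsub>X\<^esub> g as) as = coboundary B X n f as \<oplus>\<^bsub>X\<^esub> coboundary B X n g as"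
proof -
  have fc: "f \<in> tuples B n \<rightarrow> carrier X" and gc: "g \<in> tuples B n \<rightarrow> carrier X"
    using cochainsD(2)[OF f] cochainsD(2)[OF g] by auto
  let ?T = "\<lambda>i. take i as @ [as ! i \<otimes>\<^bsub>B\<^esub> as ! Suc i] @ drop (i + 2) as"
  have T: "?T i \<in> tuples B n" if "i < n" for i
    using as that by (intro tuples_merge B.mult_closed tuples_nth[of as B "Suc n"]) auto
  have "(\<Oplus>\<^bsub>X\<^esub>i\<in>{..<n}. ((- 1) ^ Suc i) \<odot>\<^bsub>X\<^esub> (\<lambda>as\<in>tuples B n. f as \<oplus>\<^bsub>X\<^esub> g as) (?T i)) =
      (\<Oplus>\<^bsub>X\<^esub>i\<in>{..<n}. ((- 1) ^ Suc i) \<odot>\<^bsub>X\<^esub> f (?T i) \<oplus>\<^bsub>X\<^esub> ((- 1) ^ Suc i) \<odot>\<^bsub>X\<^esub> g (?T i))"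
    using T fc gc by (intro X.M.finsum_cong') (auto simp: X.sm_plus Pi_iff)
  also have "\<dots> = (\<Oplus>\<^bsub>X\<^esub>i\<in>{..<n}. ((- 1) ^ Suc i) \<odot>\<^bsub>X\<^esub> f (?T i)) \<oplus>\<^bsub>X\<^esub> (\<Oplus>\<^bsub>X\<^esub>i\<in>{..<n}. ((- 1) ^ Suc i) \<odot>\<^bsub>X\<^esub> g (?T i))"
    using T fc gc by (intro X.M.finsum_addf) (auto simp: Pi_iff)
  finally have S: "(\<Oplus>\<^bsub>X\<^esub>i\<in>{..<n}. ((- 1) ^ Suc i) \<odot>\<^bsub>X\<^esub> (\<lambda>as\<in>tuples B n. f as \<oplus>\<^bsub>X\<^esub> g as) (?T i)) =
      (\<Oplus>\<^bsub>X\<^esub>i\<in>{..<n}. ((- 1) ^ Suc i) \<odot>\<^bsub>X\<^esub> f (?T i)) \<oplus>\<^bsub>X\<^esub> (\<Oplus>\<^bsub>X\<^esub>i\<in>{..<n}. ((- 1) ^ Suc i) \<odot>\<^bsub>X\<^esub> g (?T i))" .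
  have c: "(\<Oplus>\<^bsub>X\<^esub>i\<in>{..<n}. ((- 1) ^ Suc i) \<odot>\<^bsub>X\<^esub> f (?T i)) \<in> carrier X"
    "(\<Oplus>\<^bsub>X\<^esub>i\<in>{..<n}. ((- 1) ^ Suc i) \<odot>\<^bsub>X\<^esub> g (?T i)) \<in> carrier X"
    using T fc gc by (auto intro!: X.M.finsum_closed simp: Pi_iff)
  note t = tuples_hd_tl[OF as]
  show ?thesis
    using as c t cochainsD(2)[OF f] cochainsD(2)[OF g] unfolding coboundary_def S restrict_apply'[OF as]
    by (simp add: lact_add ract_add X.sm_plus X.M.a_ac)
qed

lemma coboundary_smult:
  assumes f: "f \<in> cochains B X n" and as: "as \<in> tuples B (Suc n)"
  shows "coboundary B X n (\<lambda>as\<in>tuples B n. c \<odot>\<^bsub>X\<^esub> f as) as = c \<odot>\<^bsub>X\<^esub> coboundary B X n f as"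
proof -
  have fc: "f \<in> tuples B n \<rightarrow> carrier X"
    using cochainsD(2)[OF f] by auto
  let ?T = "\<lambda>i. take i as @ [as ! i \<otimes>\<^bsub>B\<^esub> as ! Suc i] @ drop (i + 2) as"
  have T: "?T i \<in> tuples B n" if "i < n" for i
    using as that by (intro tuples_merge B.mult_closed tuples_nth[of as B "Suc n"]) auto
  have "(\<Oplus>\<^bsub>X\<^esub>i\<in>{..<n}. ((- 1) ^ Suc i) \<odot>\<^bsub>X\<^esub> (\<lambda>as\<in>tuples B n. c \<odot>\<^bsub>X\<^esub> f as) (?T i)) =
      (\<Oplus>\<^bsub>X\<^esub>i\<in>{..<n}. c \<odot>\<^bsub>X\<^esub> (((- 1) ^ Suc i) \<odot>\<^bsub>X\<^esub> f (?T i)))"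
    using T fc by (intro X.M.finsum_cong') (auto simp: X.sm_sm Pi_iff mult.commute)
  also have "\<dots> = c \<odot>\<^bsub>X\<^esub> (\<Oplus>\<^bsub>X\<^esub>i\<in>{..<n}. ((- 1) ^ Suc i) \<odot>\<^bsub>X\<^esub> f (?T i))"
    using T fc by (intro X.finsum_smult_ldistr[symmetric]) (auto simp: Pi_iff)
  finally have S: "(\<Oplus>\<^bsub>X\<^esub>i\<in>{..<n}. ((- 1) ^ Suc i) \<odot>\<^bsub>X\<^esub> (\<lambda>as\<in>tuples B n. c \<odot>\<^bsub>X\<^esub> f as) (?T i)) =
      c \<odot>\<^bsub>X\<^esub> (\<Oplus>\<^bsub>X\<^esub>i\<in>{..<n}. ((- 1) ^ Suc i) \<odot>\<^bsub>X\<^esub> f (?T i))" .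
  have cl: "(\<Oplus>\<^bsub>X\<^esub>i\<in>{..<n}. ((- 1) ^ Suc i) \<odot>\<^bsub>X\<^esub> f (?T i)) \<in> carrier X"
    using T fc by (auto intro!: X.M.finsum_closed simp: Pi_iff)
  note t = tuples_hd_tl[OF as]
  show ?thesis
    using as cl t cochainsD(2)[OF f] unfolding coboundary_def S restrict_apply'[OF as]
    by (simp add: lact_smult ract_smult X.sm_plus X.sm_sm mult.commute)
qed

lemma coboundary_zero:
  "coboundary B X n (\<lambda>as\<in>tuples B n. \<zero>\<^bsub>X\<^esub>) = (\<lambda>as\<in>tuples B (Suc n). \<zero>\<^bsub>X\<^esub>)"
proof (rule extensionalityI[of _ "tuples B (Suc n)"])
  fix as assume as: "as \<in> tuples B (Suc n)"
  have "(\<lambda>as\<in>tuples B n. 0 \<odot>\<^bsub>X\<^esub> (\<lambda>as\<in>tuples B n. \<zero>\<^bsub>X\<^esub>) as) = (\<lambda>as\<in>tuples B n. \<zero>\<^bsub>X\<^esub>)"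
    by (auto simp: fun_eq_iff restrict_def)
  moreover have "coboundary B X n (\<lambda>as\<in>tuples B n. \<zero>\<^bsub>X\<^esub>) as \<in> carrier X"
  proof -
    have "(\<lambda>as\<in>tuples B n. \<zero>\<^bsub>X\<^esub>) \<in> tuples B n \<rightarrow> carrier X"
      by auto
    from merge_closed[OF this as] show ?thesis
      using tuples_hd_tl[OF as] as unfolding coboundary_def restrict_apply'[OF as]
      by (intro X.M.a_closed X.M.finsum_closed X.smult_mem lact_closed ract_closed) auto
  qed
  ultimately show "coboundary B X n (\<lambda>as\<in>tuples B n. \<zero>\<^bsub>X\<^esub>) as = (\<lambda>as\<in>tuples B (Suc n). \<zero>\<^bsub>X\<^esub>) as"
    using coboundary_smult[OF cochain_zero[of n] as, of 0] as by simp
qed (simp_all add: coboundary_def)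

lemma zero_in_coboundaries: "\<one>\<^bsub>cochain_group B X n\<^esub> \<in> coboundaries B X n"
proof (cases n)
  case (Suc m)
  then show ?thesis
    using coboundary_zero[of m] cochain_zero[of m] by (force simp: coboundaries_def cochain_group_def)
qed (simp add: coboundaries_def)

lemma coboundary_extensional: "coboundary B X n f \<in> extensional (tuples B (Suc n))"
  by (simp add: coboundary_def)

lemma coboundary_closed:
  assumes "f \<in> cochains B X n" "as \<in> tuples B (Suc n)"
  shows "coboundary B X n f as \<in> carrier X"
proof -
  have "f \<in> tuples B n \<rightarrow> carrier X"
    using cochainsD(2)[OF assms(1)] by auto
  from merge_closed[OF this assms(2)] show ?thesis
    using tuples_hd_tl[OF assms(2)] cochainsD(2)[OF assms(1)] unfolding coboundary_def restrict_apply'[OF assms(2)]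
    by (intro X.M.a_closed X.M.finsum_closed X.smult_mem lact_closed ract_closed) auto
qed

lemma trivial_cohomology_iff:
  assumes n: "n = Suc m"
  shows "trivial_group (hochschild_cohomology B X n) \<longleftrightarrow> cocycles B X n \<subseteq> coboundaries B X n"
proof
  assume triv: "trivial_group (hochschild_cohomology B X n)"
  show "cocycles B X n \<subseteq> coboundaries B X n"
  proof
    fix z assume z: "z \<in> cocycles B X n"
    then have zc: "z \<in> cochains B X n"
      by (simp add: cocycles_def)
    have "\<one>\<^bsub>cochain_group B X n\<^esub> \<otimes>\<^bsub>cochain_group B X n\<^esub> z = z"
      using cochainsD(1,2)[OF zc] by (intro extensionalityI[of _ "tuples B n"]) (simp_all add: cochain_group_def)
    then show "z \<in> coboundaries B X n"
      using trivial_group_Mod_D[OF triv[unfolded hochschild_cohomology_def] zero_in_coboundaries z] by blast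
  qed
next
  assume sub: "cocycles B X n \<subseteq> coboundaries B X n"
  show "trivial_group (hochschild_cohomology B X n)"
    unfolding hochschild_cohomology_def
  proof (rule trivial_group_Mod[OF zero_in_coboundaries _ _ sub])
    have z: "\<one>\<^bsub>cochain_group B X n\<^esub> \<in> cocycles B X n"
      using coboundary_zero[of n] cochain_zero[of n] by (simp add: cocycles_def cochain_group_def)
    then show "cocycles B X n \<noteq> {}"
      by blast
    fix h k assume "h \<in> coboundaries B X n" "k \<in> coboundaries B X n"
    then obtain f g where f: "f \<in> cochains B X m" "h = coboundary B X m f"
      and g: "g \<in> cochains B X m" "k = coboundary B X m g"
      using n by (auto simp: coboundaries_def)
    have hk: "h \<otimes>\<^bsub>cochain_group B X n\<^esub> k = (\<lambda>as\<in>tuples B n. h as \<oplus>\<^bsub>X\<^esub> k as)"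
      by (simp add: cochain_group_def)
    also have "\<dots> = coboundary B X m (\<lambda>as\<in>tuples B m. f as \<oplus>\<^bsub>X\<^esub> g as)"
      using coboundary_add[OF f(1) g(1)] unfolding n f(2) g(2)
      by (intro extensionalityI[of _ "tuples B (Suc m)"]) (simp_all add: coboundary_extensional)
    finally show "h \<otimes>\<^bsub>cochain_group B X n\<^esub> k \<in> coboundaries B X n"
      using cochain_add[OF f(1) g(1)] n by (simp add: coboundaries_def)
    define g' where "g' = (\<lambda>as\<in>tuples B m. (- 1) \<odot>\<^bsub>X\<^esub> g as)"
    have g': "g' \<in> cochains B X m"
      unfolding g'_def by (rule cochain_smult[OF g(1)])
    define h' where "h' = coboundary B X m (\<lambda>as\<in>tuples B m. f as \<oplus>\<^bsub>X\<^esub> g' as)"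
    have "h' \<in> coboundaries B X n"
      using cochain_add[OF f(1) g'] n by (simp add: coboundaries_def h'_def)
    moreover have "h = h' \<otimes>\<^bsub>cochain_group B X n\<^esub> k"
    proof (rule extensionalityI[of _ "tuples B (Suc m)"])
      fix as assume as: "as \<in> tuples B (Suc m)"
      have "coboundary B X m g' as = (- 1) \<odot>\<^bsub>X\<^esub> coboundary B X m g as"
        unfolding g'_def by (rule coboundary_smult[OF g(1) as])
      then show "h as = (h' \<otimes>\<^bsub>cochain_group B X n\<^esub> k) as"
        using as coboundary_add[OF f(1) g' as] coboundary_closed[OF f(1) as] coboundary_closed[OF g(1) as]
        unfolding f(2) g(2) h'_def n by (simp add: cochain_group_def X.M.a_assoc)
    qed (simp_all add: f g n coboundary_extensional cochain_group_def)
    ultimately show "\<exists>h'\<in>coboundaries B X n. h = h' \<otimes>\<^bsub>cochain_group B X n\<^esub> k"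
      by blast
  qed
qed

subsection \<open>Degree one\<close>

lemma coboundary_0:
  assumes "g [] \<in> carrier X" "a \<in> carrier B"
  shows "coboundary B X 0 g [a] = commutator X (g []) a"
  using assms by (simp add: coboundary_def commutator_def tuples_def)

lemma coboundary_1:
  assumes f: "f \<in> cochains B X 1" and ab: "a \<in> carrier B" "b \<in> carrier B"
  shows "coboundary B X 1 f [a, b] =
    lact X a (f [b]) \<oplus>\<^bsub>X\<^esub> (- 1) \<odot>\<^bsub>X\<^esub> f [a \<otimes>\<^bsub>B\<^esub> b] \<oplus>\<^bsub>X\<^esub> ract X (f [a]) b"
proof -
  have fc: "f [c] \<in> carrier X" if "c \<in> carrier B" for c
    using that cochainsD(2)[OF f, of "[c]"] by (simp add: tuples_def)
  have "{..<Suc 0} = {0}"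
    by auto
  then show ?thesis
    using ab fc B.mult_closed[OF ab]
    by (simp add: coboundary_def tuples_def X.M.finsum_insert)
qed

text \<open>
  A 1-cocycle is a derivation, and the coboundary of a 0-cochain with value \<open>x\<close> is the commutator with
  \<open>x\<close>.
\<close>

lemma cocycles_1_subset_coboundaries:
  assumes "\<And>D. derivation B X D \<Longrightarrow> inner_derivation B X D"
  shows "cocycles B X 1 \<subseteq> coboundaries B X 1"
proof
  fix f assume "f \<in> cocycles B X 1"
  then have f: "f \<in> cochains B X 1" and co: "coboundary B X 1 f = \<one>\<^bsub>cochain_group B X (Suc 1)\<^esub>"
    by (simp_all add: cocycles_def)
  define D where "D a = f [a]" for a
  have t1: "[a] \<in> tuples B 1" if "a \<in> carrier B" for a
    using that by (simp add: tuples_def)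
  have Dc: "D a \<in> carrier X" if "a \<in> carrier B" for a
    unfolding D_def by (rule cochainsD(2)[OF f t1[OF that]])
  obtain C where C: "\<And>as. as \<in> tuples B 1 \<Longrightarrow> nrm X (f as) \<le> C * (\<Prod>i<1. nrm B (as ! i))"
    using cochain_bound[OF f] by metis
  have "derivation B X D"
    unfolding derivation_def bounded_linear_map_def
  proof (intro conjI ballI allI)
    show "D \<in> carrier B \<rightarrow> carrier X"
      using Dc by blast
    have "nrm X (D a) \<le> C * nrm B a" if "a \<in> carrier B" for a
      using C[OF t1[OF that]] by (simp add: D_def)
    then show "\<exists>C. \<forall>a\<in>carrier B. nrm X (D a) \<le> C * nrm B a"
      by blast
    fix a b assume ab: "a \<in> carrier B" "b \<in> carrier B"
    show "D (a \<oplus>\<^bsub>B\<^esub> b) = D a \<oplus>\<^bsub>X\<^esub> D b"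
      using cochainsD(3)[OF f t1[OF ab(1)], of 0 a b] ab by (simp add: D_def)
    have "[a, b] \<in> tuples B (Suc 1)"
      using ab by (simp add: tuples_def)
    then have 0: "lact X a (D b) \<oplus>\<^bsub>X\<^esub> (- 1) \<odot>\<^bsub>X\<^esub> D (a \<otimes>\<^bsub>B\<^esub> b) \<oplus>\<^bsub>X\<^esub> ract X (D a) b = \<zero>\<^bsub>X\<^esub>"
      using coboundary_1[OF f ab] unfolding co D_def by (simp add: cochain_group_def)
    have c: "lact X a (D b) \<in> carrier X" "ract X (D a) b \<in> carrier X" "D (a \<otimes>\<^bsub>B\<^esub> b) \<in> carrier X"
      using ab Dc B.mult_closed by simp_all
    have "lact X a (D b) \<oplus>\<^bsub>X\<^esub> ract X (D a) b \<oplus>\<^bsub>X\<^esub> (- 1) \<odot>\<^bsub>X\<^esub> D (a \<otimes>\<^bsub>B\<^esub> b) = \<zero>\<^bsub>X\<^esub>"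
      using 0 c by (simp add: X.M.a_ac)
    then show "D (a \<otimes>\<^bsub>B\<^esub> b) = lact X a (D b) \<oplus>\<^bsub>X\<^esub> ract X (D a) b"
      using X.eq_iff_diff[of "lact X a (D b) \<oplus>\<^bsub>X\<^esub> ract X (D a) b" "D (a \<otimes>\<^bsub>B\<^esub> b)"] c by simp
  next
    fix a c assume a: "a \<in> carrier B"
    show "D (c \<odot>\<^bsub>B\<^esub> a) = c \<odot>\<^bsub>X\<^esub> D a"
      using cochainsD(4)[OF f t1[OF a], of 0 a c] a by (simp add: D_def)
  qed
  from assms[OF this] obtain x where x: "x \<in> carrier X" "\<And>a. a \<in> carrier B \<Longrightarrow> D a = commutator X x a"
    unfolding inner_derivation_def by blast
  define g where "g = (\<lambda>as\<in>tuples B 0. x)"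
  have g0: "g [] = x"
    by (simp add: g_def tuples_def)
  have "g \<in> cochains B X 0"
    by (rule cochainsI[of _ _ _ _ "nrm X x"]) (use x in \<open>auto simp: g_def\<close>)
  moreover have "f = coboundary B X 0 g"
  proof (rule extensionalityI[of _ "tuples B 1"])
    show "f \<in> extensional (tuples B 1)"
      by (rule cochainsD(1)[OF f])
    show "coboundary B X 0 g \<in> extensional (tuples B 1)"
      using coboundary_extensional[of 0 g] by simp
    fix as assume "as \<in> tuples B 1"
    then obtain a where a: "as = [a]" "a \<in> carrier B"
      by (auto simp: tuples_def length_Suc_conv)
    show "f as = coboundary B X 0 g as"
      using x(2)[OF a(2)] coboundary_0[of g a] x(1) a by (simp add: g0 D_def)
  qed
  ultimately show "f \<in> coboundaries B X 1"
    by (auto simp: coboundaries_def)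
qed

lemma inner_if_cocycles_1:
  assumes sub: "cocycles B X 1 \<subseteq> coboundaries B X 1" and D: "derivation B X D"
  shows "inner_derivation B X D"
proof -
  have Dl: "bounded_linear_map B X D"
    and Dm: "\<And>a b. \<lbrakk>a \<in> carrier B; b \<in> carrier B\<rbrakk> \<Longrightarrow> D (a \<otimes>\<^bsub>B\<^esub> b) = lact X a (D b) \<oplus>\<^bsub>X\<^esub> ract X (D a) b"
    using D unfolding derivation_def by auto
  note Ds = bounded_linear_mapD[OF Dl]
  define f where "f = (\<lambda>as\<in>tuples B 1. D (hd as))"
  have t1: "\<exists>a\<in>carrier B. as = [a]" if "as \<in> tuples B 1" for as
    using that by (auto simp: tuples_def length_Suc_conv)
  have f1: "f [a] = D a" if "a \<in> carrier B" for a
    using that by (simp add: f_def tuples_def)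
  obtain C where C: "\<And>a. a \<in> carrier B \<Longrightarrow> nrm X (D a) \<le> C * nrm B a"
    using bounded_linear_map_bound[OF Dl B.banach_space_axioms] by metis
  have fc: "f \<in> cochains B X 1"
  proof (rule cochainsI)
    show "f \<in> tuples B 1 \<rightarrow>\<^sub>E carrier X"
      using Ds(1) tuples_hd_tl(1)[of _ B 0] by (auto simp: f_def)
    fix as assume "as \<in> tuples B 1"
    then obtain a where a: "a \<in> carrier B" "as = [a]"
      using t1 by blast
    then show "nrm X (f as) \<le> C * (\<Prod>i<1. nrm B (as ! i))"
      using C by (simp add: f1)
  next
    fix as a b and i :: nat assume "as \<in> tuples B 1" "i < 1" and ab: "a \<in> carrier B" "b \<in> carrier B"
    then obtain a' where "as = [a']" "i = 0"
      using t1 by blast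
    then show "f (as[i := a \<oplus>\<^bsub>B\<^esub> b]) = f (as[i := a]) \<oplus>\<^bsub>X\<^esub> f (as[i := b])"
      using ab by (simp add: f1 Ds)
  next
    fix as a c and i :: nat assume "as \<in> tuples B 1" "i < 1" and a: "a \<in> carrier B"
    then obtain a' where "as = [a']" "i = 0"
      using t1 by blast
    then show "f (as[i := c \<odot>\<^bsub>B\<^esub> a]) = c \<odot>\<^bsub>X\<^esub> f (as[i := a])"
      using a by (simp add: f1 Ds)
  qed
  have "coboundary B X 1 f = \<one>\<^bsub>cochain_group B X (Suc 1)\<^esub>"
  proof (rule extensionalityI[of _ "tuples B (Suc 1)"])
    fix as assume "as \<in> tuples B (Suc 1)"
    then obtain a b where ab: "as = [a, b]" "a \<in> carrier B" "b \<in> carrier B"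
      by (auto simp: tuples_def length_Suc_conv)
    have c: "lact X a (D b) \<in> carrier X" "ract X (D a) b \<in> carrier X"
      using ab Ds by simp_all
    have "coboundary B X 1 f as = \<zero>\<^bsub>X\<^esub>"
      unfolding ab(1) coboundary_1[OF fc ab(2,3)] f1[OF ab(2)] f1[OF ab(3)] f1[OF B.mult_closed[OF ab(2,3)]] Dm[OF ab(2,3)]
      using c by (simp add: X.sm_plus X.M.a_ac)
    then show "coboundary B X 1 f as = \<one>\<^bsub>cochain_group B X (Suc 1)\<^esub> as"
      using \<open>as \<in> _\<close> by (simp add: cochain_group_def)
  qed (simp_all only: coboundary_extensional, simp add: cochain_group_def)
  then have "f \<in> cocycles B X 1"
    using fc by (simp add: cocycles_def)
  then obtain g where g: "g \<in> cochains B X 0" "f = coboundary B X 0 g"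
    using sub by (auto simp: coboundaries_def)
  have g0: "g [] \<in> carrier X"
    by (rule cochainsD(2)[OF g(1)]) (simp add: tuples_def)
  have "D a = commutator X (g []) a" if "a \<in> carrier B" for a
    using coboundary_0[of g, OF g0 that] f1[OF that] g(2) by simp
  then show ?thesis
    unfolding inner_derivation_def using g0 by blast
qed

end

subsection \<open>Currying the last argument\<close>

definition curry_last ::
    "('b, 'm) normed_struct_scheme \<Rightarrow> nat \<Rightarrow> ('b list \<Rightarrow> 'x) \<Rightarrow> 'b list \<Rightarrow> 'b \<Rightarrow> 'x" where
  "curry_last B n f = (\<lambda>as\<in>tuples B n. \<lambda>b\<in>carrier B. f (as @ [b]))"

definition uncurry_last ::
    "('b, 'm) normed_struct_scheme \<Rightarrow> nat \<Rightarrow> ('b list \<Rightarrow> 'b \<Rightarrow> 'x) \<Rightarrow> 'b list \<Rightarrow> 'x" where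
  "uncurry_last B n G = (\<lambda>cs\<in>tuples B (Suc n). G (butlast cs) (last cs))"

lemma prod_nrm_snoc:
  "length as = n \<Longrightarrow> (\<Prod>i<Suc n. nrm B ((as @ [b]) ! i)) = (\<Prod>i<n. nrm B (as ! i)) * nrm B b"
  by (simp add: nth_append)

context banach_bimodule
begin

lemma curry_last_cochain:
  assumes f: "f \<in> cochains B X (Suc n)"
  shows "curry_last B n f \<in> cochains B (operator_bimodule B X) n"
proof -
  note fs = cochainsD[OF f]
  obtain C where C: "C \<ge> 0" "\<And>as. as \<in> tuples B (Suc n) \<Longrightarrow> nrm X (f as) \<le> C * (\<Prod>i<Suc n. nrm B (as ! i))"
    using cochain_bound[OF f] by metis
  have le: "nrm X (f (as @ [b])) \<le> (C * (\<Prod>i<n. nrm B (as ! i))) * nrm B b"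
    if as: "as \<in> tuples B n" and b: "b \<in> carrier B" for as b
  proof -
    have "length as = n"
      using as by (simp add: tuples_def)
    then show ?thesis
      using C(2)[OF tuples_snoc[OF as b]] unfolding prod_nrm_snoc[OF \<open>length as = n\<close>] by (simp add: mult_ac)
  qed
  have upd: "(as @ [b])[n := c] = as @ [c]" if "as \<in> tuples B n" for as b c
    using that by (auto simp: tuples_def list_update_append)
  have updi: "(as @ [b])[i := c] = as[i := c] @ [b]" if "as \<in> tuples B n" "i < n" for as b c i
    using that by (auto simp: tuples_def list_update_append)
  have op: "(\<lambda>b\<in>carrier B. f (as @ [b])) \<in> carrier (operator_bimodule B X)" if as: "as \<in> tuples B n" for as
  proof (rule operatorI[OF _ _ _ le[OF as]])
    fix b assume b: "b \<in> carrier B"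
    show "f (as @ [b]) \<in> carrier X"
      by (rule fs(2)[OF tuples_snoc[OF as b]])
    show "f (as @ [c \<odot>\<^bsub>B\<^esub> b]) = c \<odot>\<^bsub>X\<^esub> f (as @ [b])" for c
      using fs(4)[OF tuples_snoc[OF as b], of n b c] b by (simp add: upd[OF as])
  next
    fix a b assume ab: "a \<in> carrier B" "b \<in> carrier B"
    show "f (as @ [a \<oplus>\<^bsub>B\<^esub> b]) = f (as @ [a]) \<oplus>\<^bsub>X\<^esub> f (as @ [b])"
      using fs(3)[OF tuples_snoc[OF as ab(1)], of n a b] ab by (simp add: upd[OF as])
  qed
  show ?thesis
  proof (rule cochainsI)
    show "curry_last B n f \<in> tuples B n \<rightarrow>\<^sub>E carrier (operator_bimodule B X)"
      unfolding curry_last_def using op by (simp only: PiE_iff extensional_restrict restrict_extensional) simp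
    show "nrm (operator_bimodule B X) (curry_last B n f as) \<le> C * (\<Prod>i<n. nrm B (as ! i))"
      if as: "as \<in> tuples B n" for as
      using as C(1) prod_nrm_nonneg[OF as] le[OF as] by (intro nrm_operator_least) (simp_all add: curry_last_def)
    fix as i a assume as: "as \<in> tuples B n" and i: "i < n" and a: "a \<in> carrier B"
    show "curry_last B n f (as[i := c \<odot>\<^bsub>B\<^esub> a]) = c \<odot>\<^bsub>operator_bimodule B X\<^esub> curry_last B n f (as[i := a])" for c
    proof (rule operator_eqI)
      fix b assume b: "b \<in> carrier B"
      show "curry_last B n f (as[i := c \<odot>\<^bsub>B\<^esub> a]) b = (c \<odot>\<^bsub>operator_bimodule B X\<^esub> curry_last B n f (as[i := a])) b"
        using fs(4)[OF tuples_snoc[OF as b], of i a c] a b as i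
        by (simp add: curry_last_def updi[OF as i] tuples_update)
    qed (use as a in \<open>simp_all add: curry_last_def tuples_update\<close>)
    fix a' assume a': "a' \<in> carrier B"
    show "curry_last B n f (as[i := a \<oplus>\<^bsub>B\<^esub> a']) =
        curry_last B n f (as[i := a]) \<oplus>\<^bsub>operator_bimodule B X\<^esub> curry_last B n f (as[i := a'])"
    proof (rule operator_eqI)
      fix b assume b: "b \<in> carrier B"
      show "curry_last B n f (as[i := a \<oplus>\<^bsub>B\<^esub> a']) b =
          (curry_last B n f (as[i := a]) \<oplus>\<^bsub>operator_bimodule B X\<^esub> curry_last B n f (as[i := a'])) b"
        using fs(3)[OF tuples_snoc[OF as b], of i a a'] a a' b as i
        by (simp add: curry_last_def updi[OF as i] tuples_update)
    qed (use as a a' in \<open>simp_all add: curry_last_def tuples_update\<close>)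
  qed
qed

lemma uncurry_last_cochain:
  assumes G: "G \<in> cochains B (operator_bimodule B X) n"
  shows "uncurry_last B n G \<in> cochains B X (Suc n)" "curry_last B n (uncurry_last B n G) = G"
proof -
  interpret O: banach_bimodule B "operator_bimodule B X"
    by (rule banach_bimodule_operator)
  note Gs = cochainsD[OF G]
  note Go = operatorD[OF Gs(2)]
  obtain C where C: "C \<ge> 0"
    "\<And>as. as \<in> tuples B n \<Longrightarrow> nrm (operator_bimodule B X) (G as) \<le> C * (\<Prod>i<n. nrm B (as ! i))"
    using O.cochain_bound[OF G] by metis
  have u: "uncurry_last B n G (as @ [b]) = G as b" if "as \<in> tuples B n" "b \<in> carrier B" for as b
    using tuples_snoc[OF that] by (simp add: uncurry_last_def)
  show "uncurry_last B n G \<in> cochains B X (Suc n)"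
  proof (rule cochainsI)
    show "uncurry_last B n G \<in> tuples B (Suc n) \<rightarrow>\<^sub>E carrier X"
      unfolding uncurry_last_def by (simp add: PiE_iff Go(1) tuples_hd_tl(3,4))
    show "nrm X (uncurry_last B n G cs) \<le> C * (\<Prod>i<Suc n. nrm B (cs ! i))" if cs: "cs \<in> tuples B (Suc n)" for cs
    proof -
      obtain as b where ab: "cs = as @ [b]" "as \<in> tuples B n" "b \<in> carrier B"
        using cs unfolding tuples_Suc by blast
      have "nrm X (G as b) \<le> nrm (operator_bimodule B X) (G as) * nrm B b"
        by (intro nrm_operator_apply Gs(2) ab)
      also have "\<dots> \<le> (C * (\<Prod>i<n. nrm B (as ! i))) * nrm B b"
        by (intro mult_right_mono C(2) ab B.nrm_nonneg)
      finally show ?thesis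
        using ab prod_nrm_snoc[of as n B b] unfolding ab(1) u[OF ab(2,3)] by (simp add: tuples_def mult_ac)
    qed
    fix cs i a assume cs: "cs \<in> tuples B (Suc n)" and i: "i < Suc n" and a: "a \<in> carrier B"
    obtain as b where ab: "cs = as @ [b]" "as \<in> tuples B n" "b \<in> carrier B"
      using cs unfolding tuples_Suc by blast
    have upd: "cs[i := c] = (if i = n then as @ [c] else as[i := c] @ [b])" for c
      using ab i by (auto simp: tuples_def list_update_append)
    have u': "uncurry_last B n G (cs[i := c]) = (if i = n then G as c else G (as[i := c]) b)"
      if "c \<in> carrier B" for c
      unfolding upd using that ab by (simp add: u tuples_update)
    have i': "i \<noteq> n \<Longrightarrow> i < n"
      using i by simp
    show "uncurry_last B n G (cs[i := c \<odot>\<^bsub>B\<^esub> a]) = c \<odot>\<^bsub>X\<^esub> uncurry_last B n G (cs[i := a])" for c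
      using a ab(2,3) Gs(4)[OF ab(2) i' a, of c] Go(3)[OF ab(2)] by (simp add: u')
    fix a' assume a': "a' \<in> carrier B"
    show "uncurry_last B n G (cs[i := a \<oplus>\<^bsub>B\<^esub> a']) = uncurry_last B n G (cs[i := a]) \<oplus>\<^bsub>X\<^esub> uncurry_last B n G (cs[i := a'])"
      using a a' ab(2,3) Gs(3)[OF ab(2) i' a a'] Go(2)[OF ab(2)] by (simp add: u')
  qed
  show "curry_last B n (uncurry_last B n G) = G"
  proof (rule extensionalityI[OF _ Gs(1)])
    fix as assume as: "as \<in> tuples B n"
    show "curry_last B n (uncurry_last B n G) as = G as"
      by (rule operator_eqI) (use as Go(4)[OF as] in \<open>simp_all add: curry_last_def u\<close>)
  qed (simp add: curry_last_def)
qed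

text \<open>
  The right action of operators is made for this identity. The term of the coboundary that
  multiplies the last two arguments, and the one that takes the last argument out, together give
  the right action on the curried cochain.
\<close>

lemma coboundary_curry_last:
  assumes f: "f \<in> cochains B X (Suc n)" and as: "as \<in> tuples B (Suc n)" and b: "b \<in> carrier B"
  shows "coboundary B (operator_bimodule B X) n (curry_last B n f) as b = coboundary B X (Suc n) f (as @ [b])"
proof -
  let ?O = "operator_bimodule B X"
  interpret O: banach_bimodule B ?O
    by (rule banach_bimodule_operator)
  let ?g = "curry_last B n f"
  have fs: "f cs \<in> carrier X" if "cs \<in> tuples B (Suc n)" for cs
    by (rule cochainsD(2)[OF f that])
  have gs: "?g cs \<in> carrier ?O" if "cs \<in> tuples B n" for cs
    by (rule cochainsD(2)[OF curry_last_cochain[OF f] that])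
  have g: "?g cs c = f (cs @ [c])" if "cs \<in> tuples B n" "c \<in> carrier B" for cs c
    using that by (simp add: curry_last_def)
  note t = tuples_hd_tl[OF as]
  have len: "length as = Suc n"
    using as by (simp add: tuples_def)
  let ?m = "\<lambda>i as. take i as @ [as ! i \<otimes>\<^bsub>B\<^esub> as ! Suc i] @ drop (i + 2) as"
  have m: "?m i as \<in> tuples B n" if "i < n" for i
    using as that by (intro tuples_merge B.mult_closed tuples_nth[of as B "Suc n"]) auto
  have ma: "?m i (as @ [b]) = ?m i as @ [b]" if "i < n" for i
    using that len by (simp add: nth_append)
  have ml: "?m n (as @ [b]) = butlast as @ [last as \<otimes>\<^bsub>B\<^esub> b]"
  proof -
    have "as \<noteq> []"
      using len by auto
    then have "as ! n = last as"
      using len by (simp add: last_conv_nth)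
    then show ?thesis
      using len by (simp add: nth_append butlast_conv_take)
  qed
  define S where "S = (\<Oplus>\<^bsub>?O\<^esub>i\<in>{..<n}. ((- 1) ^ Suc i) \<odot>\<^bsub>?O\<^esub> ?g (?m i as))"
  define T where "T = (\<Oplus>\<^bsub>X\<^esub>i\<in>{..<n}. ((- 1) ^ Suc i) \<odot>\<^bsub>X\<^esub> f (?m i (as @ [b])))"
  have Sc: "S \<in> carrier ?O"
    unfolding S_def using m gs by (intro O.X.M.finsum_closed) (auto simp del: operator_bimodule_simps)
  have "S b = (\<Oplus>\<^bsub>X\<^esub>i\<in>{..<n}. (((- 1) ^ Suc i) \<odot>\<^bsub>?O\<^esub> ?g (?m i as)) b)"
    unfolding S_def
  proof (rule finsum_additive[of _ _ "\<lambda>g. g b"])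
    show "abelian_group ?O" "abelian_group X" ..
    show "((- 1) ^ Suc i) \<odot>\<^bsub>?O\<^esub> ?g (?m i as) \<in> carrier ?O" if "i \<in> {..<n}" for i
      using that by (intro O.X.smult_mem gs m) simp
  qed (use b operatorD(1) in auto)
  also have "\<dots> = T"
    unfolding T_def
  proof (rule X.M.finsum_cong')
    show "(\<lambda>i. ((- 1) ^ Suc i) \<odot>\<^bsub>X\<^esub> f (?m i (as @ [b]))) \<in> {..<n} \<rightarrow> carrier X"
    proof (rule Pi_I)
      fix i assume "i \<in> {..<n}"
      then have i: "i < n" by simp
      show "((- 1) ^ Suc i) \<odot>\<^bsub>X\<^esub> f (?m i (as @ [b])) \<in> carrier X"
        unfolding ma[OF i] by (intro X.smult_mem fs tuples_snoc m i b)
    qed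
    show "(((- 1) ^ Suc i) \<odot>\<^bsub>?O\<^esub> ?g (?m i as)) b = ((- 1) ^ Suc i) \<odot>\<^bsub>X\<^esub> f (?m i (as @ [b]))" if "i \<in> {..<n}" for i
      using that b g[OF m b] ma by simp
  qed simp
  finally have ST: "S b = T" .
  have Tc: "T \<in> carrier X"
    using operatorD(1)[OF Sc b] by (simp only: ST)
  have fm: "f (?m i (as @ [b])) \<in> carrier X" if "i < Suc n" for i
    using merge_closed[of f "Suc n" "as @ [b]" i] fs tuples_snoc[OF as b] that by auto
  have bl: "butlast as @ [last as] = as"
    using len by (metis append_butlast_last_id length_0_conv nat.distinct(1))
  have last: "last as \<otimes>\<^bsub>B\<^esub> b \<in> carrier B"
    using t b by (intro B.mult_closed)
  have fl: "f (butlast as @ [last as \<otimes>\<^bsub>B\<^esub> b]) \<in> carrier X"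
    by (intro fs tuples_snoc t last)
  have sum: "(\<Oplus>\<^bsub>X\<^esub>i\<in>{..<Suc n}. ((- 1) ^ Suc i) \<odot>\<^bsub>X\<^esub> f (?m i (as @ [b]))) =
      ((- 1) ^ Suc n) \<odot>\<^bsub>X\<^esub> f (butlast as @ [last as \<otimes>\<^bsub>B\<^esub> b]) \<oplus>\<^bsub>X\<^esub> T"
    unfolding lessThan_Suc T_def ml[symmetric]
    using fm by (intro X.M.finsum_insert) auto
  have tl: "tl (as @ [b]) = tl as @ [b]" "hd (as @ [b]) = hd as"
    using len by (cases as; simp)+
  have lhs: "coboundary B ?O n ?g as b = (lact ?O (hd as) (?g (tl as)) \<oplus>\<^bsub>?O\<^esub> S \<oplus>\<^bsub>?O\<^esub>
      ((- 1) ^ Suc n) \<odot>\<^bsub>?O\<^esub> ract ?O (?g (butlast as)) (last as)) b"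
    unfolding coboundary_def restrict_apply'[OF as] S_def by (rule refl)
  also have "\<dots> = lact X (hd as) (f (tl as @ [b])) \<oplus>\<^bsub>X\<^esub> T \<oplus>\<^bsub>X\<^esub>
      ((- 1) ^ Suc n) \<odot>\<^bsub>X\<^esub> (f (butlast as @ [last as \<otimes>\<^bsub>B\<^esub> b]) \<oplus>\<^bsub>X\<^esub> (- 1) \<odot>\<^bsub>X\<^esub> ract X (f as) b)"
    using b g[OF t(2) b] g[OF t(4) last] g[OF t(4) t(3)] bl ST by simp
  also have "\<dots> = coboundary B X (Suc n) f (as @ [b])"
    unfolding coboundary_def restrict_apply'[OF tuples_snoc[OF as b]] sum tl
    using t b fl Tc fs[OF tuples_snoc[OF t(2) b]] fs[OF as]
    by (simp add: X.sm_plus X.sm_sm X.M.a_ac)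
  finally show ?thesis .
qed

end

lemma coboundary_morphism:
  assumes e: "bimodule_morphism B Y X e" and Y: "banach_bimodule B Y" and X: "banach_bimodule B X"
    and f: "f \<in> cochains B Y n" and as: "as \<in> tuples B (Suc n)"
  shows "e (coboundary B Y n f as) = coboundary B X n (\<lambda>as\<in>tuples B n. e (f as)) as"
proof -
  interpret Y: banach_bimodule B Y by (fact Y)
  interpret X: banach_bimodule B X by (fact X)
  have el: "bounded_linear_map Y X e"
    and em: "\<And>a y. \<lbrakk>a \<in> carrier B; y \<in> carrier Y\<rbrakk> \<Longrightarrow> e (lact Y a y) = lact X a (e y)"
      "\<And>a y. \<lbrakk>a \<in> carrier B; y \<in> carrier Y\<rbrakk> \<Longrightarrow> e (ract Y y a) = ract X (e y) a"
    using e unfolding bimodule_morphism_def by auto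
  note es = bounded_linear_mapD[OF el]
  have ez: "e \<zero>\<^bsub>Y\<^esub> = \<zero>\<^bsub>X\<^esub>"
    using es(3)[of "\<zero>\<^bsub>Y\<^esub>" 0] es(1)[of "\<zero>\<^bsub>Y\<^esub>"] by simp
  let ?m = "\<lambda>i as. take i as @ [as ! i \<otimes>\<^bsub>B\<^esub> as ! Suc i] @ drop (i + 2) as"
  have m: "?m i as \<in> tuples B n" if "i < n" for i
    using as that by (intro tuples_merge Y.B.mult_closed tuples_nth[of as B "Suc n"]) auto
  have fY: "f cs \<in> carrier Y" if "cs \<in> tuples B n" for cs
    by (rule cochainsD(2)[OF f that])
  note t = tuples_hd_tl[OF as]
  have S: "e (\<Oplus>\<^bsub>Y\<^esub>i\<in>{..<n}. ((- 1) ^ Suc i) \<odot>\<^bsub>Y\<^esub> f (?m i as)) =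
      (\<Oplus>\<^bsub>X\<^esub>i\<in>{..<n}. ((- 1) ^ Suc i) \<odot>\<^bsub>X\<^esub> (\<lambda>as\<in>tuples B n. e (f as)) (?m i as))"
  proof -
    have "e (\<Oplus>\<^bsub>Y\<^esub>i\<in>{..<n}. ((- 1) ^ Suc i) \<odot>\<^bsub>Y\<^esub> f (?m i as)) =
        (\<Oplus>\<^bsub>X\<^esub>i\<in>{..<n}. e (((- 1) ^ Suc i) \<odot>\<^bsub>Y\<^esub> f (?m i as)))"
    proof (rule finsum_additive)
      show "abelian_group Y" "abelian_group X" ..
    qed (use fY m es ez in auto)
    also have "\<dots> = (\<Oplus>\<^bsub>X\<^esub>i\<in>{..<n}. ((- 1) ^ Suc i) \<odot>\<^bsub>X\<^esub> (\<lambda>as\<in>tuples B n. e (f as)) (?m i as))"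
      by (rule X.X.M.finsum_cong') (use fY m es in auto)
    finally show ?thesis .
  qed
  have c: "(\<Oplus>\<^bsub>Y\<^esub>i\<in>{..<n}. ((- 1) ^ Suc i) \<odot>\<^bsub>Y\<^esub> f (?m i as)) \<in> carrier Y"
    using fY m by (intro Y.X.M.finsum_closed) auto
  show ?thesis
    unfolding coboundary_def restrict_apply'[OF as] S[symmetric]
    using t fY c by (simp add: es em)
qed

text \<open>
  The values of the curried cocycle are indexed by tuples, so the operator bimodule has a submodule
  that contains them and has a copy in the universe. There the curried cocycle is a coboundary, and
  uncurrying finishes the step.
\<close>

lemma dimension_shift:
  fixes B :: "('b, 'm) normed_struct_scheme" and X :: "('b, 'u) bimodule"
  assumes X: "banach_bimodule B X"
    and univ: "\<exists>h :: (nat \<Rightarrow> 'b \<times> complex) \<Rightarrow> 'u. inj h"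
    and IH: "\<And>Y :: ('b, 'u) bimodule. banach_bimodule B Y \<Longrightarrow> cocycles B Y (Suc m) \<subseteq> coboundaries B Y (Suc m)"
  shows "cocycles B X (Suc (Suc m)) \<subseteq> coboundaries B X (Suc (Suc m))"
proof
  fix f assume f: "f \<in> cocycles B X (Suc (Suc m))"
  let ?n = "Suc m" and ?O = "operator_bimodule B X"
  have fc: "f \<in> cochains B X (Suc ?n)" and f0: "coboundary B X (Suc ?n) f = \<one>\<^bsub>cochain_group B X (Suc (Suc ?n))\<^esub>"
    using f by (simp_all add: cocycles_def)
  interpret banach_bimodule B X by (fact X)
  interpret O: banach_bimodule B ?O
    by (rule banach_bimodule_operator)
  let ?g = "curry_last B ?n f"
  have g: "?g \<in> cochains B ?O ?n"
    by (rule curry_last_cochain[OF fc])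
  note gs = cochainsD[OF g]
  have "small TYPE('b) (?g ` tuples B ?n)"
    by (intro small_image small_tuples)
  moreover have "?g ` tuples B ?n \<subseteq> carrier ?O"
    using gs(2) by blast
  ultimately obtain Y :: "('b, 'u) bimodule" and e where Y: "banach_bimodule B Y" "bimodule_morphism B Y ?O e"
    "inj_on e (carrier Y)" "\<And>y. y \<in> carrier Y \<Longrightarrow> nrm ?O (e y) = nrm Y y" "?g ` tuples B ?n \<subseteq> e ` carrier Y"
    using small_submodule_in_universe[OF banach_bimodule_operator _ _ univ] by metis
  interpret Y: banach_bimodule B Y by (fact Y)
  have el: "bounded_linear_map Y ?O e"
    using Y(2) unfolding bimodule_morphism_def by auto
  note es = bounded_linear_mapD[OF el]
  have inj: "x = y" if "e x = e y" "x \<in> carrier Y" "y \<in> carrier Y" for x y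
    using Y(3) that by (auto simp: inj_on_def)
  have ez: "e \<zero>\<^bsub>Y\<^esub> = \<zero>\<^bsub>?O\<^esub>"
    using es(3)[of "\<zero>\<^bsub>Y\<^esub>" 0] O.X.sm_0[OF es(1)[of "\<zero>\<^bsub>Y\<^esub>"]] by simp
  define h where "h = (\<lambda>as\<in>tuples B ?n. inv_into (carrier Y) e (?g as))"
  have h: "h as \<in> carrier Y" "e (h as) = ?g as" if "as \<in> tuples B ?n" for as
  proof -
    have "?g as \<in> e ` carrier Y"
      using Y(5) that by blast
    then show "h as \<in> carrier Y" "e (h as) = ?g as"
      using that unfolding h_def by (simp_all only: restrict_apply' inv_into_into f_inv_into_f)
  qed
  have hc: "h \<in> cochains B Y ?n"
  proof -
    obtain C where C: "\<And>as. as \<in> tuples B ?n \<Longrightarrow> nrm ?O (?g as) \<le> C * (\<Prod>i<?n. nrm B (as ! i))"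
      using O.cochain_bound[OF g] by metis
    show ?thesis
    proof (rule cochainsI)
      show "h \<in> tuples B ?n \<rightarrow>\<^sub>E carrier Y"
        using h(1) by (simp add: PiE_iff) (simp add: h_def)
      show "nrm Y (h as) \<le> C * (\<Prod>i<?n. nrm B (as ! i))" if as: "as \<in> tuples B ?n" for as
        using C[OF as] Y(4)[OF h(1)[OF as]] h(2)[OF as] by simp
      fix as i a assume as: "as \<in> tuples B ?n" and i: "i < ?n" and a: "a \<in> carrier B"
      have u: "as[i := c] \<in> tuples B ?n" if "c \<in> carrier B" for c
        using tuples_update[OF as that] .
      show "h (as[i := c \<odot>\<^bsub>B\<^esub> a]) = c \<odot>\<^bsub>Y\<^esub> h (as[i := a])" for c
      proof (rule inj)
        show "e (h (as[i := c \<odot>\<^bsub>B\<^esub> a])) = e (c \<odot>\<^bsub>Y\<^esub> h (as[i := a]))"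
          unfolding h(2)[OF u[OF B.smult_mem[OF a]]] es(3)[OF h(1)[OF u[OF a]]] h(2)[OF u[OF a]]
          by (rule gs(4)[OF as i a])
      qed (intro h u B.smult_mem Y.X.smult_mem a)+
      fix b assume b: "b \<in> carrier B"
      show "h (as[i := a \<oplus>\<^bsub>B\<^esub> b]) = h (as[i := a]) \<oplus>\<^bsub>Y\<^esub> h (as[i := b])"
      proof (rule inj)
        show "e (h (as[i := a \<oplus>\<^bsub>B\<^esub> b])) = e (h (as[i := a]) \<oplus>\<^bsub>Y\<^esub> h (as[i := b]))"
          unfolding h(2)[OF u[OF B.M.a_closed[OF a b]]] es(2)[OF h(1)[OF u[OF a]] h(1)[OF u[OF b]]]
            h(2)[OF u[OF a]] h(2)[OF u[OF b]]
          by (rule gs(3)[OF as i a b])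
      qed (intro h u B.M.a_closed Y.X.M.a_closed a b)+
    qed
  qed
  have eh: "(\<lambda>as\<in>tuples B ?n. e (h as)) = ?g"
    by (rule extensionalityI[OF _ gs(1)]) (simp_all add: h)
  have "coboundary B Y ?n h = \<one>\<^bsub>cochain_group B Y (Suc ?n)\<^esub>"
  proof (rule extensionalityI[OF Y.coboundary_extensional])
    fix as assume as: "as \<in> tuples B (Suc ?n)"
    have "coboundary B Y ?n h as = \<zero>\<^bsub>Y\<^esub>"
    proof (rule inj)
      have "coboundary B ?O ?n ?g as = \<zero>\<^bsub>?O\<^esub>"
      proof (rule operator_eqI)
        show "coboundary B ?O ?n ?g as \<in> extensional (carrier B)"
          by (rule operatorD(4)[OF O.coboundary_closed[OF g as]])
        fix b assume b: "b \<in> carrier B"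
        show "coboundary B ?O ?n ?g as b = \<zero>\<^bsub>?O\<^esub> b"
          unfolding coboundary_curry_last[OF fc as b] f0
          using tuples_snoc[OF as b] b by (simp add: cochain_group_def)
      qed simp
      then show "e (coboundary B Y ?n h as) = e \<zero>\<^bsub>Y\<^esub>"
        unfolding coboundary_morphism[OF Y(2,1) banach_bimodule_operator hc as] eh ez .
    qed (intro Y.coboundary_closed[OF hc as] Y.X.M.zero_closed)+
    then show "coboundary B Y ?n h as = \<one>\<^bsub>cochain_group B Y (Suc ?n)\<^esub> as"
      using as by (simp add: cochain_group_def)
  qed (simp add: cochain_group_def)
  then have "h \<in> coboundaries B Y ?n"
    using IH[OF Y(1)] hc by (auto simp: cocycles_def)
  then obtain k where k: "k \<in> cochains B Y m" "h = coboundary B Y m k"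
    by (auto simp: coboundaries_def)
  define G where "G = (\<lambda>as\<in>tuples B m. e (k as))"
  note ks = cochainsD[OF k(1)]
  have G: "G \<in> cochains B ?O m"
  proof -
    obtain C where C: "\<And>as. as \<in> tuples B m \<Longrightarrow> nrm Y (k as) \<le> C * (\<Prod>i<m. nrm B (as ! i))"
      using Y.cochain_bound[OF k(1)] by metis
    show ?thesis
    proof (rule cochainsI)
      show "G \<in> tuples B m \<rightarrow>\<^sub>E carrier ?O"
        unfolding G_def using es(1)[OF ks(2)] by (simp only: PiE_iff restrict_extensional) simp
      show "nrm ?O (G as) \<le> C * (\<Prod>i<m. nrm B (as ! i))" if as: "as \<in> tuples B m" for as
        using C[OF as] Y(4)[OF ks(2)[OF as]] as by (simp add: G_def)
    qed (simp_all only: G_def restrict_apply' tuples_update B.smult_mem B.M.a_closed ks es)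
  qed
  have "f = coboundary B X ?n (uncurry_last B m G)"
  proof (rule extensionalityI[OF cochainsD(1)[OF fc] coboundary_extensional])
    fix cs assume "cs \<in> tuples B (Suc ?n)"
    then obtain as b where ab: "cs = as @ [b]" "as \<in> tuples B ?n" "b \<in> carrier B"
      unfolding tuples_Suc[of cs] by blast
    have "coboundary B X ?n (uncurry_last B m G) cs = coboundary B ?O m G as b"
      unfolding ab(1) coboundary_curry_last[OF uncurry_last_cochain(1)[OF G] ab(2,3), symmetric]
        uncurry_last_cochain(2)[OF G] ..
    also have "\<dots> = e (h as) b"
      unfolding k(2) coboundary_morphism[OF Y(2,1) banach_bimodule_operator k(1) ab(2)] G_def ..
    also have "\<dots> = f cs"
      using ab by (simp add: h curry_last_def)
    finally show "f cs = coboundary B X ?n (uncurry_last B m G) cs" ..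
  qed
  then show "f \<in> coboundaries B X (Suc (Suc m))"
    using uncurry_last_cochain(1)[OF G] by (auto simp: coboundaries_def)
qed

theorem contractible_iff_cohomology_trivial:
  fixes B :: "('b, 'm) normed_struct_scheme"
  assumes B: "banach_algebra B" and univ: "\<exists>h :: (nat \<Rightarrow> 'b \<times> complex) \<Rightarrow> 'u. inj h"
  shows "contractible_algebra TYPE('u) B \<longleftrightarrow>
    (\<forall>X :: ('b, 'u) bimodule. banach_bimodule B X \<longrightarrow>
      (\<forall>n\<ge>1. trivial_group (hochschild_cohomology B X n)))"
proof
  assume con: "contractible_algebra TYPE('u) B"
  have "cocycles B X (Suc m) \<subseteq> coboundaries B X (Suc m)" if "banach_bimodule B X" for X :: "('b, 'u) bimodule" and m
    using that
  proof (induction m arbitrary: X)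
    case 0
    show ?case
      using banach_bimodule.cocycles_1_subset_coboundaries[OF 0 contractible_imp_inner[OF con univ 0]] by simp
  next
    case (Suc m)
    show ?case
      by (rule dimension_shift[OF Suc.prems univ Suc.IH])
  qed
  then show "\<forall>X :: ('b, 'u) bimodule. banach_bimodule B X \<longrightarrow>
      (\<forall>n\<ge>1. trivial_group (hochschild_cohomology B X n))"
    by (metis banach_bimodule.trivial_cohomology_iff Suc_le_D One_nat_def)
next
  assume triv: "\<forall>X :: ('b, 'u) bimodule. banach_bimodule B X \<longrightarrow>
      (\<forall>n\<ge>1. trivial_group (hochschild_cohomology B X n))"
  show "contractible_algebra TYPE('u) B"
  proof (rule inner_imp_contractible[OF B])
    fix X :: "('b, 'u) bimodule" and D assume X: "banach_bimodule B X" and D: "derivation B X D"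
    have "trivial_group (hochschild_cohomology B X 1)"
      using triv X by simp
    then have "cocycles B X 1 \<subseteq> coboundaries B X 1"
      using banach_bimodule.trivial_cohomology_iff[OF X, of 1 0] by simp
    then show "inner_derivation B X D"
      by (rule banach_bimodule.inner_if_cocycles_1[OF X _ D])
  qed
qed

section \<open>Permanence of contractibility\<close>

lemma banach_space_bounded_maps_agree:
  assumes E: "banach_space E" and F: "banach_space F"
    and f: "bounded_linear_map E F f" and g: "bounded_linear_map E F g"
    and dense: "\<And>\<epsilon>. \<epsilon> > 0 \<Longrightarrow> \<exists>y\<in>carrier E. gap E y x < \<epsilon> \<and> f y = g y" and x: "x \<in> carrier E"
  shows "f x = g x"
proof -
  interpret E: banach_space E by fact
  interpret F: banach_space F by fact
  obtain C where C: "C \<ge> 0" "\<And>x y. \<lbrakk>x \<in> carrier E; y \<in> carrier E\<rbrakk> \<Longrightarrow> gap F (f x) (f y) \<le> C * gap E x y"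
    using bounded_linear_map_gap[OF f E] by blast
  obtain K where K: "K \<ge> 0" "\<And>x y. \<lbrakk>x \<in> carrier E; y \<in> carrier E\<rbrakk> \<Longrightarrow> gap F (g x) (g y) \<le> K * gap E x y"
    using bounded_linear_map_gap[OF g E] by blast
  note fc = bounded_linear_mapD(1)[OF f] and gc = bounded_linear_mapD(1)[OF g]
  have "gap F (f x) (g x) \<le> 0 + \<epsilon>" if "\<epsilon> > 0" for \<epsilon>
  proof -
    have "\<epsilon> / (C + K + 1) > 0"
      using that C(1) K(1) by simp
    then obtain y where y: "y \<in> carrier E" "gap E y x < \<epsilon> / (C + K + 1)" "f y = g y"
      using dense by blast
    have "gap F (f x) (g x) \<le> gap F (f x) (f y) + gap F (g y) (g x)"
      using F.gap_triangle[of "f x" "f y" "g x"] fc gc x y by simp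
    also have "\<dots> \<le> C * gap E y x + K * gap E y x"
      using C(2)[OF x y(1)] K(2)[OF y(1) x] E.gap_commute[OF x y(1)] by simp
    also have "\<dots> \<le> (C + K + 1) * gap E y x"
      using E.gap_nonneg[OF y(1) x] by (simp add: algebra_simps)
    also have "\<dots> \<le> \<epsilon>"
      using y(2) C(1) K(1) by (simp add: less_divide_eq mult.commute)
    finally show ?thesis by simp
  qed
  then have "gap F (f x) (g x) \<le> 0"
    by (rule field_le_epsilon)
  then have "gap F (f x) (g x) = 0"
    using F.gap_nonneg[OF fc[OF x] gc[OF x]] by linarith
  then show ?thesis
    using F.gap_0_iff[OF fc[OF x] gc[OF x]] by blast
qed

definition algebra_hom ::
    "('b, 'm) normed_struct_scheme \<Rightarrow> ('c, 'n) normed_struct_scheme \<Rightarrow> ('b \<Rightarrow> 'c) \<Rightarrow> bool" where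
  "algebra_hom B C \<theta> \<longleftrightarrow> bounded_linear_map B C \<theta> \<and>
     (\<forall>a\<in>carrier B. \<forall>b\<in>carrier B. \<theta> (a \<otimes>\<^bsub>B\<^esub> b) = \<theta> a \<otimes>\<^bsub>C\<^esub> \<theta> b)"

definition pullback :: "('b \<Rightarrow> 'c) \<Rightarrow> ('c, 'x, 'n) bimodule_scheme \<Rightarrow> ('b, 'x) bimodule" where
  "pullback \<theta> X = \<lparr>carrier = carrier X, mult = undefined, one = undefined, zero = \<zero>\<^bsub>X\<^esub>,
     add = add X, smult = smult X, nrm = nrm X,
     lact = (\<lambda>a. lact X (\<theta> a)), ract = (\<lambda>x a. ract X x (\<theta> a))\<rparr>"

lemma banach_bimodule_pullback:
  assumes B: "banach_algebra B" and X: "banach_bimodule C X" and \<theta>: "algebra_hom B C \<theta>"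
  shows "banach_bimodule B (pullback \<theta> X)"
proof -
  interpret dom: banach_algebra B by fact
  interpret banach_bimodule C X by fact
  have \<theta>l: "bounded_linear_map B C \<theta>"
    and \<theta>m: "\<And>a b. \<lbrakk>a \<in> carrier B; b \<in> carrier B\<rbrakk> \<Longrightarrow> \<theta> (a \<otimes>\<^bsub>B\<^esub> b) = \<theta> a \<otimes>\<^bsub>C\<^esub> \<theta> b"
    using \<theta> unfolding algebra_hom_def by auto
  note \<theta>s = bounded_linear_mapD[OF \<theta>l]
  obtain K where K: "K \<ge> 0" "\<And>a. a \<in> carrier B \<Longrightarrow> nrm C (\<theta> a) \<le> K * nrm B a"
    using bounded_linear_map_bound[OF \<theta>l dom.banach_space_axioms] by blast
  obtain L where L: "L \<ge> 0"
    "\<And>a x. \<lbrakk>a \<in> carrier C; x \<in> carrier X\<rbrakk> \<Longrightarrow> nrm X (lact X a x) \<le> L * nrm C a * nrm X x"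
    "\<And>a x. \<lbrakk>a \<in> carrier C; x \<in> carrier X\<rbrakk> \<Longrightarrow> nrm X (ract X x a) \<le> L * nrm C a * nrm X x"
    using bounds by blast
  show ?thesis
  proof (intro banach_bimodule.intro banach_bimodule_axioms.intro)
    show "banach_algebra B" by fact
    show "banach_space (pullback \<theta> X)"
      by (rule banach_space_transfer[OF X.banach_space_axioms, of id]) (simp_all add: pullback_def)
    show "\<exists>C. \<forall>a\<in>carrier B. \<forall>x\<in>carrier (pullback \<theta> X).
        nrm (pullback \<theta> X) (lact (pullback \<theta> X) a x) \<le> C * nrm B a * nrm (pullback \<theta> X) x \<and>
        nrm (pullback \<theta> X) (ract (pullback \<theta> X) x a) \<le> C * nrm B a * nrm (pullback \<theta> X) x"
    proof (intro exI[of _ "L * K"] ballI)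
      fix a x assume a: "a \<in> carrier B" and x: "x \<in> carrier (pullback \<theta> X)"
      then have x': "x \<in> carrier X"
        by (simp add: pullback_def)
      have "L * nrm C (\<theta> a) * nrm X x \<le> L * (K * nrm B a) * nrm X x"
        by (intro mult_right_mono mult_left_mono K a L(1) X.nrm_nonneg x')
      then show "nrm (pullback \<theta> X) (lact (pullback \<theta> X) a x) \<le> L * K * nrm B a * nrm (pullback \<theta> X) x \<and>
          nrm (pullback \<theta> X) (ract (pullback \<theta> X) x a) \<le> L * K * nrm B a * nrm (pullback \<theta> X) x"
        using L(2,3)[OF \<theta>s(1)[OF a] x'] by (simp add: pullback_def mult_ac)
    qed
  qed (simp_all add: pullback_def \<theta>s \<theta>m lact_add add_lact lact_smult smult_lact ract_add add_ract
      ract_smult smult_ract lact_assoc ract_assoc lact_ract)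
qed

lemma derivation_pullback:
  assumes B: "banach_algebra B" and X: "banach_bimodule C X" and \<theta>: "algebra_hom B C \<theta>"
    and D: "derivation C X D"
  shows "derivation B (pullback \<theta> X) (\<lambda>a. D (\<theta> a))"
proof -
  interpret dom: banach_algebra B by fact
  interpret banach_bimodule C X by fact
  have \<theta>l: "bounded_linear_map B C \<theta>"
    and \<theta>m: "\<And>a b. \<lbrakk>a \<in> carrier B; b \<in> carrier B\<rbrakk> \<Longrightarrow> \<theta> (a \<otimes>\<^bsub>B\<^esub> b) = \<theta> a \<otimes>\<^bsub>C\<^esub> \<theta> b"
    using \<theta> unfolding algebra_hom_def by auto
  have Dl: "bounded_linear_map C X D"
    and Dm: "\<And>a b. \<lbrakk>a \<in> carrier C; b \<in> carrier C\<rbrakk> \<Longrightarrow> D (a \<otimes>\<^bsub>C\<^esub> b) = lact X a (D b) \<oplus>\<^bsub>X\<^esub> ract X (D a) b"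
    using D unfolding derivation_def by auto
  note \<theta>s = bounded_linear_mapD[OF \<theta>l] and Ds = bounded_linear_mapD[OF Dl]
  obtain K where K: "K \<ge> 0" "\<And>a. a \<in> carrier B \<Longrightarrow> nrm C (\<theta> a) \<le> K * nrm B a"
    using bounded_linear_map_bound[OF \<theta>l dom.banach_space_axioms] by blast
  obtain L where L: "L \<ge> 0" "\<And>a. a \<in> carrier C \<Longrightarrow> nrm X (D a) \<le> L * nrm C a"
    using bounded_linear_map_bound[OF Dl B.banach_space_axioms] by blast
  have "nrm X (D (\<theta> a)) \<le> L * K * nrm B a" if a: "a \<in> carrier B" for a
    using L(2)[OF \<theta>s(1)[OF a]] mult_left_mono[OF K(2)[OF a] L(1)] by simp
  then have "\<exists>M. \<forall>a\<in>carrier B. nrm X (D (\<theta> a)) \<le> M * nrm B a"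
    by blast
  then show ?thesis
    unfolding derivation_def bounded_linear_map_def by (simp add: pullback_def \<theta>s \<theta>m Ds Dm)
qed

text \<open>
  A derivation of \<open>C\<close> pulls back to an inner derivation of \<open>B\<close>. So it agrees with a commutator on the
  image of \<open>\<theta>\<close>, and by continuity everywhere.
\<close>

lemma contractible_dense_image:
  fixes B :: "('b, 'm) normed_struct_scheme" and C :: "('c, 'n) normed_struct_scheme"
  assumes con: "contractible_algebra TYPE('u) B"
    and univ: "\<exists>h :: (nat \<Rightarrow> 'b \<times> complex) \<Rightarrow> 'u. inj h"
    and B: "banach_algebra B" and C: "banach_algebra C" and \<theta>: "algebra_hom B C \<theta>"
    and dense: "\<And>c \<epsilon>. \<lbrakk>c \<in> carrier C; \<epsilon> > 0\<rbrakk> \<Longrightarrow> \<exists>a\<in>carrier B. gap C (\<theta> a) c < \<epsilon>"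
  shows "contractible_algebra TYPE('u) C"
proof (rule inner_imp_contractible[OF C])
  fix X :: "('c, 'u) bimodule" and D assume X: "banach_bimodule C X" and D: "derivation C X D"
  interpret banach_bimodule C X by fact
  have "inner_derivation B (pullback \<theta> X) (\<lambda>a. D (\<theta> a))"
    by (rule contractible_imp_inner[OF con univ banach_bimodule_pullback[OF B X \<theta>] derivation_pullback[OF B X \<theta> D]])
  then obtain x where x: "x \<in> carrier X" "\<And>a. a \<in> carrier B \<Longrightarrow> D (\<theta> a) = commutator X x (\<theta> a)"
    unfolding inner_derivation_def by (auto simp: pullback_def commutator_def)
  have \<theta>c: "\<theta> a \<in> carrier C" if "a \<in> carrier B" for a
    using \<theta> that unfolding algebra_hom_def bounded_linear_map_def by blast
  have "D c = commutator X x c" if c: "c \<in> carrier C" for c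
  proof (rule banach_space_bounded_maps_agree[OF B.banach_space_axioms X.banach_space_axioms _ _ _ c])
    show "bounded_linear_map C X D" "bounded_linear_map C X (commutator X x)"
      using D derivation_commutator[OF x(1)] unfolding derivation_def by blast+
    show "\<exists>y\<in>carrier C. gap C y c < \<epsilon> \<and> D y = commutator X x y" if "\<epsilon> > 0" for \<epsilon>
      using dense[OF c that] x(2) \<theta>c by blast
  qed
  then show "inner_derivation C X D"
    unfolding inner_derivation_def using x(1) by blast
qed

text \<open>
  On \<open>B\<close> with the zero right action the identity map is a derivation, and if it is the commutator
  with \<open>e\<close>, then \<open>e\<close> is a right identity. Exchanging the sides gives a left identity.
\<close>

lemma contractible_imp_identity:
  fixes B :: "('b, 'm) normed_struct_scheme"
  assumes con: "contractible_algebra TYPE('u) B"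
    and univ: "\<exists>h :: (nat \<Rightarrow> 'b \<times> complex) \<Rightarrow> 'u. inj h"
    and B: "banach_algebra B"
  obtains e where "e \<in> carrier B" "\<And>a. a \<in> carrier B \<Longrightarrow> e \<otimes>\<^bsub>B\<^esub> a = a" "\<And>a. a \<in> carrier B \<Longrightarrow> a \<otimes>\<^bsub>B\<^esub> e = a"
proof -
  interpret B: banach_algebra B by fact
  define L :: "('b, 'b) bimodule" where
    "L = \<lparr>carrier = carrier B, mult = undefined, one = undefined, zero = \<zero>\<^bsub>B\<^esub>, add = add B, smult = smult B,
       nrm = nrm B, lact = (\<lambda>a x. a \<otimes>\<^bsub>B\<^esub> x), ract = (\<lambda>x a. \<zero>\<^bsub>B\<^esub>)\<rparr>"
  define R :: "('b, 'b) bimodule" where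
    "R = \<lparr>carrier = carrier B, mult = undefined, one = undefined, zero = \<zero>\<^bsub>B\<^esub>, add = add B, smult = smult B,
       nrm = nrm B, lact = (\<lambda>a x. \<zero>\<^bsub>B\<^esub>), ract = (\<lambda>x a. x \<otimes>\<^bsub>B\<^esub> a)\<rparr>"
  note facts = B.mult_closed B.mult_assoc B.mult_distl B.mult_distr B.smult_mult_left B.smult_mult_right
  have Lb: "banach_bimodule B L"
  proof (intro banach_bimodule.intro banach_bimodule_axioms.intro)
    show "banach_algebra B" by fact
    show "banach_space L"
      by (rule banach_space_transfer[OF B.banach_space_axioms, of id]) (simp_all add: L_def)
    show "\<exists>C. \<forall>a\<in>carrier B. \<forall>x\<in>carrier L. nrm L (lact L a x) \<le> C * nrm B a * nrm L x \<and>
        nrm L (ract L x a) \<le> C * nrm B a * nrm L x"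
      using B.nrm_mult B.nrm_nonneg by (intro exI[of _ 1]) (simp add: L_def)
  qed (simp_all add: L_def facts)
  have nm: "nrm B (x \<otimes>\<^bsub>B\<^esub> a) \<le> nrm B a * nrm B x" if "a \<in> carrier B" "x \<in> carrier B" for a x
    using B.nrm_mult[OF that(2,1)] by (simp add: mult.commute)
  have Rb: "banach_bimodule B R"
  proof (intro banach_bimodule.intro banach_bimodule_axioms.intro)
    show "banach_algebra B" by fact
    show "banach_space R"
      by (rule banach_space_transfer[OF B.banach_space_axioms, of id]) (simp_all add: R_def)
    show "\<exists>C. \<forall>a\<in>carrier B. \<forall>x\<in>carrier R. nrm R (lact R a x) \<le> C * nrm B a * nrm R x \<and>
        nrm R (ract R x a) \<le> C * nrm B a * nrm R x"
      using nm B.nrm_nonneg by (intro exI[of _ 1]) (simp add: R_def)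
  qed (simp_all add: R_def facts)
  have "derivation B L (\<lambda>a. a)" "derivation B R (\<lambda>a. a)"
    unfolding derivation_def bounded_linear_map_def
    by (auto simp: L_def R_def facts intro!: exI[of _ 1])
  then have "inner_derivation B L (\<lambda>a. a)" "inner_derivation B R (\<lambda>a. a)"
    using contractible_imp_inner[OF con univ] Lb Rb by blast+
  then obtain r l where r: "r \<in> carrier B" "\<And>a. a \<in> carrier B \<Longrightarrow> a = a \<otimes>\<^bsub>B\<^esub> r"
    and l: "l \<in> carrier B" "\<And>a. a \<in> carrier B \<Longrightarrow> a = (- 1) \<odot>\<^bsub>B\<^esub> (l \<otimes>\<^bsub>B\<^esub> a)"
    unfolding inner_derivation_def by (auto simp: L_def R_def commutator_def facts)
  define l' where "l' = (- 1) \<odot>\<^bsub>B\<^esub> l"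
  have l': "l' \<in> carrier B" "\<And>a. a \<in> carrier B \<Longrightarrow> l' \<otimes>\<^bsub>B\<^esub> a = a"
    using l by (simp_all add: l'_def B.smult_mult_left)
  have "l' = r"
    using l'(2)[OF r(1)] r(2)[OF l'(1)] by simp
  then show ?thesis
    using that[of r] r l' by metis
qed

text \<open>
  This glues commutators along orthogonal pieces. If \<open>D\<close> vanishes at \<open>e\<close> and is the commutator with
  \<open>\<eta>\<close> at an element \<open>b\<close> orthogonal to \<open>e\<close>, then cutting \<open>\<eta>\<close> down by \<open>1 - e\<close> on both sides changes
  nothing at \<open>b\<close> and gives an element that commutes with everything supported by \<open>e\<close>.
\<close>

lemma (in banach_bimodule) commutator_cut:
  assumes D: "derivation B X D" and e: "e \<in> carrier B" "D e = \<zero>\<^bsub>X\<^esub>" and \<eta>: "\<eta> \<in> carrier X"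
    and \<zeta>: "\<zeta> = \<eta> \<oplus>\<^bsub>X\<^esub> (- 1) \<odot>\<^bsub>X\<^esub> lact X e \<eta>" and \<xi>: "\<xi> = \<zeta> \<oplus>\<^bsub>X\<^esub> (- 1) \<odot>\<^bsub>X\<^esub> ract X \<zeta> e"
  shows "\<xi> \<in> carrier X"
    "\<lbrakk>a \<in> carrier B; e \<otimes>\<^bsub>B\<^esub> a = a; a \<otimes>\<^bsub>B\<^esub> e = a\<rbrakk> \<Longrightarrow> commutator X \<xi> a = \<zero>\<^bsub>X\<^esub>"
    "\<lbrakk>b \<in> carrier B; e \<otimes>\<^bsub>B\<^esub> b = \<zero>\<^bsub>B\<^esub>; b \<otimes>\<^bsub>B\<^esub> e = \<zero>\<^bsub>B\<^esub>; D b = commutator X \<eta> b\<rbrakk> \<Longrightarrow> commutator X \<xi> b = D b"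
proof -
  have \<zeta>c: "\<zeta> \<in> carrier X"
    using e \<eta> by (simp add: \<zeta>)
  show \<xi>c: "\<xi> \<in> carrier X"
    using e \<zeta>c by (simp add: \<xi>)
  have Dl: "bounded_linear_map B X D"
    and Dm: "\<And>a b. \<lbrakk>a \<in> carrier B; b \<in> carrier B\<rbrakk> \<Longrightarrow> D (a \<otimes>\<^bsub>B\<^esub> b) = lact X a (D b) \<oplus>\<^bsub>X\<^esub> ract X (D a) b"
    using D unfolding derivation_def by auto
  note Ds = bounded_linear_mapD[OF Dl]
  have Dz: "D \<zero>\<^bsub>B\<^esub> = \<zero>\<^bsub>X\<^esub>"
    using Ds(3)[of "\<zero>\<^bsub>B\<^esub>" 0] Ds(1)[of "\<zero>\<^bsub>B\<^esub>"] by simp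
  show "commutator X \<xi> a = \<zero>\<^bsub>X\<^esub>" if a: "a \<in> carrier B" "e \<otimes>\<^bsub>B\<^esub> a = a" "a \<otimes>\<^bsub>B\<^esub> e = a"
  proof -
    have 1: "lact X a (lact X e \<eta>) = lact X a \<eta>"
      using lact_assoc[OF a(1) e(1) \<eta>] a(3) by simp
    have "lact X a \<zeta> = \<zero>\<^bsub>X\<^esub>"
      using a(1) e \<eta> by (simp add: \<zeta> lact_add lact_smult 1)
    then have l: "lact X a \<xi> = \<zero>\<^bsub>X\<^esub>"
      using a(1) e \<zeta>c by (simp add: \<xi> lact_add lact_smult lact_ract)
    have 2: "ract X (ract X \<zeta> e) a = ract X \<zeta> a"
      using ract_assoc[OF e(1) a(1) \<zeta>c] a(2) by simp
    have r: "ract X \<xi> a = \<zero>\<^bsub>X\<^esub>"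
      using a(1) e \<zeta>c by (simp add: \<xi> ract_add ract_smult 2)
    show ?thesis
      unfolding commutator_def l r by simp
  qed
  show "commutator X \<xi> b = D b"
    if b: "b \<in> carrier B" "e \<otimes>\<^bsub>B\<^esub> b = \<zero>\<^bsub>B\<^esub>" "b \<otimes>\<^bsub>B\<^esub> e = \<zero>\<^bsub>B\<^esub>" "D b = commutator X \<eta> b"
  proof -
    let ?l = "lact X b \<eta>" and ?r = "ract X \<eta> b"
    have c: "?l \<in> carrier X" "?r \<in> carrier X" "D b \<in> carrier X"
      using b(1) \<eta> Ds(1) by simp_all
    have "ract X (D b) e = \<zero>\<^bsub>X\<^esub>"
      using Dm[OF b(1) e(1)] b e c Dz by simp
    then have "ract X ?l e \<oplus>\<^bsub>X\<^esub> (- 1) \<odot>\<^bsub>X\<^esub> ract X ?r e = \<zero>\<^bsub>X\<^esub>"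
      unfolding b(4) commutator_def using c e by (simp add: ract_add ract_smult)
    moreover have "ract X ?r e = \<zero>\<^bsub>X\<^esub>"
      using ract_assoc[OF b(1) e(1) \<eta>] b(3) \<eta> by simp
    ultimately have le: "ract X ?l e = \<zero>\<^bsub>X\<^esub>"
      using c e by simp
    have "lact X e (D b) = \<zero>\<^bsub>X\<^esub>"
      using Dm[OF e(1) b(1)] b e c Dz by simp
    then have "lact X e ?l \<oplus>\<^bsub>X\<^esub> (- 1) \<odot>\<^bsub>X\<^esub> lact X e ?r = \<zero>\<^bsub>X\<^esub>"
      unfolding b(4) commutator_def using c e by (simp add: lact_add lact_smult)
    moreover have "lact X e ?l = \<zero>\<^bsub>X\<^esub>"
      using lact_assoc[OF e(1) b(1) \<eta>] b(2) \<eta> by simp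
    ultimately have "(- 1) \<odot>\<^bsub>X\<^esub> lact X e ?r = \<zero>\<^bsub>X\<^esub>"
      using c e by simp
    then have re: "lact X e ?r = \<zero>\<^bsub>X\<^esub>"
      using X.sm_sm[of "lact X e ?r" "- 1" "- 1"] c e by simp
    have "lact X b (lact X e \<eta>) = \<zero>\<^bsub>X\<^esub>"
      using lact_assoc[OF b(1) e(1) \<eta>] b(3) \<eta> by simp
    then have "lact X b \<zeta> = ?l"
      using b(1) e \<eta> by (simp add: \<zeta> lact_add lact_smult)
    then have l: "lact X b \<xi> = ?l"
      using b(1) e \<zeta>c c le by (simp add: \<xi> lact_add lact_smult lact_ract)
    have "ract X (ract X \<zeta> e) b = \<zero>\<^bsub>X\<^esub>"
      using ract_assoc[OF e(1) b(1) \<zeta>c] b(2) \<zeta>c by simp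
    then have "ract X \<xi> b = ract X \<zeta> b"
      using b(1) e \<zeta>c by (simp add: \<xi> ract_add ract_smult)
    also have "\<dots> = ?r"
      using b(1) e \<eta> re c by (simp add: \<zeta> ract_add ract_smult lact_ract[symmetric])
    finally show ?thesis
      unfolding commutator_def l b(4) by simp
  qed
qed

section \<open>The Banach algebra of a continuous field\<close>

lemma vanishes_at_infinity_mono:
  assumes "vanishes_at_infinity X f" "\<And>t. t \<in> topspace X \<Longrightarrow> \<bar>g t\<bar> \<le> \<bar>f t\<bar>"
  shows "vanishes_at_infinity X g"
  unfolding vanishes_at_infinity_def
proof (intro allI impI)
  fix \<epsilon> :: real assume "\<epsilon> > 0"
  then obtain K where K: "compactin X K" "\<forall>t \<in> topspace X - K. \<bar>f t\<bar> < \<epsilon>"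
    using assms(1) unfolding vanishes_at_infinity_def by blast
  then have "\<forall>t \<in> topspace X - K. \<bar>g t\<bar> < \<epsilon>"
    using assms(2) by (meson DiffD1 order_le_less_trans)
  then show "\<exists>K. compactin X K \<and> (\<forall>t \<in> topspace X - K. \<bar>g t\<bar> < \<epsilon>)"
    using K(1) by blast
qed

lemma vanishes_at_infinity_scale:
  assumes "vanishes_at_infinity X f"
  shows "vanishes_at_infinity X (\<lambda>t. c * f t)"
  unfolding vanishes_at_infinity_def
proof (intro allI impI)
  fix \<epsilon> :: real assume \<epsilon>: "\<epsilon> > 0"
  then have "\<epsilon> / (\<bar>c\<bar> + 1) > 0"
    by simp
  then obtain K where K: "compactin X K" "\<forall>t \<in> topspace X - K. \<bar>f t\<bar> < \<epsilon> / (\<bar>c\<bar> + 1)"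
    using assms unfolding vanishes_at_infinity_def by blast
  have "\<bar>c * f t\<bar> < \<epsilon>" if "t \<in> topspace X - K" for t
  proof -
    have "\<bar>c * f t\<bar> \<le> (\<bar>c\<bar> + 1) * \<bar>f t\<bar>"
      by (simp add: abs_mult algebra_simps)
    also have "\<dots> < \<epsilon>"
      using bspec[OF K(2) that] by (simp add: less_divide_eq mult.commute add_pos_nonneg)
    finally show ?thesis .
  qed
  then show "\<exists>K. compactin X K \<and> (\<forall>t \<in> topspace X - K. \<bar>c * f t\<bar> < \<epsilon>)"
    using K(1) by blast
qed

lemma vanishes_at_infinity_add:
  assumes "vanishes_at_infinity X f" "vanishes_at_infinity X g"
  shows "vanishes_at_infinity X (\<lambda>t. f t + g t)"
  unfolding vanishes_at_infinity_def
proof (intro allI impI)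
  fix \<epsilon> :: real assume "\<epsilon> > 0"
  then have "\<epsilon> / 2 > 0"
    by simp
  then obtain K L where K: "compactin X K" "\<forall>t \<in> topspace X - K. \<bar>f t\<bar> < \<epsilon> / 2"
    and L: "compactin X L" "\<forall>t \<in> topspace X - L. \<bar>g t\<bar> < \<epsilon> / 2"
    using assms unfolding vanishes_at_infinity_def by meson
  have "\<bar>f t + g t\<bar> < \<epsilon>" if "t \<in> topspace X - (K \<union> L)" for t
    using bspec[OF K(2), of t] bspec[OF L(2), of t] that by auto
  moreover have "compactin X (K \<union> L)"
    using K L by (simp add: compactin_Un)
  ultimately show "\<exists>K. compactin X K \<and> (\<forall>t \<in> topspace X - K. \<bar>f t + g t\<bar> < \<epsilon>)"
    by blast
qed

locale cts_field =
  fixes U :: "('t, 'a) banach_field"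
  assumes field: "continuous_field U"
begin

abbreviation T where "T \<equiv> topspace (base U)"
abbreviation F where "F \<equiv> fibre U"

lemma Hausdorff: "Hausdorff_space (base U)" and locally_compact: "locally_compact_space (base U)"
  and fibre_banach: "t \<in> T \<Longrightarrow> banach_algebra (F t)"
  using field unfolding continuous_field_def by auto

lemma fibre_space: "t \<in> T \<Longrightarrow> banach_space (F t)"
  using fibre_banach banach_algebra.axioms(1) by blast

lemma sections_PiE: "x \<in> sections U \<Longrightarrow> x \<in> (\<Pi>\<^sub>E t\<in>T. carrier (F t))"
  and sections_add: "\<lbrakk>x \<in> sections U; y \<in> sections U\<rbrakk> \<Longrightarrow> (\<lambda>t\<in>T. x t \<oplus>\<^bsub>F t\<^esub> y t) \<in> sections U"
  and sections_zero: "(\<lambda>t\<in>T. \<zero>\<^bsub>F t\<^esub>) \<in> sections U"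
  and sections_smult: "x \<in> sections U \<Longrightarrow> (\<lambda>t\<in>T. c \<odot>\<^bsub>F t\<^esub> x t) \<in> sections U"
proof -
  have sub: "submodule (sections U) complex_scalars (prod_struct T F)"
    using field unfolding continuous_field_def by blast
  interpret submodule "sections U" complex_scalars "prod_struct T F"
    by (fact sub)
  show "x \<in> (\<Pi>\<^sub>E t\<in>T. carrier (F t))" if "x \<in> sections U"
    using subset that by (auto simp: prod_struct_def)
  show "(\<lambda>t\<in>T. x t \<oplus>\<^bsub>F t\<^esub> y t) \<in> sections U" if "x \<in> sections U" "y \<in> sections U"
    using m_closed[OF that] by (simp add: prod_struct_def)
  show "(\<lambda>t\<in>T. \<zero>\<^bsub>F t\<^esub>) \<in> sections U"
    using one_closed by (simp add: prod_struct_def)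
  show "(\<lambda>t\<in>T. c \<odot>\<^bsub>F t\<^esub> x t) \<in> sections U" if "x \<in> sections U"
    using smult_closed[of c x] that by (simp add: prod_struct_def)
qed

lemma sections_carrier: "\<lbrakk>x \<in> sections U; t \<in> T\<rbrakk> \<Longrightarrow> x t \<in> carrier (F t)"
  using sections_PiE by (auto simp: PiE_iff)

lemma sections_mult:
  "\<lbrakk>x \<in> sections U; y \<in> sections U\<rbrakk> \<Longrightarrow> (\<lambda>t\<in>T. x t \<otimes>\<^bsub>F t\<^esub> y t) \<in> sections U"
  using field unfolding continuous_field_def by (simp add: prod_struct_def)

lemma sections_continuous:
  "x \<in> sections U \<Longrightarrow> continuous_map (base U) euclideanreal (\<lambda>t. nrm (F t) (x t))"
  using field unfolding continuous_field_def by blast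

lemma sections_complete:
  assumes "x \<in> (\<Pi>\<^sub>E t\<in>T. carrier (F t))"
    "\<And>t \<epsilon>. \<lbrakk>t \<in> T; \<epsilon> > 0\<rbrakk> \<Longrightarrow> \<exists>y\<in>sections U. \<exists>V. openin (base U) V \<and> t \<in> V \<and> (\<forall>s\<in>V. gap (F s) (x s) (y s) \<le> \<epsilon>)"
  shows "x \<in> sections U"
proof -
  have "locally_approximable (base U) F (sections U) x"
    unfolding locally_approximable_def
  proof (intro ballI allI impI)
    fix t and \<epsilon> :: real assume "t \<in> T" "\<epsilon> > 0"
    then obtain y V where y: "y \<in> sections U" "openin (base U) V" "t \<in> V" "\<forall>s\<in>V. gap (F s) (x s) (y s) \<le> \<epsilon>"
      using assms(2) by blast
    have "nrm (F s) (x s \<ominus>\<^bsub>F s\<^esub> y s) \<le> \<epsilon>" if "s \<in> V" for s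
    proof -
      have s: "s \<in> T"
        using openin_subset[OF y(2)] that by blast
      have "x s \<in> carrier (F s)"
        using assms(1) s by (auto simp: PiE_iff)
      then show ?thesis
        using banach_space.gap_eq_nrm[OF fibre_space[OF s], of "x s" "y s"] sections_carrier[OF y(1) s] bspec[OF y(4) that]
        by simp
    qed
    then show "\<exists>y\<in>sections U. \<exists>V. openin (base U) V \<and> t \<in> V \<and> (\<forall>s\<in>V. nrm (F s) (x s \<ominus>\<^bsub>F s\<^esub> y s) \<le> \<epsilon>)"
      using y by blast
  qed
  then show ?thesis
    using field assms(1) unfolding continuous_field_def by blast
qed

lemma sections_dense:
  assumes "t \<in> T" "c \<in> carrier (F t)" "\<epsilon> > 0"
  obtains x where "x \<in> sections U" "gap (F t) (x t) c < \<epsilon>"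
proof -
  interpret Ft: banach_space "F t"
    by (rule fibre_space[OF assms(1)])
  interpret Metric_space "carrier (F t)" "ndist (F t)"
    by (rule Ft.Metric_space_ndist)
  have "c \<in> mtopology closure_of {x t |x. x \<in> sections U}"
    using field assms(1,2) unfolding continuous_field_def by auto
  then obtain x where x: "x \<in> sections U" "x t \<in> mball c \<epsilon>"
    using assms(3) unfolding metric_closure_of by blast
  then have "gap (F t) (x t) c < \<epsilon>"
    using assms(2) Ft.gap_eq_nrm[of c "x t"] Ft.gap_commute[of c "x t"] by (auto simp: in_mball ndist_def split: if_splits)
  then show ?thesis
    using that x(1) by blast
qed

abbreviation A where "A \<equiv> field_algebra U"

lemma A_simps [simp]:
  "x \<oplus>\<^bsub>A\<^esub> y = (\<lambda>t\<in>T. x t \<oplus>\<^bsub>F t\<^esub> y t)"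
  "x \<otimes>\<^bsub>A\<^esub> y = (\<lambda>t\<in>T. x t \<otimes>\<^bsub>F t\<^esub> y t)"
  "c \<odot>\<^bsub>A\<^esub> x = (\<lambda>t\<in>T. c \<odot>\<^bsub>F t\<^esub> x t)"
  "\<zero>\<^bsub>A\<^esub> = (\<lambda>t\<in>T. \<zero>\<^bsub>F t\<^esub>)"
  by (simp_all add: field_algebra_def prod_struct_def)

lemma A_iff: "x \<in> carrier A \<longleftrightarrow> x \<in> sections U \<and> vanishes_at_infinity (base U) (\<lambda>t. nrm (F t) (x t))"
  by (simp add: field_algebra_def)

lemma A_carrier: "\<lbrakk>x \<in> carrier A; t \<in> T\<rbrakk> \<Longrightarrow> x t \<in> carrier (F t)"
  by (simp add: A_iff sections_carrier)

lemma A_extensional: "x \<in> carrier A \<Longrightarrow> x \<in> extensional T"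
  using sections_PiE by (auto simp: A_iff PiE_iff)

lemma A_eqI: "\<lbrakk>x \<in> extensional T; y \<in> extensional T; \<And>t. t \<in> T \<Longrightarrow> x t = y t\<rbrakk> \<Longrightarrow> x = y"
  by (rule extensionalityI)

lemma A_linf: "A = (linf T F)\<lparr>carrier := carrier A\<rparr>"
  by (simp add: field_algebra_def linf_def prod_struct_def)

lemma nrm_A: "nrm A x = nrm (linf T F) x"
  by (simp add: field_algebra_def linf_def prod_struct_def)

lemma A_subset_linf: "carrier A \<subseteq> carrier (linf T F)"
proof
  fix x assume x: "x \<in> carrier A"
  then have xs: "x \<in> sections U" "vanishes_at_infinity (base U) (\<lambda>t. nrm (F t) (x t))"
    by (simp_all add: A_iff)
  obtain K where K: "compactin (base U) K" "\<forall>t \<in> T - K. \<bar>nrm (F t) (x t)\<bar> < 1"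
    using xs(2) unfolding vanishes_at_infinity_def by (meson zero_less_one)
  have "compactin euclideanreal ((\<lambda>t. nrm (F t) (x t)) ` K)"
    by (rule image_compactin[OF K(1) sections_continuous[OF xs(1)]])
  then have "bounded ((\<lambda>t. nrm (F t) (x t)) ` K)"
    by (simp add: compact_imp_bounded)
  then obtain C where C: "\<And>t. t \<in> K \<Longrightarrow> \<bar>nrm (F t) (x t)\<bar> \<le> C"
    unfolding bounded_iff by auto
  have "nrm (F t) (x t) \<le> max C 1" if "t \<in> T" for t
    using C[of t] bspec[OF K(2), of t] that by (cases "t \<in> K") auto
  then show "x \<in> carrier (linf T F)"
    using sections_PiE[OF xs(1)] by auto
qed

lemma nrm_A_upper: "\<lbrakk>x \<in> carrier A; t \<in> T\<rbrakk> \<Longrightarrow> nrm (F t) (x t) \<le> nrm A x"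
  unfolding nrm_A using A_subset_linf by (intro nrm_linf_upper) auto

lemma A_add: "\<lbrakk>x \<in> carrier A; y \<in> carrier A\<rbrakk> \<Longrightarrow> x \<oplus>\<^bsub>A\<^esub> y \<in> carrier A"
proof -
  assume x: "x \<in> carrier A" and y: "y \<in> carrier A"
  have "vanishes_at_infinity (base U) (\<lambda>t. nrm (F t) (x t) + nrm (F t) (y t))"
    using x y by (intro vanishes_at_infinity_add) (simp_all add: A_iff)
  then have "vanishes_at_infinity (base U) (\<lambda>t. nrm (F t) ((x \<oplus>\<^bsub>A\<^esub> y) t))"
  proof (rule vanishes_at_infinity_mono)
    fix t assume t: "t \<in> T"
    interpret Ft: banach_space "F t"
      by (rule fibre_space[OF t])
    have xy: "x t \<in> carrier (F t)" "y t \<in> carrier (F t)"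
      using A_carrier x y t by auto
    show "\<bar>nrm (F t) ((x \<oplus>\<^bsub>A\<^esub> y) t)\<bar> \<le> \<bar>nrm (F t) (x t) + nrm (F t) (y t)\<bar>"
      using t xy Ft.nrm_triangle[OF xy] Ft.nrm_nonneg[OF Ft.M.a_closed[OF xy]] by simp
  qed
  then show ?thesis
    using x y sections_add by (simp add: A_iff)
qed

lemma A_smult: "x \<in> carrier A \<Longrightarrow> c \<odot>\<^bsub>A\<^esub> x \<in> carrier A"
proof -
  assume x: "x \<in> carrier A"
  have "vanishes_at_infinity (base U) (\<lambda>t. cmod c * nrm (F t) (x t))"
    using x by (intro vanishes_at_infinity_scale) (simp add: A_iff)
  then have "vanishes_at_infinity (base U) (\<lambda>t. nrm (F t) ((c \<odot>\<^bsub>A\<^esub> x) t))"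
    by (rule vanishes_at_infinity_mono)
      (simp add: banach_space.nrm_smult[OF fibre_space] A_carrier[OF x])
  then show ?thesis
    using x sections_smult by (simp add: A_iff)
qed

lemma A_zero: "\<zero>\<^bsub>A\<^esub> \<in> carrier A"
proof -
  have "vanishes_at_infinity (base U) (\<lambda>t. 0)"
    unfolding vanishes_at_infinity_def using compactin_empty by fastforce
  then have "vanishes_at_infinity (base U) (\<lambda>t. nrm (F t) (\<zero>\<^bsub>A\<^esub> t))"
    by (rule vanishes_at_infinity_mono) (simp add: banach_space.nrm_zero[OF fibre_space])
  then show ?thesis
    using sections_zero by (simp add: A_iff)
qed

lemma A_mult: "\<lbrakk>x \<in> carrier A; y \<in> carrier A\<rbrakk> \<Longrightarrow> x \<otimes>\<^bsub>A\<^esub> y \<in> carrier A"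
proof -
  assume x: "x \<in> carrier A" and y: "y \<in> carrier A"
  have "vanishes_at_infinity (base U) (\<lambda>t. nrm A x * nrm (F t) (y t))"
    using y by (intro vanishes_at_infinity_scale) (simp add: A_iff)
  then have "vanishes_at_infinity (base U) (\<lambda>t. nrm (F t) ((x \<otimes>\<^bsub>A\<^esub> y) t))"
  proof (rule vanishes_at_infinity_mono)
    fix t assume t: "t \<in> T"
    interpret Ft: banach_algebra "F t"
      by (rule fibre_banach[OF t])
    have xy: "x t \<in> carrier (F t)" "y t \<in> carrier (F t)"
      using A_carrier x y t by auto
    have "nrm (F t) (x t \<otimes>\<^bsub>F t\<^esub> y t) \<le> nrm (F t) (x t) * nrm (F t) (y t)"
      by (rule Ft.nrm_mult[OF xy])
    also have "\<dots> \<le> nrm A x * nrm (F t) (y t)"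
      by (intro mult_right_mono nrm_A_upper x t Ft.nrm_nonneg xy)
    finally show "\<bar>nrm (F t) ((x \<otimes>\<^bsub>A\<^esub> y) t)\<bar> \<le> \<bar>nrm A x * nrm (F t) (y t)\<bar>"
      using t Ft.nrm_nonneg[OF Ft.mult_closed[OF xy]] by simp
  qed
  then show ?thesis
    using x y sections_mult by (simp add: A_iff)
qed

text \<open>
  A uniform limit of sections is approximated near each point by a single section, so it is a section
  by the local completeness of a continuous field.
\<close>

lemma banach_space_A: "banach_space A"
proof (subst A_linf, rule banach_subspace)
  show lin: "banach_space (linf T F)"
    by (rule banach_space_linf[OF fibre_space])
  interpret L: banach_space "linf T F"
    by (fact lin)
  show "carrier A \<subseteq> carrier (linf T F)"
    by (rule A_subset_linf)
  show "\<zero>\<^bsub>linf T F\<^esub> \<in> carrier A"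
    using A_zero by simp
  show "x \<oplus>\<^bsub>linf T F\<^esub> y \<in> carrier A" if "x \<in> carrier A" "y \<in> carrier A" for x y
    using A_add[OF that] by simp
  show "c \<odot>\<^bsub>linf T F\<^esub> x \<in> carrier A" if "x \<in> carrier A" for c x
    using A_smult[OF that] by simp
  fix s l assume s: "\<And>n. s n \<in> carrier A" and l: "l \<in> carrier (linf T F)" and c: "converges (linf T F) s l"
  have lc: "l t \<in> carrier (F t)" if "t \<in> T" for t
    using l that by auto
  have approx: "\<exists>n. \<forall>t\<in>T. gap (F t) (l t) (s n t) \<le> \<epsilon>" if "\<epsilon> > 0" for \<epsilon>
  proof -
    obtain n where n: "norm (gap (linf T F) (s n) l - 0) < \<epsilon>"
      using LIMSEQ_D[OF c[unfolded converges_def] \<open>\<epsilon> > 0\<close>] by blast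
    have "gap (F t) (l t) (s n t) \<le> \<epsilon>" if t: "t \<in> T" for t
    proof -
      interpret Ft: banach_space "F t"
        by (rule fibre_space[OF t])
      have "s n \<oplus>\<^bsub>linf T F\<^esub> (- 1) \<odot>\<^bsub>linf T F\<^esub> l \<in> carrier (linf T F)"
        using A_subset_linf s l by (intro L.M.a_closed L.smult_mem) auto
      from nrm_linf_upper[OF this t] have "gap (F t) (s n t) (l t) \<le> gap (linf T F) (s n) l"
        using t by (simp add: gap_def)
      then show ?thesis
        using n Ft.gap_commute[OF lc[OF t] A_carrier[OF s t]] by simp
    qed
    then show ?thesis by blast
  qed
  have "l \<in> sections U"
  proof (rule sections_complete)
    show "l \<in> (\<Pi>\<^sub>E t\<in>T. carrier (F t))"
      using l by simp
    fix t and \<epsilon> :: real assume t: "t \<in> T" and "\<epsilon> > 0"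
    then obtain n where "\<forall>t\<in>T. gap (F t) (l t) (s n t) \<le> \<epsilon>"
      using approx by blast
    then show "\<exists>y\<in>sections U. \<exists>V. openin (base U) V \<and> t \<in> V \<and> (\<forall>s\<in>V. gap (F s) (l s) (y s) \<le> \<epsilon>)"
      using s[of n] t by (intro bexI[of _ "s n"] exI[of _ T]) (simp_all add: A_iff)
  qed
  moreover have "vanishes_at_infinity (base U) (\<lambda>t. nrm (F t) (l t))"
    unfolding vanishes_at_infinity_def
  proof (intro allI impI)
    fix \<epsilon> :: real assume "\<epsilon> > 0"
    then have \<epsilon>: "\<epsilon> / 2 > 0"
      by simp
    then obtain n where n: "\<forall>t\<in>T. gap (F t) (l t) (s n t) \<le> \<epsilon> / 2"
      using approx by blast
    obtain K where K: "compactin (base U) K" "\<forall>t\<in>T - K. \<bar>nrm (F t) (s n t)\<bar> < \<epsilon> / 2"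
      using s[of n] \<epsilon> unfolding A_iff vanishes_at_infinity_def by blast
    have "\<bar>nrm (F t) (l t)\<bar> < \<epsilon>" if t: "t \<in> T - K" for t
    proof -
      interpret Ft: banach_space "F t"
        using t by (intro fibre_space) simp
      have "nrm (F t) (l t) \<le> nrm (F t) (s n t) + gap (F t) (l t) (s n t)"
        using t lc A_carrier[OF s] by (intro Ft.nrm_le_gap) auto
      then show ?thesis
        using bspec[OF K(2) t] bspec[OF n, of t] t Ft.nrm_nonneg[of "l t"] lc[of t] by auto
    qed
    then show "\<exists>K. compactin (base U) K \<and> (\<forall>t\<in>T - K. \<bar>nrm (F t) (l t)\<bar> < \<epsilon>)"
      using K(1) by blast
  qed
  ultimately show "l \<in> carrier A"
    by (simp add: A_iff)
qed

lemma banach_algebra_A: "banach_algebra A"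
proof (intro banach_algebra.intro banach_algebra_axioms.intro banach_space_A A_mult)
  interpret As: banach_space A
    by (rule banach_space_A)
  fix x y assume x: "x \<in> carrier A" and y: "y \<in> carrier A"
  note xy = A_carrier[OF x] A_carrier[OF y]
  show "nrm A (x \<otimes>\<^bsub>A\<^esub> y) \<le> nrm A x * nrm A y"
    unfolding nrm_A[of "x \<otimes>\<^bsub>A\<^esub> y"]
  proof (rule nrm_linf_least)
    show "0 \<le> nrm A x * nrm A y"
      using As.nrm_nonneg x y by simp
    fix t assume t: "t \<in> T"
    interpret Ft: banach_algebra "F t"
      by (rule fibre_banach[OF t])
    have "nrm (F t) (x t \<otimes>\<^bsub>F t\<^esub> y t) \<le> nrm (F t) (x t) * nrm (F t) (y t)"
      by (intro Ft.nrm_mult xy t)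
    also have "\<dots> \<le> nrm A x * nrm A y"
      by (intro mult_mono nrm_A_upper x y t As.nrm_nonneg Ft.nrm_nonneg xy)
    finally show "nrm (F t) ((x \<otimes>\<^bsub>A\<^esub> y) t) \<le> nrm A x * nrm A y"
      using t by simp
  qed
  fix c
  show "(c \<odot>\<^bsub>A\<^esub> x) \<otimes>\<^bsub>A\<^esub> y = c \<odot>\<^bsub>A\<^esub> (x \<otimes>\<^bsub>A\<^esub> y)"
    by (rule A_eqI) (simp_all add: xy banach_algebra.smult_mult_left[OF fibre_banach])
  show "x \<otimes>\<^bsub>A\<^esub> (c \<odot>\<^bsub>A\<^esub> y) = c \<odot>\<^bsub>A\<^esub> (x \<otimes>\<^bsub>A\<^esub> y)"
    by (rule A_eqI) (simp_all add: xy banach_algebra.smult_mult_right[OF fibre_banach])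
  fix z assume z: "z \<in> carrier A"
  note xyz = xy A_carrier[OF z]
  show "(x \<otimes>\<^bsub>A\<^esub> y) \<otimes>\<^bsub>A\<^esub> z = x \<otimes>\<^bsub>A\<^esub> (y \<otimes>\<^bsub>A\<^esub> z)"
    by (rule A_eqI) (simp_all add: xyz banach_algebra.mult_assoc[OF fibre_banach])
  show "(x \<oplus>\<^bsub>A\<^esub> y) \<otimes>\<^bsub>A\<^esub> z = (x \<otimes>\<^bsub>A\<^esub> z) \<oplus>\<^bsub>A\<^esub> (y \<otimes>\<^bsub>A\<^esub> z)"
    by (rule A_eqI) (simp_all add: xyz banach_algebra.mult_distl[OF fibre_banach])
  show "x \<otimes>\<^bsub>A\<^esub> (y \<oplus>\<^bsub>A\<^esub> z) = (x \<otimes>\<^bsub>A\<^esub> y) \<oplus>\<^bsub>A\<^esub> (x \<otimes>\<^bsub>A\<^esub> z)"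
    by (rule A_eqI) (simp_all add: xyz banach_algebra.mult_distr[OF fibre_banach])
qed

lemma evaluation_hom:
  assumes t: "t \<in> T"
  shows "algebra_hom A (F t) (\<lambda>x. x t)"
  unfolding algebra_hom_def bounded_linear_map_def
  using A_carrier[OF _ t] nrm_A_upper[OF _ t] t by (auto intro!: exI[of _ 1])

subsection \<open>Cutting sections off\<close>

text \<open>
  Near \<open>t\<close> the product \<open>g x\<close> is uniformly close to the scalar multiple \<open>g(t) x\<close>, which is a section.
\<close>

lemma sections_scale:
  assumes x: "x \<in> sections U" and g: "continuous_map (base U) euclideanreal g"
  shows "(\<lambda>t\<in>T. complex_of_real (g t) \<odot>\<^bsub>F t\<^esub> x t) \<in> sections U"
proof (rule sections_complete)
  have cl: "c \<odot>\<^bsub>F t\<^esub> x t \<in> carrier (F t)" if "t \<in> T" for t c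
    using banach_space.smult_mem[OF fibre_space[OF that] sections_carrier[OF x that]] .
  then show "(\<lambda>t\<in>T. complex_of_real (g t) \<odot>\<^bsub>F t\<^esub> x t) \<in> (\<Pi>\<^sub>E t\<in>T. carrier (F t))"
    by auto
  fix t and \<epsilon> :: real assume t: "t \<in> T" and \<epsilon>: "\<epsilon> > 0"
  define h where "h s = \<bar>g s - g t\<bar> * nrm (F s) (x s)" for s
  have "continuous_map (base U) euclideanreal h"
    unfolding h_def
    by (intro continuous_map_real_mult continuous_map_real_abs continuous_map_diff g
        sections_continuous[OF x]) simp
  then have "openin (base U) {s \<in> T. h s \<in> {..<\<epsilon>}}"
    by (rule openin_continuous_map_preimage) simp
  moreover have "t \<in> {s \<in> T. h s \<in> {..<\<epsilon>}}"
    using t \<epsilon> by (simp add: h_def)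
  moreover have "gap (F s) ((\<lambda>t\<in>T. complex_of_real (g t) \<odot>\<^bsub>F t\<^esub> x t) s) ((\<lambda>s\<in>T. complex_of_real (g t) \<odot>\<^bsub>F s\<^esub> x s) s) \<le> \<epsilon>"
    if "s \<in> {s \<in> T. h s \<in> {..<\<epsilon>}}" for s
  proof -
    have s: "s \<in> T" "h s < \<epsilon>"
      using that by auto
    interpret Fs: banach_space "F s"
      by (rule fibre_space[OF s(1)])
    have xs: "x s \<in> carrier (F s)"
      by (rule sections_carrier[OF x s(1)])
    have "complex_of_real (g s) \<odot>\<^bsub>F s\<^esub> x s \<oplus>\<^bsub>F s\<^esub> (- 1) \<odot>\<^bsub>F s\<^esub> (complex_of_real (g t) \<odot>\<^bsub>F s\<^esub> x s) =
        complex_of_real (g s - g t) \<odot>\<^bsub>F s\<^esub> x s"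
      using xs by (simp add: Fs.sm_sm flip: Fs.sm_add)
    then have "gap (F s) (complex_of_real (g s) \<odot>\<^bsub>F s\<^esub> x s) (complex_of_real (g t) \<odot>\<^bsub>F s\<^esub> x s) = h s"
      unfolding gap_def h_def using Fs.nrm_smult[OF xs] by (simp only: norm_of_real)
    then show ?thesis
      using s by simp
  qed
  ultimately show "\<exists>y\<in>sections U. \<exists>V. openin (base U) V \<and> t \<in> V \<and>
      (\<forall>s\<in>V. gap (F s) ((\<lambda>t\<in>T. complex_of_real (g t) \<odot>\<^bsub>F t\<^esub> x t) s) (y s) \<le> \<epsilon>)"
    using sections_smult[OF x, of "complex_of_real (g t)"] by blast
qed

text \<open>
  Multiply \<open>x\<close> by a continuous function that is 1 at \<open>t\<close> and 0 on \<open>S\<close> and outside a compact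
  neighbourhood of \<open>t\<close>. The last condition makes the product vanish at infinity.
\<close>

lemma cut_off:
  assumes x: "x \<in> sections U" and t: "t \<in> T" and S: "closedin (base U) S" "t \<notin> S"
  obtains a where "a \<in> carrier A" "a t = x t" "\<And>s. s \<in> S \<Longrightarrow> a s = \<zero>\<^bsub>F s\<^esub>"
proof -
  obtain V K where VK: "openin (base U) V" "compactin (base U) K" "t \<in> V" "V \<subseteq> K"
    using locally_compact t unfolding locally_compact_space_def by blast
  have "completely_regular_space (base U)"
    using locally_compact_Hausdorff_imp_regular_space[OF locally_compact Hausdorff] locally_compact
    by (simp add: locally_compact_regular_imp_completely_regular_space)
  moreover have "closedin (base U) (S \<union> (T - V))" "t \<in> T - (S \<union> (T - V))"
    using S VK t by auto
  ultimately obtain f :: "'t \<Rightarrow> real" where f: "continuous_map (base U) (top_of_set {0..1}) f" "f t = 0"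
    "f ` (S \<union> (T - V)) \<subseteq> {1}"
    unfolding completely_regular_space_def by blast
  have fc: "continuous_map (base U) euclideanreal f"
    using f(1) by (simp add: continuous_map_in_subtopology)
  define a where "a = (\<lambda>s\<in>T. complex_of_real (1 - f s) \<odot>\<^bsub>F s\<^esub> x s)"
  have as: "a \<in> sections U"
    unfolding a_def by (intro sections_scale[OF x] continuous_map_diff fc) simp
  have ST: "S \<subseteq> T"
    using S(1) by (rule closedin_subset)
  have zero: "a s = \<zero>\<^bsub>F s\<^esub>" if "s \<in> S \<union> (T - V)" for s
  proof -
    have "s \<in> T" "f s = 1"
      using that ST f(3) by auto
    then show ?thesis
      using banach_space.sm_0[OF fibre_space sections_carrier[OF x]] by (simp add: a_def)
  qed
  have "vanishes_at_infinity (base U) (\<lambda>t. nrm (F t) (a t))"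
    unfolding vanishes_at_infinity_def
  proof (intro allI impI)
    fix \<epsilon> :: real assume "\<epsilon> > 0"
    have "\<bar>nrm (F t) (a t)\<bar> < \<epsilon>" if "t \<in> T - K" for t
    proof -
      have "a t = \<zero>\<^bsub>F t\<^esub>"
        using zero[of t] that VK(4) by blast
      then show ?thesis
        using banach_space.nrm_zero[OF fibre_space, of t] that \<open>\<epsilon> > 0\<close> by simp
    qed
    then have "\<forall>t\<in>T - K. \<bar>nrm (F t) (a t)\<bar> < \<epsilon>"
      by blast
    then show "\<exists>K. compactin (base U) K \<and> (\<forall>t\<in>T - K. \<bar>nrm (F t) (a t)\<bar> < \<epsilon>)"
      using VK(2) by blast
  qed
  then have "a \<in> carrier A"
    using as by (simp add: A_iff)
  moreover have "a t = x t"
    using t f(2) banach_space.sm_1[OF fibre_space sections_carrier[OF x]] by (simp add: a_def)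
  ultimately show ?thesis
    using that[of a] zero by blast
qed

lemma evaluation_dense:
  assumes t: "t \<in> T" and c: "c \<in> carrier (F t)" and "\<epsilon> > 0"
  shows "\<exists>a\<in>carrier A. gap (F t) (a t) c < \<epsilon>"
proof -
  obtain x where x: "x \<in> sections U" "gap (F t) (x t) c < \<epsilon>"
    using sections_dense[OF assms] by blast
  obtain a where a: "a \<in> carrier A" "a t = x t"
    using cut_off[OF x(1) t closedin_empty] by blast
  show ?thesis
    by (rule bexI[OF _ a(1)]) (simp only: a(2) x(2))
qed

end

section \<open>Contractibility forces a finite discrete base\<close>

lemma (in banach_algebra) bounded_linear_mult:
  assumes a: "a \<in> carrier A"
  shows "bounded_linear_map A A (\<lambda>x. a \<otimes> x)" "bounded_linear_map A A (\<lambda>x. x \<otimes> a)"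
proof -
  have "\<forall>x\<in>carrier A. nrm A (a \<otimes> x) \<le> nrm A a * nrm A x" "\<forall>x\<in>carrier A. nrm A (x \<otimes> a) \<le> nrm A a * nrm A x"
    using nrm_mult[OF a] nrm_mult[OF _ a] by (simp_all add: mult.commute[of "nrm A a"])
  then show "bounded_linear_map A A (\<lambda>x. a \<otimes> x)" "bounded_linear_map A A (\<lambda>x. x \<otimes> a)"
    unfolding bounded_linear_map_def
    using a by (auto simp: mult_closed mult_distl mult_distr smult_mult_left smult_mult_right)
qed

lemma bounded_linear_map_id: "bounded_linear_map E E (\<lambda>x. x)"
  unfolding bounded_linear_map_def by (auto intro: exI[of _ 1])

lemma (in banach_algebra) nrm_identity_ge_1:
  assumes e: "e \<in> carrier A" "\<And>x. x \<in> carrier A \<Longrightarrow> e \<otimes> x = x" and ne: "carrier A \<noteq> {\<zero>}"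
  shows "1 \<le> nrm A e"
proof -
  have "e \<noteq> \<zero>"
  proof
    assume e0: "e = \<zero>"
    have "x = \<zero>" if x: "x \<in> carrier A" for x
      using e(2)[OF x] x unfolding e0 by simp
    then show False
      using ne M.zero_closed by blast
  qed
  then have "nrm A e > 0"
    using nrm_nonneg[OF e(1)] nrm_eq_0[OF e(1)] by linarith
  moreover have "nrm A e \<le> nrm A e * nrm A e"
    using nrm_mult[OF e(1) e(1)] e by simp
  ultimately show ?thesis
    by simp
qed

context cts_field
begin

lemma identity_at:
  assumes e: "e \<in> carrier A" "\<And>a. a \<in> carrier A \<Longrightarrow> e \<otimes>\<^bsub>A\<^esub> a = a" and t: "t \<in> T" and c: "c \<in> carrier (F t)"
  shows "e t \<otimes>\<^bsub>F t\<^esub> c = c"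
proof -
  interpret Ft: banach_algebra "F t"
    by (rule fibre_banach[OF t])
  show ?thesis
  proof (rule banach_space_bounded_maps_agree[OF Ft.banach_space_axioms Ft.banach_space_axioms _ bounded_linear_map_id _ c])
    show "bounded_linear_map (F t) (F t) (\<lambda>x. e t \<otimes>\<^bsub>F t\<^esub> x)"
      by (rule Ft.bounded_linear_mult(1)[OF A_carrier[OF e(1) t]])
    fix \<epsilon> :: real assume "\<epsilon> > 0"
    then obtain a where a: "a \<in> carrier A" "gap (F t) (a t) c < \<epsilon>"
      using evaluation_dense[OF t c] by blast
    have "(e \<otimes>\<^bsub>A\<^esub> a) t = a t"
      using e(2)[OF a(1)] by simp
    then have "e t \<otimes>\<^bsub>F t\<^esub> a t = a t"
      using t by simp
    then show "\<exists>y\<in>carrier (F t). gap (F t) y c < \<epsilon> \<and> e t \<otimes>\<^bsub>F t\<^esub> y = y"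
      using a(2) A_carrier[OF a(1) t] by blast
  qed
qed

text \<open>
  Near \<open>t0\<close> all fibres are carried to one algebra \<open>A0\<close>. The functions to \<open>A0\<close> that tend to 0 at \<open>t0\<close>
  form a bimodule, where a section acts from the left by its value at \<open>t0\<close> and from the right by its
  values at the various points. The difference of these values is a derivation, namely the commutator
  with the constant function \<open>1\<close>, which does not belong to the module. If it is also the commutator
  with an element \<open>\<xi>\<close> of the module, then testing against a section that is \<open>1\<close> at \<open>t0\<close> and \<open>0\<close> at \<open>t\<close>
  yields \<open>\<xi>(t) = 1\<close>, for every \<open>t \<noteq> t0\<close>. Since \<open>\<xi>\<close> tends to 0 at \<open>t0\<close>, there are no such \<open>t\<close> near \<open>t0\<close>.
\<close>

lemma contractible_imp_isolated:
  fixes A0 :: "'a normed_struct"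
  assumes con: "contractible_algebra TYPE('u) A"
    and univ: "\<exists>h :: (nat \<Rightarrow> ('t \<Rightarrow> 'a) \<times> complex) \<Rightarrow> 'u. inj h"
    and t0: "t0 \<in> T" and nonzero: "carrier (F t0) \<noteq> {\<zero>\<^bsub>F t0\<^esub>}"
    and VW: "openin (base U) W" "t0 \<in> W" "W \<subseteq> V" "V \<subseteq> T"
    and A0: "banach_algebra A0" and iso: "\<And>t. t \<in> V \<Longrightarrow> isometric_algebra_iso (F t) A0 (\<phi> t)"
    and cont: "\<And>x \<epsilon>. \<lbrakk>x \<in> sections U; \<epsilon> > 0\<rbrakk> \<Longrightarrow>
      \<exists>N. openin (base U) N \<and> t0 \<in> N \<and> (\<forall>t\<in>N \<inter> V. gap A0 (\<phi> t0 (x t0)) (\<phi> t (x t)) < \<epsilon>)"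
  shows "openin (base U) {t0}"
proof -
  interpret A0: banach_algebra A0 by (fact A0)
  interpret As: banach_algebra A by (rule banach_algebra_A)
  interpret Ft0: banach_algebra "F t0" by (rule fibre_banach[OF t0])
  have t0V: "t0 \<in> V"
    using VW by blast
  have VT: "t \<in> T" if "t \<in> V" for t
    using that VW by blast
  define p where "p t a = \<phi> t (a t)" for t and a :: "'t \<Rightarrow> 'a"
  have p: "p t a \<in> carrier A0" "nrm A0 (p t a) \<le> nrm A a" "p t (c \<odot>\<^bsub>A\<^esub> a) = c \<odot>\<^bsub>A0\<^esub> p t a"
    "p t (a \<oplus>\<^bsub>A\<^esub> b) = p t a \<oplus>\<^bsub>A0\<^esub> p t b" "p t (a \<otimes>\<^bsub>A\<^esub> b) = p t a \<otimes>\<^bsub>A0\<^esub> p t b"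
    if "t \<in> V" "a \<in> carrier A" "b \<in> carrier A" for t a b c
  proof -
    have t: "t \<in> T" "a t \<in> carrier (F t)" "b t \<in> carrier (F t)"
      using VT A_carrier that by auto
    note i = iso[OF that(1), unfolded isometric_algebra_iso_def]
    show "p t a \<in> carrier A0"
      using i t(2) unfolding p_def bij_betw_def by blast
    have "nrm A0 (p t a) = nrm (F t) (a t)"
      using i t(2) unfolding p_def by blast
    then show "nrm A0 (p t a) \<le> nrm A a"
      using nrm_A_upper[OF that(2) t(1)] by simp
    show "p t (c \<odot>\<^bsub>A\<^esub> a) = c \<odot>\<^bsub>A0\<^esub> p t a" "p t (a \<oplus>\<^bsub>A\<^esub> b) = p t a \<oplus>\<^bsub>A0\<^esub> p t b"
      "p t (a \<otimes>\<^bsub>A\<^esub> b) = p t a \<otimes>\<^bsub>A0\<^esub> p t b"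
      using i t unfolding p_def by simp_all
  qed
  have pc: "p t a \<in> carrier A0" if "t \<in> V" "a \<in> carrier A" for t a
    using p(1)[OF that that(2)] .
  let ?L = "linf V (\<lambda>_. A0)"
  have Lb: "banach_space ?L"
    by (rule banach_space_linf) (rule A0.banach_space_axioms)
  interpret L: banach_space ?L by (fact Lb)
  define Z where "Z G \<longleftrightarrow> (\<forall>\<epsilon>>0. \<exists>N. openin (base U) N \<and> t0 \<in> N \<and> (\<forall>t\<in>N \<inter> V. nrm A0 (G t) \<le> \<epsilon>))" for G
  define C where "C = {G \<in> carrier ?L. Z G}"
  have Gc: "G t \<in> carrier A0" if "G \<in> C" "t \<in> V" for G t
    using that by (auto simp: C_def)
  have Gn: "nrm A0 (G t) \<le> nrm ?L G" if "G \<in> C" "t \<in> V" for G t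
    using that nrm_linf_upper[of G V "\<lambda>_. A0" t] by (simp add: C_def)
  have CI: "restrict H V \<in> C"
    if G: "G \<in> C" and K: "K \<ge> 0" and H: "\<And>t. t \<in> V \<Longrightarrow> H t \<in> carrier A0"
      "\<And>t. t \<in> V \<Longrightarrow> nrm A0 (H t) \<le> K * nrm A0 (G t)" for G H K
  proof -
    have "nrm A0 (H t) \<le> K * nrm ?L G" if "t \<in> V" for t
      using H(2)[OF that] mult_left_mono[OF Gn[OF G that] K] by linarith
    then have "restrict H V \<in> carrier ?L"
      using H(1) by auto
    moreover have "Z (restrict H V)"
      unfolding Z_def
    proof (intro allI impI)
      fix \<epsilon> :: real assume "\<epsilon> > 0"
      then have "\<epsilon> / (K + 1) > 0"
        using K by simp
      then obtain N where N: "openin (base U) N" "t0 \<in> N" "\<forall>t\<in>N \<inter> V. nrm A0 (G t) \<le> \<epsilon> / (K + 1)"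
        using G unfolding C_def Z_def by blast
      have "nrm A0 (restrict H V t) \<le> \<epsilon>" if t: "t \<in> N \<inter> V" for t
      proof -
        have tV: "t \<in> V"
          using t by simp
        have "nrm A0 (H t) \<le> K * nrm A0 (G t)"
          by (rule H(2)[OF tV])
        also have "\<dots> \<le> (K + 1) * nrm A0 (G t)"
          using A0.nrm_nonneg[OF Gc[OF G tV]] by (simp add: algebra_simps)
        also have "\<dots> \<le> \<epsilon>"
          using bspec[OF N(3) t] K by (simp add: le_divide_eq mult.commute)
        finally show ?thesis
          using tV by simp
      qed
      then show "\<exists>N. openin (base U) N \<and> t0 \<in> N \<and> (\<forall>t\<in>N \<inter> V. nrm A0 (restrict H V t) \<le> \<epsilon>)"
        using N by blast
    qed
    ultimately show ?thesis
      by (simp add: C_def)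
  qed
  have C0: "\<zero>\<^bsub>?L\<^esub> \<in> C"
  proof -
    have "Z \<zero>\<^bsub>?L\<^esub>"
      unfolding Z_def using VW(1,2) by (auto intro!: exI[of _ W])
    then show ?thesis
      using L.M.zero_closed unfolding C_def by blast
  qed
  have Cadd: "G \<oplus>\<^bsub>?L\<^esub> H \<in> C" if G: "G \<in> C" and H: "H \<in> C" for G H
  proof -
    have "Z (G \<oplus>\<^bsub>?L\<^esub> H)"
      unfolding Z_def
    proof (intro allI impI)
      fix \<epsilon> :: real assume "\<epsilon> > 0"
      then have \<epsilon>: "\<epsilon> / 2 > 0"
        by simp
      obtain N where N: "openin (base U) N" "t0 \<in> N" "\<forall>t\<in>N \<inter> V. nrm A0 (G t) \<le> \<epsilon> / 2"
        using G \<epsilon> unfolding C_def Z_def by blast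
      obtain N' where N': "openin (base U) N'" "t0 \<in> N'" "\<forall>t\<in>N' \<inter> V. nrm A0 (H t) \<le> \<epsilon> / 2"
        using H \<epsilon> unfolding C_def Z_def by blast
      have "nrm A0 ((G \<oplus>\<^bsub>?L\<^esub> H) t) \<le> \<epsilon>" if t: "t \<in> (N \<inter> N') \<inter> V" for t
      proof -
        have tV: "t \<in> V" and "nrm A0 (G t) \<le> \<epsilon> / 2" "nrm A0 (H t) \<le> \<epsilon> / 2"
          using t N(3) N'(3) by blast+
        then show ?thesis
          using A0.nrm_triangle[OF Gc[OF G tV] Gc[OF H tV]] by simp
      qed
      then show "\<exists>N. openin (base U) N \<and> t0 \<in> N \<and> (\<forall>t\<in>N \<inter> V. nrm A0 ((G \<oplus>\<^bsub>?L\<^esub> H) t) \<le> \<epsilon>)"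
        using N N' openin_Int by blast
    qed
    moreover have "G \<oplus>\<^bsub>?L\<^esub> H \<in> carrier ?L"
      using G H unfolding C_def by (intro L.M.a_closed) blast+
    ultimately show ?thesis
      unfolding C_def by blast
  qed
  have Csm: "c \<odot>\<^bsub>?L\<^esub> G \<in> C" if G: "G \<in> C" for c G
    unfolding linf_simps(4)
    by (rule CI[OF G norm_ge_zero[of c]]) (simp_all add: Gc[OF G] A0.nrm_smult)
  have Cb: "banach_space (?L\<lparr>carrier := C\<rparr>)"
  proof (rule banach_subspace[OF Lb _ C0 Cadd Csm])
    show "C \<subseteq> carrier ?L"
      unfolding C_def by blast
    fix s l assume s: "\<And>n. s n \<in> C" and l: "l \<in> carrier ?L" and c: "converges ?L s l"
    have "Z l"
      unfolding Z_def
    proof (intro allI impI)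
      fix \<epsilon> :: real assume "\<epsilon> > 0"
      then have \<epsilon>: "\<epsilon> / 2 > 0"
        by simp
      then obtain n where n: "norm (gap ?L (s n) l - 0) < \<epsilon> / 2"
        using LIMSEQ_D[OF c[unfolded converges_def] \<epsilon>] by blast
      obtain N where N: "openin (base U) N" "t0 \<in> N" "\<forall>t\<in>N \<inter> V. nrm A0 (s n t) \<le> \<epsilon> / 2"
        using s[of n] \<epsilon> unfolding C_def Z_def by blast
      have "nrm A0 (l t) \<le> \<epsilon>" if t: "t \<in> N \<inter> V" for t
      proof -
        have lt: "l t \<in> carrier A0" and st: "s n t \<in> carrier A0" and tV: "t \<in> V"
          using l t Gc[OF s] by auto
        have "s n \<oplus>\<^bsub>?L\<^esub> (- 1) \<odot>\<^bsub>?L\<^esub> l \<in> carrier ?L"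
          using s[of n] l unfolding C_def by (intro L.M.a_closed L.smult_mem) blast+
        from nrm_linf_upper[OF this tV] have "gap A0 (s n t) (l t) \<le> gap ?L (s n) l"
          using t by (simp add: gap_def)
        then have "gap A0 (l t) (s n t) \<le> \<epsilon> / 2"
          using n A0.gap_commute[OF lt st] by simp
        then show ?thesis
          using A0.nrm_le_gap[OF lt st] bspec[OF N(3) t] by simp
      qed
      then show "\<exists>N. openin (base U) N \<and> t0 \<in> N \<and> (\<forall>t\<in>N \<inter> V. nrm A0 (l t) \<le> \<epsilon>)"
        using N by blast
    qed
    then show "l \<in> C"
      using l unfolding C_def by blast
  qed
  define M :: "('t \<Rightarrow> 'a, 't \<Rightarrow> 'a) bimodule" where
    "M = \<lparr>carrier = C, mult = undefined, one = undefined, zero = zero ?L, add = add ?L, smult = smult ?L,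
       nrm = nrm ?L, lact = (\<lambda>a G. \<lambda>t\<in>V. p t0 a \<otimes>\<^bsub>A0\<^esub> G t), ract = (\<lambda>G a. \<lambda>t\<in>V. G t \<otimes>\<^bsub>A0\<^esub> p t a)\<rparr>"
  have Ms: "carrier M = C" "zero M = zero ?L" "add M = add ?L" "smult M = smult ?L" "nrm M = nrm ?L"
    "lact M = (\<lambda>a G. \<lambda>t\<in>V. p t0 a \<otimes>\<^bsub>A0\<^esub> G t)" "ract M = (\<lambda>G a. \<lambda>t\<in>V. G t \<otimes>\<^bsub>A0\<^esub> p t a)"
    by (simp_all add: M_def)
  have Mb: "banach_space M"
    by (rule banach_space_transfer[OF Cb, of id]) (simp_all add: Ms C0 Cadd Csm del: linf_simps)
  have ln: "nrm A0 (p t0 a \<otimes>\<^bsub>A0\<^esub> x) \<le> nrm A a * nrm A0 x" if "a \<in> carrier A" "x \<in> carrier A0" for a x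
    using A0.nrm_mult[OF pc[OF t0V that(1)] that(2)]
      mult_right_mono[OF p(2)[OF t0V that(1,1)] A0.nrm_nonneg[OF that(2)]] by linarith
  have rn: "nrm A0 (x \<otimes>\<^bsub>A0\<^esub> p t a) \<le> nrm A a * nrm A0 x" if "a \<in> carrier A" "x \<in> carrier A0" "t \<in> V" for a x t
    using A0.nrm_mult[OF that(2) pc[OF that(3,1)]]
      mult_left_mono[OF p(2)[OF that(3,1,1)] A0.nrm_nonneg[OF that(2)]] by (simp add: mult.commute)
  have Mbi: "banach_bimodule A M"
  proof (intro banach_bimodule.intro banach_bimodule_axioms.intro banach_algebra_A Mb)
    show "\<exists>K. \<forall>a\<in>carrier A. \<forall>x\<in>carrier M. nrm M (lact M a x) \<le> K * nrm A a * nrm M x \<and>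
        nrm M (ract M x a) \<le> K * nrm A a * nrm M x"
    proof (intro exI[of _ 1] ballI conjI)
      fix a G assume a: "a \<in> carrier A" and "G \<in> carrier M"
      then have G: "G \<in> C"
        by (simp add: Ms)
      have k: "0 \<le> 1 * nrm A a * nrm ?L G"
        using As.nrm_nonneg[OF a] nrm_linf_nonneg[of G V "\<lambda>_. A0"] G by (simp add: C_def)
      have le: "nrm A a * nrm A0 (G t) \<le> 1 * nrm A a * nrm ?L G" if "t \<in> V" for t
        using mult_left_mono[OF Gn[OF G that] As.nrm_nonneg[OF a]] by simp
      show "nrm M (lact M a G) \<le> 1 * nrm A a * nrm M G"
        unfolding Ms using ln[OF a Gc[OF G]] le by (intro nrm_linf_least[OF k]) (auto intro: order_trans)
      show "nrm M (ract M G a) \<le> 1 * nrm A a * nrm M G"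
        unfolding Ms using rn[OF a Gc[OF G]] le by (intro nrm_linf_least[OF k]) (auto intro: order_trans)
    qed
    fix a G assume a: "a \<in> carrier A" and "G \<in> carrier M"
    then have G: "G \<in> C"
      by (simp add: Ms)
    show "lact M a G \<in> carrier M"
      unfolding Ms
      by (rule CI[OF G As.nrm_nonneg[OF a]]) (simp_all add: ln a A0.mult_closed pc t0V Gc[OF G])
    show "ract M G a \<in> carrier M"
      unfolding Ms
      by (rule CI[OF G As.nrm_nonneg[OF a]]) (simp_all add: rn a A0.mult_closed pc Gc[OF G])
    fix c
    show "lact M a (c \<odot>\<^bsub>M\<^esub> G) = c \<odot>\<^bsub>M\<^esub> lact M a G"
      by (rule extensionalityI[of _ V]) (simp_all add: Ms A0.smult_mult_right pc a t0V Gc[OF G])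
    show "lact M (c \<odot>\<^bsub>A\<^esub> a) G = c \<odot>\<^bsub>M\<^esub> lact M a G"
      by (rule extensionalityI[of _ V])
        (simp_all add: Ms A0.smult_mult_left p[OF _ a a] t0V Gc[OF G] del: A_simps)
    show "ract M (c \<odot>\<^bsub>M\<^esub> G) a = c \<odot>\<^bsub>M\<^esub> ract M G a"
      by (rule extensionalityI[of _ V]) (simp_all add: Ms A0.smult_mult_left pc a t0V Gc[OF G])
    show "ract M G (c \<odot>\<^bsub>A\<^esub> a) = c \<odot>\<^bsub>M\<^esub> ract M G a"
      by (rule extensionalityI[of _ V])
        (simp_all add: Ms A0.smult_mult_right p[OF _ a a] t0V Gc[OF G] del: A_simps)
  next
    fix a G H assume a: "a \<in> carrier A" and "G \<in> carrier M" "H \<in> carrier M"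
    then have GH: "G \<in> C" "H \<in> C"
      by (simp_all add: Ms)
    show "lact M a (G \<oplus>\<^bsub>M\<^esub> H) = lact M a G \<oplus>\<^bsub>M\<^esub> lact M a H"
      by (rule extensionalityI[of _ V]) (simp_all add: Ms A0.mult_distr pc a t0V Gc GH)
    show "ract M (G \<oplus>\<^bsub>M\<^esub> H) a = ract M G a \<oplus>\<^bsub>M\<^esub> ract M H a"
      by (rule extensionalityI[of _ V]) (simp_all add: Ms A0.mult_distl pc a t0V Gc GH)
  next
    fix a b G assume ab: "a \<in> carrier A" "b \<in> carrier A" and "G \<in> carrier M"
    then have G: "G \<in> C"
      by (simp add: Ms)
    show "lact M (a \<oplus>\<^bsub>A\<^esub> b) G = lact M a G \<oplus>\<^bsub>M\<^esub> lact M b G"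
      by (rule extensionalityI[of _ V])
        (simp_all add: Ms A0.mult_distl p[OF _ ab] pc ab t0V Gc[OF G] del: A_simps)
    show "ract M G (a \<oplus>\<^bsub>A\<^esub> b) = ract M G a \<oplus>\<^bsub>M\<^esub> ract M G b"
      by (rule extensionalityI[of _ V])
        (simp_all add: Ms A0.mult_distr p[OF _ ab] pc ab t0V Gc[OF G] del: A_simps)
    show "lact M (a \<otimes>\<^bsub>A\<^esub> b) G = lact M a (lact M b G)"
      by (rule extensionalityI[of _ V])
        (simp_all add: Ms A0.mult_assoc p[OF _ ab] pc ab t0V Gc[OF G] del: A_simps)
    show "ract M G (a \<otimes>\<^bsub>A\<^esub> b) = ract M (ract M G a) b"
      by (rule extensionalityI[of _ V])
        (simp_all add: Ms A0.mult_assoc p[OF _ ab] pc ab t0V Gc[OF G] del: A_simps)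
    show "lact M a (ract M G b) = ract M (lact M a G) b"
      by (rule extensionalityI[of _ V]) (simp_all add: Ms A0.mult_assoc pc ab t0V Gc[OF G])
  qed
  define D where "D a = (\<lambda>t\<in>V. p t0 a \<oplus>\<^bsub>A0\<^esub> (- 1) \<odot>\<^bsub>A0\<^esub> p t a)" for a
  have Dn: "nrm A0 (p t0 a \<oplus>\<^bsub>A0\<^esub> (- 1) \<odot>\<^bsub>A0\<^esub> p t a) \<le> 2 * nrm A a" if "a \<in> carrier A" "t \<in> V" for a t
    using A0.nrm_triangle[of "p t0 a" "(- 1) \<odot>\<^bsub>A0\<^esub> p t a"] A0.nrm_smult[of "p t a" "- 1"]
      p(2)[OF t0V that(1,1)] p(2)[OF that(2,1,1)] pc[OF t0V that(1)] pc[OF that(2,1)] by simp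
  have DC: "D a \<in> C" if a: "a \<in> carrier A" for a
  proof -
    have "Z (D a)"
      unfolding Z_def
    proof (intro allI impI)
      fix \<epsilon> :: real assume "\<epsilon> > 0"
      then obtain N where N: "openin (base U) N" "t0 \<in> N" "\<forall>t\<in>N \<inter> V. gap A0 (\<phi> t0 (a t0)) (\<phi> t (a t)) < \<epsilon>"
        using cont[of a \<epsilon>] a unfolding A_iff by blast
      have "nrm A0 (D a t) \<le> \<epsilon>" if "t \<in> N \<inter> V" for t
        using bspec[OF N(3) that] that by (simp add: D_def p_def gap_def)
      then show "\<exists>N. openin (base U) N \<and> t0 \<in> N \<and> (\<forall>t\<in>N \<inter> V. nrm A0 (D a t) \<le> \<epsilon>)"
        using N by blast
    qed
    moreover have "D a \<in> carrier ?L"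
      using a pc t0V Dn[OF a] by (auto simp: D_def)
    ultimately show ?thesis
      unfolding C_def by blast
  qed
  have "derivation A M D"
    unfolding derivation_def bounded_linear_map_def
  proof (intro conjI ballI allI)
    show "D \<in> carrier A \<rightarrow> carrier M"
      using DC by (simp add: Ms)
    have "nrm M (D a) \<le> 2 * nrm A a" if a: "a \<in> carrier A" for a
      unfolding Ms using As.nrm_nonneg[OF a] Dn[OF a] by (intro nrm_linf_least) (simp_all add: D_def)
    then show "\<exists>K. \<forall>a\<in>carrier A. nrm M (D a) \<le> K * nrm A a"
      by blast
    fix a b assume ab: "a \<in> carrier A" "b \<in> carrier A"
    note pab = p[OF _ ab] pc[OF _ ab(1)] pc[OF _ ab(2)]
    show "D (a \<oplus>\<^bsub>A\<^esub> b) = D a \<oplus>\<^bsub>M\<^esub> D b"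
      by (rule extensionalityI[of _ V])
        (simp_all add: Ms D_def pab t0V A0.sm_plus A0.M.a_ac del: A_simps)
    show "D (a \<otimes>\<^bsub>A\<^esub> b) = lact M a (D b) \<oplus>\<^bsub>M\<^esub> ract M (D a) b"
      by (rule extensionalityI[of _ V])
        (simp_all add: Ms D_def pab t0V A0.mult_closed A0.mult_distl A0.mult_distr A0.smult_mult_left
          A0.smult_mult_right A0.M.a_assoc del: A_simps)
  next
    fix a c assume a: "a \<in> carrier A"
    show "D (c \<odot>\<^bsub>A\<^esub> a) = c \<odot>\<^bsub>M\<^esub> D a"
      by (rule extensionalityI[of _ V])
        (simp_all add: Ms D_def p[OF _ a a] pc[OF _ a] t0V A0.sm_plus A0.sm_sm mult.commute del: A_simps)
  qed
  from contractible_imp_inner[OF con univ Mbi this] obtain \<xi> where \<xi>: "\<xi> \<in> C"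
    "\<And>a. a \<in> carrier A \<Longrightarrow> D a = commutator M \<xi> a"
    unfolding inner_derivation_def Ms by blast
  obtain e where e: "e \<in> carrier A" "\<And>a. a \<in> carrier A \<Longrightarrow> e \<otimes>\<^bsub>A\<^esub> a = a"
    using contractible_imp_identity[OF con univ banach_algebra_A] by metis
  have es: "e \<in> sections U"
    using e(1) by (simp add: A_iff)
  have one: "e t0 \<otimes>\<^bsub>F t0\<^esub> c = c" if "c \<in> carrier (F t0)" for c
    by (rule identity_at[OF e t0 that])
  have et0: "e t0 \<in> carrier (F t0)"
    by (rule A_carrier[OF e(1) t0])
  define E where "E = p t0 e"
  have Ec: "E \<in> carrier A0"
    unfolding E_def by (rule pc[OF t0V e(1)])
  note i0 = iso[OF t0V, unfolded isometric_algebra_iso_def]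
  have "nrm A0 E = nrm (F t0) (e t0)"
    using i0 et0 unfolding E_def p_def by blast
  then have E1: "1 \<le> nrm A0 E"
    using Ft0.nrm_identity_ge_1[OF et0 one nonzero] by simp
  have Eone: "E \<otimes>\<^bsub>A0\<^esub> c = c" if c: "c \<in> carrier A0" for c
  proof -
    have "\<phi> t0 ` carrier (F t0) = carrier A0"
      using i0 by (simp add: bij_betw_def)
    then obtain c' where c': "c' \<in> carrier (F t0)" "c = \<phi> t0 c'"
      using c by (metis imageE)
    have "\<phi> t0 (e t0 \<otimes>\<^bsub>F t0\<^esub> c') = \<phi> t0 (e t0) \<otimes>\<^bsub>A0\<^esub> \<phi> t0 c'"
      using i0 et0 c'(1) by blast
    then show ?thesis
      unfolding one[OF c'(1)] E_def p_def c'(2) by simp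
  qed
  have \<xi>1: "\<xi> t = E" if t: "t \<in> V" "t \<noteq> t0" for t
  proof -
    have tT: "t \<in> T"
      by (rule VT[OF t(1)])
    have "closedin (base U) {t}"
      using closedin_Hausdorff_sing_eq[OF Hausdorff] tT by blast
    then obtain a where a: "a \<in> carrier A" "a t0 = e t0" "a t = \<zero>\<^bsub>F t\<^esub>"
      using cut_off[OF es t0, of "{t}"] t(2) by (metis singletonD singletonI)
    have p0: "p t0 a = E"
      by (simp add: p_def E_def a(2))
    have "p t a = \<phi> t (0 \<odot>\<^bsub>F t\<^esub> a t)"
      using banach_space.sm_zero[OF fibre_space[OF tT]] by (simp add: p_def a(3))
    also have "\<dots> = 0 \<odot>\<^bsub>A0\<^esub> p t a"
      using iso[OF t(1)] A_carrier[OF a(1) tT] unfolding isometric_algebra_iso_def p_def by blast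
    finally have pt: "p t a = \<zero>\<^bsub>A0\<^esub>"
      using A0.sm_0[OF pc[OF t(1) a(1)]] by simp
    have "D a t = commutator M \<xi> a t"
      using \<xi>(2)[OF a(1)] by simp
    then have "E = E \<otimes>\<^bsub>A0\<^esub> \<xi> t"
      using t(1) Ec Gc[OF \<xi>(1) t(1)] A0.mult_closed[OF Ec Gc[OF \<xi>(1) t(1)]]
      by (simp add: D_def commutator_def Ms p0 pt)
    then show ?thesis
      using Eone[OF Gc[OF \<xi>(1) t(1)]] by simp
  qed
  have "Z \<xi>"
    using \<xi>(1) unfolding C_def by blast
  then have "\<exists>N. openin (base U) N \<and> t0 \<in> N \<and> (\<forall>t\<in>N \<inter> V. nrm A0 (\<xi> t) \<le> 1 / 2)"
    unfolding Z_def by (elim allE[of _ "1 / 2"]) simp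
  then obtain N where N: "openin (base U) N" "t0 \<in> N" "\<forall>t\<in>N \<inter> V. nrm A0 (\<xi> t) \<le> 1 / 2"
    by blast
  have "N \<inter> W = {t0}"
  proof
    show "N \<inter> W \<subseteq> {t0}"
    proof
      fix t assume t: "t \<in> N \<inter> W"
      then have "nrm A0 (\<xi> t) \<le> 1 / 2" "t \<in> V"
        using N(3) VW(3) by blast+
      then show "t \<in> {t0}"
        using \<xi>1[of t] E1 by (cases "t = t0") auto
    qed
  qed (use N VW in blast)
  then show ?thesis
    using openin_Int[OF N(1) VW(1)] by simp
qed

text \<open>
  The restriction of a section to \<open>V\<close> is a section of the induced field, and the isomorphism with a
  constant field takes it to a continuous function.
\<close>

lemma trivialization:
  assumes V: "V \<subseteq> T" and triv: "trivial_field (restrict_field U V)"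
  obtains A0 :: "'a normed_struct" and \<phi> where "banach_algebra A0"
    "\<And>t. t \<in> V \<Longrightarrow> isometric_algebra_iso (F t) A0 (\<phi> t)"
    "\<And>x t0 \<epsilon>. \<lbrakk>x \<in> sections U; t0 \<in> V; \<epsilon> > 0\<rbrakk> \<Longrightarrow>
      \<exists>N. openin (base U) N \<and> t0 \<in> N \<and> (\<forall>t\<in>N \<inter> V. gap A0 (\<phi> t0 (x t0)) (\<phi> t (x t)) < \<epsilon>)"
proof -
  let ?R = "restrict_field U V"
  have bR: "base ?R = subtopology (base U) V" "topspace (base ?R) = V" "fibre ?R = F"
    using V by (auto simp: restrict_field_def)
  have tV: "topspace (subtopology (base U) V) = V"
    using V by auto
  obtain A0 :: "'a normed_struct" and \<phi> where A0: "banach_algebra A0"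
    and iso: "field_iso ?R (constant_field (base ?R) A0) \<phi>"
    using triv unfolding trivial_field_def by blast
  interpret A0: banach_algebra A0 by (fact A0)
  interpret A0m: Metric_space "carrier A0" "ndist A0"
    by (rule A0.Metric_space_ndist)
  have isoV: "isometric_algebra_iso (F t) A0 (\<phi> t)" if "t \<in> V" for t
    using iso that unfolding field_iso_def bR(2,3) constant_field_def by simp
  have "\<exists>N. openin (base U) N \<and> t0 \<in> N \<and> (\<forall>t\<in>N \<inter> V. gap A0 (\<phi> t0 (x t0)) (\<phi> t (x t)) < \<epsilon>)"
    if x: "x \<in> sections U" and t0: "t0 \<in> V" and \<epsilon>: "\<epsilon> > 0" for x t0 \<epsilon>
  proof -
    have xc: "x t \<in> carrier (F t)" if "t \<in> V" for t
      using sections_carrier[OF x] that V by blast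
    have "locally_approximable (subtopology (base U) V) F (sections U) (restrict x V)"
      unfolding locally_approximable_def
    proof (intro ballI allI impI)
      fix t and \<delta> :: real assume t: "t \<in> topspace (subtopology (base U) V)" and \<delta>: "\<delta> > 0"
      have "nrm (F s) (restrict x V s \<ominus>\<^bsub>F s\<^esub> x s) \<le> \<delta>" if s: "s \<in> V" for s
      proof -
        interpret Fs: banach_space "F s"
          using s V by (intro fibre_space) blast
        show ?thesis
          using s xc[OF s] \<delta> by (simp add: Fs.minus_eq_sm)
      qed
      moreover have "openin (subtopology (base U) V) V"
        using openin_topspace[of "subtopology (base U) V"] V by (simp add: Int_absorb1)
      ultimately show "\<exists>y\<in>sections U. \<exists>W. openin (subtopology (base U) V) W \<and> t \<in> W \<and>
          (\<forall>s\<in>W. nrm (F s) (restrict x V s \<ominus>\<^bsub>F s\<^esub> y s) \<le> \<delta>)"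
        using x t by auto
    qed
    then have "restrict x V \<in> sections ?R"
      using xc by (auto simp: restrict_field_def)
    then have "(\<lambda>t\<in>V. \<phi> t (restrict x V t)) \<in> sections (constant_field (base ?R) A0)"
      using iso unfolding field_iso_def bR(1) tV by blast
    then have "continuous_map (subtopology (base U) V) A0m.mtopology (\<lambda>t\<in>V. \<phi> t (restrict x V t))"
      unfolding bR(1) by (simp add: constant_field_def)
    moreover have "t0 \<in> topspace (subtopology (base U) V)"
      using t0 V by auto
    ultimately obtain W where W: "openin (subtopology (base U) V) W" "t0 \<in> W"
      "\<forall>t\<in>W. (\<lambda>t\<in>V. \<phi> t (restrict x V t)) t \<in> A0m.mball ((\<lambda>t\<in>V. \<phi> t (restrict x V t)) t0) \<epsilon>"
      using \<epsilon> unfolding A0m.continuous_map_to_metric by blast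
    obtain N where N: "openin (base U) N" "W = N \<inter> V"
      using W(1) unfolding openin_subtopology by blast
    have "gap A0 (\<phi> t0 (x t0)) (\<phi> t (x t)) < \<epsilon>" if t: "t \<in> N \<inter> V" for t
      using bspec[OF W(3), of t] t t0 A0.gap_eq_nrm[of "\<phi> t0 (x t0)" "\<phi> t (x t)"] N(2)
      by (auto simp: A0m.in_mball ndist_def split: if_splits)
    then show ?thesis
      using N W(2) by blast
  qed
  then show ?thesis
    using that[OF A0 isoV] by blast
qed

end

lemma (in banach_bimodule) derivation_diff:
  assumes D: "derivation B X D" and E: "derivation B X E"
  shows "derivation B X (\<lambda>a. D a \<oplus>\<^bsub>X\<^esub> (- 1) \<odot>\<^bsub>X\<^esub> E a)"
proof -
  have Dl: "bounded_linear_map B X D"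
    and Dm: "\<And>a b. \<lbrakk>a \<in> carrier B; b \<in> carrier B\<rbrakk> \<Longrightarrow> D (a \<otimes>\<^bsub>B\<^esub> b) = lact X a (D b) \<oplus>\<^bsub>X\<^esub> ract X (D a) b"
    using D unfolding derivation_def by auto
  have El: "bounded_linear_map B X E"
    and Em: "\<And>a b. \<lbrakk>a \<in> carrier B; b \<in> carrier B\<rbrakk> \<Longrightarrow> E (a \<otimes>\<^bsub>B\<^esub> b) = lact X a (E b) \<oplus>\<^bsub>X\<^esub> ract X (E a) b"
    using E unfolding derivation_def by auto
  note Ds = bounded_linear_mapD[OF Dl] and Es = bounded_linear_mapD[OF El]
  obtain K where K: "K \<ge> 0" "\<And>a. a \<in> carrier B \<Longrightarrow> nrm X (D a) \<le> K * nrm B a"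
    using bounded_linear_map_bound[OF Dl B.banach_space_axioms] by blast
  obtain L where L: "L \<ge> 0" "\<And>a. a \<in> carrier B \<Longrightarrow> nrm X (E a) \<le> L * nrm B a"
    using bounded_linear_map_bound[OF El B.banach_space_axioms] by blast
  show ?thesis
    unfolding derivation_def bounded_linear_map_def
  proof (intro conjI ballI allI)
    show "(\<lambda>a. D a \<oplus>\<^bsub>X\<^esub> (- 1) \<odot>\<^bsub>X\<^esub> E a) \<in> carrier B \<rightarrow> carrier X"
      using Ds(1) Es(1) by simp
    have "nrm X (D a \<oplus>\<^bsub>X\<^esub> (- 1) \<odot>\<^bsub>X\<^esub> E a) \<le> (K + L) * nrm B a" if a: "a \<in> carrier B" for a
      using X.nrm_triangle[of "D a" "(- 1) \<odot>\<^bsub>X\<^esub> E a"] X.nrm_smult[of "E a" "- 1"] K(2)[OF a] L(2)[OF a]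
        Ds(1)[OF a] Es(1)[OF a] by (simp add: algebra_simps)
    then show "\<exists>C. \<forall>a\<in>carrier B. nrm X (D a \<oplus>\<^bsub>X\<^esub> (- 1) \<odot>\<^bsub>X\<^esub> E a) \<le> C * nrm B a"
      by blast
  qed (simp_all add: Ds Es Dm Em B.mult_closed lact_add ract_add lact_smult ract_smult X.sm_plus X.sm_sm
      X.M.a_ac mult.commute)
qed

context cts_field
begin

text \<open>
  The identity of the algebra has norm at least 1 at each point and vanishes at infinity, so the base
  is compact. All its points are isolated, so it is finite. The algebra has dense image in each fibre.
\<close>

lemma contractible_imp_finite_discrete:
  assumes con: "contractible_algebra TYPE('u) A"
    and univ: "\<exists>h :: (nat \<Rightarrow> ('t \<Rightarrow> 'a) \<times> complex) \<Rightarrow> 'u. inj h"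
    and loc_triv: "locally_trivial U"
    and nonzero: "\<And>t. t \<in> T \<Longrightarrow> carrier (F t) \<noteq> {\<zero>\<^bsub>F t\<^esub>}"
  shows "finite T" "base U = discrete_topology T" "\<And>t. t \<in> T \<Longrightarrow> contractible_algebra TYPE('u) (F t)"
proof -
  show "contractible_algebra TYPE('u) (F t)" if t: "t \<in> T" for t
    by (rule contractible_dense_image[OF con univ banach_algebra_A fibre_banach[OF t] evaluation_hom[OF t]])
      (rule evaluation_dense[OF t])
  have "openin (base U) {t}" if t: "t \<in> T" for t
  proof -
    have "\<exists>W V. openin (base U) W \<and> t \<in> W \<and> W \<subseteq> V \<and> V \<subseteq> T \<and> trivial_field (restrict_field U V)"
      by (rule bspec[OF loc_triv[unfolded locally_trivial_def] t])
    then obtain W V where VW: "openin (base U) W" "t \<in> W" "W \<subseteq> V" "V \<subseteq> T" "trivial_field (restrict_field U V)"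
      by metis
    have tV: "t \<in> V"
      using VW by blast
    show ?thesis
    proof (rule trivialization[OF VW(4,5)])
      fix A0 :: "'a normed_struct" and \<phi>
      assume A0: "banach_algebra A0" "\<And>t. t \<in> V \<Longrightarrow> isometric_algebra_iso (F t) A0 (\<phi> t)"
        "\<And>x t0 \<epsilon>. \<lbrakk>x \<in> sections U; t0 \<in> V; \<epsilon> > 0\<rbrakk> \<Longrightarrow>
          \<exists>N. openin (base U) N \<and> t0 \<in> N \<and> (\<forall>t\<in>N \<inter> V. gap A0 (\<phi> t0 (x t0)) (\<phi> t (x t)) < \<epsilon>)"
      show "openin (base U) {t}"
        by (rule contractible_imp_isolated[OF con univ t nonzero[OF t] VW(1-4) A0(1,2) A0(3)[OF _ tV]])
    qed
  qed
  then show disc: "base U = discrete_topology T"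
    using discrete_topology_unique[of T "base U"] by simp
  obtain e where e: "e \<in> carrier A" "\<And>a. a \<in> carrier A \<Longrightarrow> e \<otimes>\<^bsub>A\<^esub> a = a"
    using contractible_imp_identity[OF con univ banach_algebra_A] by metis
  obtain K where K: "compactin (base U) K" "\<forall>t \<in> T - K. \<bar>nrm (F t) (e t)\<bar> < 1"
    using e(1) unfolding A_iff vanishes_at_infinity_def by (meson zero_less_one)
  have "T \<subseteq> K"
  proof
    fix t assume t: "t \<in> T"
    interpret Ft: banach_algebra "F t"
      by (rule fibre_banach[OF t])
    have "1 \<le> nrm (F t) (e t)"
      by (rule Ft.nrm_identity_ge_1[OF A_carrier[OF e(1) t] identity_at[OF e t] nonzero[OF t]])
    then show "t \<in> K"
      using bspec[OF K(2), of t] t by auto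
  qed
  moreover have "finite K"
    using K(1) disc by (metis compactin_discrete_topology)
  ultimately show "finite T"
    by (rule finite_subset)
qed

section \<open>Finite direct sums of contractible algebras\<close>

lemma discrete_sections:
  assumes disc: "base U = discrete_topology T" and x: "x \<in> (\<Pi>\<^sub>E t\<in>T. carrier (F t))"
  shows "x \<in> sections U"
proof (rule sections_complete[OF x])
  fix t and \<epsilon> :: real assume t: "t \<in> T" and \<epsilon>: "\<epsilon> > 0"
  have xt: "x t \<in> carrier (F t)"
    using x t by auto
  obtain y where y: "y \<in> sections U" "gap (F t) (y t) (x t) < \<epsilon>"
    using sections_dense[OF t xt \<epsilon>] by blast
  have "gap (F t) (x t) (y t) \<le> \<epsilon>"
    using y(2) banach_space.gap_commute[OF fibre_space[OF t] xt sections_carrier[OF y(1) t]] by simp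
  moreover have "openin (base U) {t}"
    using t disc by (metis discrete_topology_unique)
  ultimately show "\<exists>y\<in>sections U. \<exists>V. openin (base U) V \<and> t \<in> V \<and> (\<forall>s\<in>V. gap (F s) (x s) (y s) \<le> \<epsilon>)"
    using y(1) by (intro bexI[of _ y] exI[of _ "{t}"]) simp_all
qed

lemma finite_discrete_carrier:
  assumes fin: "finite T" and disc: "base U = discrete_topology T"
  shows "carrier A = (\<Pi>\<^sub>E t\<in>T. carrier (F t))"
proof
  show "carrier A \<subseteq> (\<Pi>\<^sub>E t\<in>T. carrier (F t))"
    by (rule subsetI, rule sections_PiE) (simp add: A_iff)
  have "compactin (base U) T"
    using fin by (simp add: finite_imp_compactin)
  then have van: "vanishes_at_infinity (base U) f" for f
    unfolding vanishes_at_infinity_def by blast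
  show "(\<Pi>\<^sub>E t\<in>T. carrier (F t)) \<subseteq> carrier A"
    by (rule subsetI) (simp add: A_iff van discrete_sections[OF disc])
qed

definition point_section :: "'t \<Rightarrow> 'a \<Rightarrow> 't \<Rightarrow> 'a" where
  "point_section t c = (\<lambda>s\<in>T. if s = t then c else \<zero>\<^bsub>F s\<^esub>)"

definition restriction :: "'t set \<Rightarrow> ('t \<Rightarrow> 'a) \<Rightarrow> 't \<Rightarrow> 'a" where
  "restriction S x = (\<lambda>s\<in>T. if s \<in> S then x s else \<zero>\<^bsub>F s\<^esub>)"

lemma fibre_zero:
  assumes "t \<in> T"
  shows "\<zero>\<^bsub>F t\<^esub> \<in> carrier (F t)" "c \<in> carrier (F t) \<Longrightarrow> \<zero>\<^bsub>F t\<^esub> \<oplus>\<^bsub>F t\<^esub> c = c"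
    "c \<in> carrier (F t) \<Longrightarrow> c \<oplus>\<^bsub>F t\<^esub> \<zero>\<^bsub>F t\<^esub> = c"
    "z \<odot>\<^bsub>F t\<^esub> \<zero>\<^bsub>F t\<^esub> = \<zero>\<^bsub>F t\<^esub>" "nrm (F t) \<zero>\<^bsub>F t\<^esub> = 0"
proof -
  interpret Ft: banach_space "F t"
    by (rule fibre_space[OF assms(1)])
  show "\<zero>\<^bsub>F t\<^esub> \<in> carrier (F t)" "c \<in> carrier (F t) \<Longrightarrow> \<zero>\<^bsub>F t\<^esub> \<oplus>\<^bsub>F t\<^esub> c = c"
    "c \<in> carrier (F t) \<Longrightarrow> c \<oplus>\<^bsub>F t\<^esub> \<zero>\<^bsub>F t\<^esub> = c"
    "z \<odot>\<^bsub>F t\<^esub> \<zero>\<^bsub>F t\<^esub> = \<zero>\<^bsub>F t\<^esub>" "nrm (F t) \<zero>\<^bsub>F t\<^esub> = 0"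
    by simp_all
qed

lemma point_section_hom:
  assumes fin: "finite T" and disc: "base U = discrete_topology T" and t: "t \<in> T"
  shows "algebra_hom (F t) A (point_section t)"
proof -
  interpret Ft: banach_algebra "F t"
    by (rule fibre_banach[OF t])
  have car: "point_section t c \<in> carrier A" if "c \<in> carrier (F t)" for c
    unfolding finite_discrete_carrier[OF fin disc] using that fibre_zero(1) by (auto simp: point_section_def)
  have nrm: "nrm A (point_section t c) \<le> 1 * nrm (F t) c" if c: "c \<in> carrier (F t)" for c
    unfolding nrm_A using Ft.nrm_nonneg[OF c]
    by (intro nrm_linf_least) (auto simp: point_section_def fibre_zero)
  have eq: "x = y" if "x \<in> extensional T" "y \<in> extensional T" "\<And>s. s \<in> T \<Longrightarrow> x s = y s" for x y :: "'t \<Rightarrow> 'a"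
    using that by (rule A_eqI)
  show ?thesis
    unfolding algebra_hom_def bounded_linear_map_def
  proof (intro conjI ballI allI)
    show "point_section t \<in> carrier (F t) \<rightarrow> carrier A"
      using car by blast
    show "\<exists>C. \<forall>x\<in>carrier (F t). nrm A (point_section t x) \<le> C * nrm (F t) x"
      using nrm by blast
    fix c d assume "c \<in> carrier (F t)" "d \<in> carrier (F t)"
    show "point_section t (c \<oplus>\<^bsub>F t\<^esub> d) = point_section t c \<oplus>\<^bsub>A\<^esub> point_section t d"
      by (rule eq) (auto simp: point_section_def fibre_zero)
    show "point_section t (c \<otimes>\<^bsub>F t\<^esub> d) = point_section t c \<otimes>\<^bsub>A\<^esub> point_section t d"
      by (rule eq) (auto simp: point_section_def fibre_zero banach_algebra.zero_mult[OF fibre_banach])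
  next
    fix c z assume "c \<in> carrier (F t)"
    show "point_section t (z \<odot>\<^bsub>F t\<^esub> c) = z \<odot>\<^bsub>A\<^esub> point_section t c"
      by (rule eq) (auto simp: point_section_def fibre_zero)
  qed
qed

text \<open>
  A derivation is made inner on more and more points. Once it is the commutator with \<open>x\<close> on the
  sections supported in \<open>S\<close>, subtracting that commutator leaves a derivation that vanishes there, and
  contractibility of the fibre at a new point supplies a correction that commutes with the old
  sections.
\<close>

lemma finite_discrete_imp_contractible:
  assumes fin: "finite T" and disc: "base U = discrete_topology T"
    and con: "\<And>t. t \<in> T \<Longrightarrow> contractible_algebra TYPE('u) (F t)"
    and univ: "\<exists>h :: (nat \<Rightarrow> 'a \<times> complex) \<Rightarrow> 'u. inj h"
  shows "contractible_algebra TYPE('u) A"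
proof (rule inner_imp_contractible[OF banach_algebra_A])
  fix X :: "('t \<Rightarrow> 'a, 'u) bimodule" and D assume X: "banach_bimodule A X" and D: "derivation A X D"
  interpret banach_bimodule A X by (fact X)
  have Dl: "bounded_linear_map A X D"
    using D unfolding derivation_def by auto
  note car = finite_discrete_carrier[OF fin disc]
  have "\<exists>e. e \<in> carrier (F t) \<and> (\<forall>c\<in>carrier (F t). e \<otimes>\<^bsub>F t\<^esub> c = c \<and> c \<otimes>\<^bsub>F t\<^esub> e = c)" if t: "t \<in> T" for t
    using contractible_imp_identity[OF con[OF t] univ fibre_banach[OF t]] by metis
  then obtain e where e: "\<And>t. t \<in> T \<Longrightarrow> e t \<in> carrier (F t)"
    "\<And>t c. \<lbrakk>t \<in> T; c \<in> carrier (F t)\<rbrakk> \<Longrightarrow> e t \<otimes>\<^bsub>F t\<^esub> c = c"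
    "\<And>t c. \<lbrakk>t \<in> T; c \<in> carrier (F t)\<rbrakk> \<Longrightarrow> c \<otimes>\<^bsub>F t\<^esub> e t = c"
    by metis
  have rest: "restriction S x \<in> carrier A" if "\<And>t. t \<in> T \<Longrightarrow> x t \<in> carrier (F t)" for S x
    unfolding car using that fibre_zero(1) by (auto simp: restriction_def)
  have pt: "point_section t c \<in> carrier A" if "c \<in> carrier (F t)" for t c
    unfolding car using that fibre_zero(1) by (auto simp: point_section_def)
  have "\<exists>x\<in>carrier X. \<forall>a\<in>carrier A. (\<forall>s\<in>T - S. a s = \<zero>\<^bsub>F s\<^esub>) \<longrightarrow> D a = commutator X x a"
    if S: "finite S" "S \<subseteq> T" for S
    using S
  proof (induction S rule: finite_induct)
    case empty
    have "D a = commutator X \<zero>\<^bsub>X\<^esub> a" if a: "a \<in> carrier A" "\<forall>s\<in>T - {}. a s = \<zero>\<^bsub>F s\<^esub>" for a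
    proof -
      have "a = \<zero>\<^bsub>A\<^esub>"
        by (rule A_eqI) (use a A_extensional in auto)
      then have "0 \<odot>\<^bsub>A\<^esub> a = a"
        using B.sm_0[OF a(1)] by (simp only:)
      then have "D a = \<zero>\<^bsub>X\<^esub>"
        using bounded_linear_mapD(3)[OF Dl a(1), of 0] X.sm_0[OF bounded_linear_mapD(1)[OF Dl a(1)]]
        by (simp only:)
      then show ?thesis
        using a(1) by (simp add: commutator_def)
    qed
    then show ?case
      by blast
  next
    case (insert t S)
    have t: "t \<in> T" and ST: "S \<subseteq> T" and tS: "t \<notin> S"
      using insert by auto
    interpret Ft: banach_algebra "F t"
      by (rule fibre_banach[OF t])
    obtain x where x: "x \<in> carrier X"
      "\<And>a. \<lbrakk>a \<in> carrier A; \<forall>s\<in>T - S. a s = \<zero>\<^bsub>F s\<^esub>\<rbrakk> \<Longrightarrow> D a = commutator X x a"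
      using insert.IH[OF ST] by blast
    define D' where "D' a = D a \<oplus>\<^bsub>X\<^esub> (- 1) \<odot>\<^bsub>X\<^esub> commutator X x a" for a
    have D': "derivation A X D'"
      unfolding D'_def by (rule derivation_diff[OF D derivation_commutator[OF x(1)]])
    have D'l: "bounded_linear_map A X D'"
      using D' unfolding derivation_def by auto
    have D'0: "D' a = \<zero>\<^bsub>X\<^esub>" if "a \<in> carrier A" "\<forall>s\<in>T - S. a s = \<zero>\<^bsub>F s\<^esub>" for a
      using x(2)[OF that] x(1) that(1) by (simp add: D'_def)
    have "inner_derivation (F t) (pullback (point_section t) X) (\<lambda>c. D' (point_section t c))"
      by (rule contractible_imp_inner[OF con[OF t] univ banach_bimodule_pullback derivation_pullback])
        (rule Ft.banach_algebra_axioms X point_section_hom[OF fin disc t] D')+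
    then obtain \<eta> where \<eta>: "\<eta> \<in> carrier X"
      "\<And>c. c \<in> carrier (F t) \<Longrightarrow> D' (point_section t c) = commutator X \<eta> (point_section t c)"
      unfolding inner_derivation_def by (auto simp: pullback_def commutator_def)
    define eS where "eS = restriction S e"
    have eS: "eS \<in> carrier A" "D' eS = \<zero>\<^bsub>X\<^esub>"
    proof -
      show "eS \<in> carrier A"
        unfolding eS_def by (rule rest[OF e(1)])
      then show "D' eS = \<zero>\<^bsub>X\<^esub>"
        by (rule D'0) (simp add: eS_def restriction_def)
    qed
    define \<zeta> where "\<zeta> = \<eta> \<oplus>\<^bsub>X\<^esub> (- 1) \<odot>\<^bsub>X\<^esub> lact X eS \<eta>"
    define \<xi> where "\<xi> = \<zeta> \<oplus>\<^bsub>X\<^esub> (- 1) \<odot>\<^bsub>X\<^esub> ract X \<zeta> eS"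
    note cut = commutator_cut[OF D' eS \<eta>(1) \<zeta>_def \<xi>_def]
    have "D a = commutator X (\<xi> \<oplus>\<^bsub>X\<^esub> x) a" if a: "a \<in> carrier A" "\<forall>s\<in>T - insert t S. a s = \<zero>\<^bsub>F s\<^esub>" for a
    proof -
      note ac = A_carrier[OF a(1)]
      define b where "b = restriction S a"
      define c where "c = point_section t (a t)"
      have b: "b \<in> carrier A" and c: "c \<in> carrier A"
        unfolding b_def c_def using ac t by (simp_all only: rest pt)
      have abc: "a = b \<oplus>\<^bsub>A\<^esub> c"
        by (rule A_eqI) (use a A_extensional ac tS in \<open>auto simp: b_def c_def restriction_def point_section_def fibre_zero\<close>)
      have b0: "D' b = \<zero>\<^bsub>X\<^esub>"
        by (rule D'0[OF b]) (simp add: b_def restriction_def)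
      have "eS \<otimes>\<^bsub>A\<^esub> b = b" "b \<otimes>\<^bsub>A\<^esub> eS = b"
        using ST by (auto intro!: A_eqI simp: eS_def b_def restriction_def e ac fibre_zero banach_algebra.zero_mult[OF fibre_banach])
      then have \<xi>b: "commutator X \<xi> b = \<zero>\<^bsub>X\<^esub>"
        by (rule cut(2)[OF b])
      have "eS \<otimes>\<^bsub>A\<^esub> c = \<zero>\<^bsub>A\<^esub>" "c \<otimes>\<^bsub>A\<^esub> eS = \<zero>\<^bsub>A\<^esub>"
        using tS by (auto intro!: A_eqI simp: eS_def c_def restriction_def point_section_def e ac fibre_zero banach_algebra.zero_mult[OF fibre_banach])
      then have \<xi>c: "commutator X \<xi> c = D' c"
        by (rule cut(3)[OF c]) (simp add: c_def \<eta>(2) ac t)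
      have D'c: "D' c \<in> carrier X"
        by (rule bounded_linear_mapD(1)[OF D'l c])
      have \<xi>l: "bounded_linear_map A X (commutator X \<xi>)"
        using derivation_commutator[OF cut(1)] unfolding derivation_def by blast
      have "D' a = commutator X \<xi> a"
        unfolding abc bounded_linear_mapD(2)[OF D'l b c] bounded_linear_mapD(2)[OF \<xi>l b c] b0 \<xi>b \<xi>c ..
      then have "D a = commutator X \<xi> a \<oplus>\<^bsub>X\<^esub> commutator X x a"
        unfolding D'_def using bounded_linear_mapD(1)[OF Dl a(1)] x(1) a(1)
        by (metis X.M.a_assoc X.cancel_neg(2) X.M.r_zero X.smult_mem commutator_closed)
      then show ?thesis
        using cut(1) x(1) a(1) by (simp add: commutator_def lact_add ract_add X.sm_plus X.M.a_ac)
    qed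
    then show ?case
      using cut(1) x(1) by blast
  qed
  from this[OF fin] show "inner_derivation A X D"
    unfolding inner_derivation_def by auto
qed

end

section \<open>Contractibility, the base space and cohomology\<close>

theorem theorem5p2:
  fixes U :: "('t, 'a) banach_field"
  assumes field: "continuous_field U"
    and loc_triv: "locally_trivial U"
    and nonzero: "\<And>x. x \<in> topspace (base U) \<Longrightarrow> carrier (fibre U x) \<noteq> {\<zero>\<^bsub>fibre U x\<^esub>}"
    and univ: "\<exists>h :: (nat \<Rightarrow> ('t \<Rightarrow> 'a) \<times> complex) \<Rightarrow> 'u. inj h"
  shows "(contractible_algebra TYPE('u) (field_algebra U) \<longleftrightarrow>
      finite (topspace (base U)) \<and> base U = discrete_topology (topspace (base U)) \<and>
      (\<forall>x\<in>topspace (base U). contractible_algebra TYPE('u) (fibre U x))) \<and>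
    (contractible_algebra TYPE('u) (field_algebra U) \<longleftrightarrow>
      (\<forall>X :: ('t \<Rightarrow> 'a, 'u) bimodule. banach_bimodule (field_algebra U) X \<longrightarrow>
        (\<forall>n\<ge>1. trivial_group (hochschild_cohomology (field_algebra U) X n))))"
proof
  interpret cts_field U
    by unfold_locales (rule field)
  obtain h :: "(nat \<Rightarrow> ('t \<Rightarrow> 'a) \<times> complex) \<Rightarrow> 'u" where h: "inj h"
    using univ by blast
  \<comment> \<open>Elements of a fibre become constant functions, so the universe also has room for the modules of the fibres.\<close>
  have "inj (\<lambda>f :: nat \<Rightarrow> 'a \<times> complex. h (\<lambda>n. (\<lambda>_. fst (f n), snd (f n))))"
  proof (rule injI)
    fix f g :: "nat \<Rightarrow> 'a \<times> complex"
    assume "h (\<lambda>n. (\<lambda>_. fst (f n), snd (f n))) = h (\<lambda>n. (\<lambda>_. fst (g n), snd (g n)))"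
    then have "(\<lambda>n. (\<lambda>_ :: 't. fst (f n), snd (f n))) = (\<lambda>n. (\<lambda>_. fst (g n), snd (g n)))"
      by (rule injD[OF h])
    then show "f = g"
      by (auto simp: fun_eq_iff prod_eq_iff)
  qed
  then have univ': "\<exists>h :: (nat \<Rightarrow> 'a \<times> complex) \<Rightarrow> 'u. inj h"
    by blast
  show "contractible_algebra TYPE('u) (field_algebra U) \<longleftrightarrow>
      finite (topspace (base U)) \<and> base U = discrete_topology (topspace (base U)) \<and>
      (\<forall>x\<in>topspace (base U). contractible_algebra TYPE('u) (fibre U x))"
  proof
    assume con: "contractible_algebra TYPE('u) (field_algebra U)"
    show "finite (topspace (base U)) \<and> base U = discrete_topology (topspace (base U)) \<and>
        (\<forall>x\<in>topspace (base U). contractible_algebra TYPE('u) (fibre U x))"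
      by (intro conjI ballI contractible_imp_finite_discrete[OF con univ loc_triv nonzero])
  next
    assume "finite (topspace (base U)) \<and> base U = discrete_topology (topspace (base U)) \<and>
      (\<forall>x\<in>topspace (base U). contractible_algebra TYPE('u) (fibre U x))"
    then show "contractible_algebra TYPE('u) (field_algebra U)"
      by (intro finite_discrete_imp_contractible[OF _ _ _ univ']) blast+
  qed
  show "contractible_algebra TYPE('u) (field_algebra U) \<longleftrightarrow>
      (\<forall>X :: ('t \<Rightarrow> 'a, 'u) bimodule. banach_bimodule (field_algebra U) X \<longrightarrow>
        (\<forall>n\<ge>1. trivial_group (hochschild_cohomology (field_algebra U) X n)))"
    by (rule contractible_iff_cohomology_trivial[OF banach_algebra_A univ])
qed

end
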